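(* Let $d\geq 4$, and let $n_3,\ldots,n_{d-1}\geq 5$ and $m_{d-1}\geq 5$ be integers. Then there exists a finite alternating semiregular $d$-polytope $\mathcal S$ with the following properties. (a) $\mathcal S$ is of type $$\left\{\{4,4\}^{(n_3)},\ldots,\{4,4\}^{(n_{d-3})},\{4,4\}^{(n_{d-2})},\ \begin{array}{l}\{4,4\}^{(n_{d-1})}\\ \{4,4\}^{(m_{d-1})}\end{array}\right\}$$ (to be read as $\left\{\begin{array}{l}\{4,4\}^{(n_{3})}\\ \{4,4\}^{(m_{3})}\end{array}\right\}$ if $d=4$). (b) The automorphism group of $\mathcal S$ is a 2-group; it has order $$2^{\,n_3+n_4+\cdots+n_{d-2}+n_{d-1}+m_{d-1}-3(d-3)}$$ if $n_{d-1}\neq m_{d-1}$, and twice this order if $n_{d-1}=m_{d-1}$.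
   Context: **Polytopes.** An (abstract) polytope of rank $d$ (a $d$-polytope) is a partially ordered set $\mathcal P$ with a strictly monotone rank function with values in $\{-1,0,\ldots,d\}$, having a unique least face $F_{-1}$ (rank $-1$) and a unique greatest face $F_d$ (rank $d$), such that: every flag (maximal totally ordered subset) has exactly $d+2$ faces, one of each rank; $\mathcal P$ is strongly flag-connected (any two flags $\Phi,\Psi$ are joined by a finite sequence of flags, each containing $\Phi\cap\Psi$, in which successive flags are adjacent, i.e. differ in exactly one face); and the diamond condition holds (if $F\le G$ have ranks $j-1$ and $j+1$, there are exactly two $j$-faces $H$ with $F\le H\le G$). Elements of rank $j$ are $j$-faces; $0$-faces are vertices, $(d-1)$-faces are facets. For $F\le G$, the section $G/F=\{H: F\le H\le G\}$ is a polytope of rank $\operatorname{rank}G-\operatorname{rank}F-1$; a face $F$ is identified with the section $F/F_{-1}$. $\mathcal P$ is regular if its automorphism group $\Gamma(\mathcal P)$ is transitive on flags. **Semiregular polytopes.** A $d$-polytope $\mathcal S$ is semiregular if its facets are regular and $\Gamma(\mathcal S)$ is transitive on vertices. It is alternating semiregular if moreover its facets are of two kinds $\mathcal P$ and $\mathcal Q$ (both regular) which occur in alternating fashion around any $(d-3)$-face of $\mathcal S$. The case $\mathcal P\cong\mathcal Q$ is allowed, with the meaning that $\Gamma(\mathcal S)$ has a subgroup of index 2 with only two facet orbits such that the facet orbits occur in alternating fashion around any $(d-3)$-face of $\mathcal S$. **Toroidal polyhedra.** For $s\ge2,\ t=0$ or $s=t\ge 2$, $\{4,4\}_{(s,t)}$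 is the regular 3-polytope obtained as the quotient of the square tessellation of the plane with vertex set $\mathbb Z^2$ by the lattice spanned by $(s,t)$ and $(-t,s)$. For $n\ge5$, $\{4,4\}^{(n)}$ denotes $\{4,4\}_{(2^e,0)}$ if $n=2e+3$ is odd and $\{4,4\}_{(2^e,2^e)}$ if $n=2e+4$ is even; its automorphism group has order $2^n$. **Types.** A regular $c$-polytope with base flag $\{F_{-1},\ldots,F_c\}$ is of type (has symbol) $\{\mathcal P_3,\ldots,\mathcal P_c\}$, where the $\mathcal P_j$ are regular 3-polytopes, if the section $F_j/F_{j-4}$ is isomorphic to $\mathcal P_j$ for each $j=3,\ldots,c$. An alternating semiregular $d$-polytope $\mathcal S$ is of the type displayed in (a) if its two kinds of regular facets $\mathcal P$ and $\mathcal Q$ (of rank $d-1$) have symbols $$\{\{4,4\}^{(n_3)},\ldots,\{4,4\}^{(n_{d-2})},\{4,4\}^{(n_{d-1})}\}\quad\text{and}\quad \{\{4,4\}^{(n_3)},\ldots,\{4,4\}^{(n_{d-2})},\{4,4\}^{(m_{d-1})}\},$$ respectively, and meet along common $(d-2)$-faces with symbol $\{\{4,4\}^{(n_3)},\ldots,\{4,4\}^{(n_{d-2})}\}$ if $d\ge5$, and along 2-faces which are 4-gons $\{4\}$ if $d=4$. (For $d=4$ the facets are $\{4,4\}^{(n_3)}$ and $\{4,4\}^{(m_3)}$.) *)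

theory Defs
  imports "HOL-Algebra.Algebra"
begin

section \<open>Abstract polytopes\<close>

text \<open>A poset is a relation \<open>r\<close> that is a partial order on its field; \<open>(F, G) \<in> r\<close> reads
  \<open>F \<le> G\<close>. The elements of \<open>Field r\<close> are the faces.\<close>

definition flags :: "'a rel \<Rightarrow> 'a set set" where
  "flags r = {\<Phi> \<in> Chains r. \<forall>\<Psi> \<in> Chains r. \<Phi> \<subseteq> \<Psi> \<longrightarrow> \<Psi> = \<Phi>}"

definition adjacent_flags :: "'a set \<Rightarrow> 'a set \<Rightarrow> bool" where
  "adjacent_flags \<Phi> \<Psi> \<longleftrightarrow> card (\<Phi> - \<Psi>) = 1 \<and> card (\<Psi> - \<Phi>) = 1"

text \<open>Ranks are integers because the least face has rank \<open>-1\<close>. The values of \<open>rk\<close> outside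
  \<open>Field r\<close> are irrelevant.\<close>

locale abstract_polytope =
  fixes d :: int and r :: "'a rel" and rk :: "'a \<Rightarrow> int"
  assumes partial_order: "Partial_order r"
    and rank_range: "F \<in> Field r \<Longrightarrow> rk F \<in> {-1..d}"
    and rank_strict_mono: "(F, G) \<in> r \<Longrightarrow> F \<noteq> G \<Longrightarrow> rk F < rk G"
    and least_face: "\<exists>F \<in> Field r. rk F = -1 \<and> (\<forall>G \<in> Field r. (F, G) \<in> r)"
    and greatest_face: "\<exists>F \<in> Field r. rk F = d \<and> (\<forall>G \<in> Field r. (G, F) \<in> r)"
    and flag_ranks: "\<Phi> \<in> flags r \<Longrightarrow> bij_betw rk \<Phi> {-1..d}"
    and strongly_flag_connected: "\<Phi> \<in> flags r \<Longrightarrow> \<Psi> \<in> flags r \<Longrightarrow>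
      (\<Phi>, \<Psi>) \<in> {(A, B). A \<in> flags r \<and> B \<in> flags r \<and> adjacent_flags A B
                  \<and> \<Phi> \<inter> \<Psi> \<subseteq> A \<and> \<Phi> \<inter> \<Psi> \<subseteq> B}\<^sup>*"
    and diamond: "(F, G) \<in> r \<Longrightarrow> rk F = j - 1 \<Longrightarrow> rk G = j + 1 \<Longrightarrow>
      card {H \<in> Field r. rk H = j \<and> (F, H) \<in> r \<and> (H, G) \<in> r} = 2"

definition faces_of_rank :: "'a rel \<Rightarrow> ('a \<Rightarrow> int) \<Rightarrow> int \<Rightarrow> 'a set" where
  "faces_of_rank r rk j = {F \<in> Field r. rk F = j}"

definition poly_section :: "'a rel \<Rightarrow> 'a \<Rightarrow> 'a \<Rightarrow> 'a rel" where
  "poly_section r F G = Restr r (above r F \<inter> under r G)"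

text \<open>The section \<open>G/F\<^sub>-\<^sub>1\<close>, with which the face \<open>G\<close> is identified. Since the least face has
  rank \<open>-1\<close>, the rank function of a polytope is also the rank function of each such section.\<close>

definition face_poset :: "'a rel \<Rightarrow> 'a \<Rightarrow> 'a rel" where
  "face_poset r G = Restr r (under r G)"

definition poset_isos :: "'a rel \<Rightarrow> 'b rel \<Rightarrow> ('a \<Rightarrow> 'b) set" where
  "poset_isos r s = {f. bij_betw f (Field r) (Field s) \<and>
     (\<forall>F \<in> Field r. \<forall>G \<in> Field r. (F, G) \<in> r \<longleftrightarrow> (f F, f G) \<in> s)}"

definition isomorphic_posets :: "'a rel \<Rightarrow> 'b rel \<Rightarrow> bool" where
  "isomorphic_posets r s \<longleftrightarrow> poset_isos r s \<noteq> {}"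

text \<open>As in \<^const>\<open>AutoGroup\<close>, automorphisms are extensional functions, so that each is counted
  once.\<close>

definition aut_group :: "'a rel \<Rightarrow> ('a \<Rightarrow> 'a) monoid" where
  "aut_group r = BijGroup (Field r) \<lparr>carrier := Bij (Field r) \<inter> poset_isos r r\<rparr>"

definition regular_polytope :: "int \<Rightarrow> 'a rel \<Rightarrow> ('a \<Rightarrow> int) \<Rightarrow> bool" where
  "regular_polytope d r rk \<longleftrightarrow> abstract_polytope d r rk \<and>
     (\<forall>\<Phi> \<in> flags r. \<forall>\<Psi> \<in> flags r. \<exists>f \<in> carrier (aut_group r). f ` \<Phi> = \<Psi>)"


section \<open>Semiregular polytopes\<close>

definition semiregular_polytope :: "int \<Rightarrow> 'a rel \<Rightarrow> ('a \<Rightarrow> int) \<Rightarrow> bool" where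
  "semiregular_polytope d r rk \<longleftrightarrow> abstract_polytope d r rk \<and>
     (\<forall>G \<in> faces_of_rank r rk (d - 1). regular_polytope (d - 1) (face_poset r G) rk) \<and>
     (\<forall>u \<in> faces_of_rank r rk 0. \<forall>v \<in> faces_of_rank r rk 0.
        \<exists>f \<in> carrier (aut_group r). f u = v)"

text \<open>For a \<open>(d-3)\<close>-face \<open>F\<close>, the facets and the \<open>(d-2)\<close>-faces above \<open>F\<close> are cyclically arranged
  (the co-face at \<open>F\<close> is a polygon), consecutive facets being those that share a \<open>(d-2)\<close>-face
  above \<open>F\<close>. The two classes of facets alternate around \<open>F\<close> if consecutive facets always lie
  in different classes.\<close>

definition alternate_around ::
  "int \<Rightarrow> 'a rel \<Rightarrow> ('a \<Rightarrow> int) \<Rightarrow> 'a set \<Rightarrow> 'a set \<Rightarrow> 'a \<Rightarrow> bool" where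
  "alternate_around d r rk A B F \<longleftrightarrow>
     (\<forall>H \<in> faces_of_rank r rk (d - 2).
      \<forall>G \<in> faces_of_rank r rk (d - 1). \<forall>G' \<in> faces_of_rank r rk (d - 1).
        (F, H) \<in> r \<and> (H, G) \<in> r \<and> (H, G') \<in> r \<and> G \<noteq> G' \<longrightarrow>
        G \<in> A \<and> G' \<in> B \<or> G \<in> B \<and> G' \<in> A)"

text \<open>\<open>A\<close> and \<open>B\<close> are the sets of facets of the two kinds. Either they are told apart by their
  isomorphism types, or all facets are isomorphic and \<open>A\<close>, \<open>B\<close> are the two facet orbits of a
  subgroup of index 2 in the automorphism group.\<close>

definition alternating_semiregular ::
  "int \<Rightarrow> 'a rel \<Rightarrow> ('a \<Rightarrow> int) \<Rightarrow> 'a set \<Rightarrow> 'a set \<Rightarrow> bool" where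
  "alternating_semiregular d r rk A B \<longleftrightarrow>
     semiregular_polytope d r rk \<and>
     A \<noteq> {} \<and> B \<noteq> {} \<and> A \<inter> B = {} \<and> A \<union> B = faces_of_rank r rk (d - 1) \<and>
     (\<forall>F \<in> faces_of_rank r rk (d - 3). alternate_around d r rk A B F) \<and>
     (\<forall>G \<in> A. \<forall>G' \<in> A. isomorphic_posets (face_poset r G) (face_poset r G')) \<and>
     (\<forall>G \<in> B. \<forall>G' \<in> B. isomorphic_posets (face_poset r G) (face_poset r G')) \<and>
     ((\<forall>G \<in> A. \<forall>G' \<in> B. \<not> isomorphic_posets (face_poset r G) (face_poset r G')) \<or>
      (\<forall>G \<in> A. \<forall>G' \<in> B. isomorphic_posets (face_poset r G) (face_poset r G')) \<and>
      (\<exists>N. subgroup N (aut_group r) \<and> card (rcosets\<^bsub>aut_group r\<^esub> N) = 2 \<and>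
           orbits (aut_group r \<lparr>carrier := N\<rparr>) (faces_of_rank r rk (d - 1)) (\<lambda>f. f) = {A, B}))"


section \<open>Toroidal polyhedra\<close>

text \<open>The faces of the square tessellation are represented by their sets of vertices,
  together with the least face \<open>{}\<close> and the greatest face \<open>UNIV\<close>.\<close>

definition unit_square :: "int \<Rightarrow> int \<Rightarrow> (int \<times> int) set" where
  "unit_square x y = {x, x + 1} \<times> {y, y + 1}"

definition tessellation_faces :: "(int \<times> int) set set" where
  "tessellation_faces =
     {{}, UNIV} \<union> {{(x, y)} | x y. True}
     \<union> {{(x, y), (x + 1, y)} | x y. True} \<union> {{(x, y), (x, y + 1)} | x y. True}
     \<union> {unit_square x y | x y. True}"

definition square_tessellation :: "(int \<times> int) set rel" where
  "square_tessellation = relation_of (\<subseteq>) tessellation_faces"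

definition torus_lattice :: "int \<Rightarrow> int \<Rightarrow> (int \<times> int) set" where
  "torus_lattice s t = {(i * s - j * t, i * t + j * s) | i j. True}"

definition lattice_equiv :: "int \<Rightarrow> int \<Rightarrow> (int \<times> int) set rel" where
  "lattice_equiv s t = {(A, B). A \<in> tessellation_faces \<and> B \<in> tessellation_faces \<and>
     (\<exists>(a, b) \<in> torus_lattice s t. B = (\<lambda>(x, y). (x + a, y + b)) ` A)}"

text \<open>The polyhedron \<open>{4,4}\<^sub>(\<^sub>s\<^sub>,\<^sub>t\<^sub>)\<close>: lattice orbits of faces, two orbits being incident if they
  have incident representatives.\<close>

definition torus_map :: "int \<Rightarrow> int \<Rightarrow> (int \<times> int) set set rel" where
  "torus_map s t = relation_of (\<lambda>U V. \<exists>A \<in> U. \<exists>B \<in> V. (A, B) \<in> square_tessellation)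
                     (tessellation_faces // lattice_equiv s t)"

text \<open>The polyhedron \<open>{4,4}\<^sup>(\<^sup>n\<^sup>)\<close>, for \<open>n \<ge> 5\<close>.\<close>

definition torus44 :: "nat \<Rightarrow> (int \<times> int) set set rel" where
  "torus44 n = (if odd n then torus_map (2 ^ ((n - 3) div 2)) 0
                else torus_map (2 ^ ((n - 4) div 2)) (2 ^ ((n - 4) div 2)))"

definition four_gon :: "(int \<times> int) set rel" where
  "four_gon = face_poset square_tessellation (unit_square 0 0)"


section \<open>Types\<close>

text \<open>\<open>r\<close> is a regular \<open>c\<close>-polytope with symbol \<open>{P\<^sub>3, \<dots>, P\<^sub>c}\<close>; values of \<open>P\<close> outside
  \<open>{3..c}\<close> are irrelevant. By regularity the choice of the base flag \<open>\<Phi>\<close> does not matter.\<close>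

definition has_symbol ::
  "nat \<Rightarrow> 'a rel \<Rightarrow> ('a \<Rightarrow> int) \<Rightarrow> (nat \<Rightarrow> 'b rel) \<Rightarrow> bool" where
  "has_symbol c r rk P \<longleftrightarrow> regular_polytope (int c) r rk \<and>
     (\<exists>\<Phi> \<in> flags r. \<forall>j \<in> {3..c}. \<forall>F \<in> \<Phi>. \<forall>G \<in> \<Phi>. rk F = int j - 4 \<and> rk G = int j \<longrightarrow>
        isomorphic_posets (poly_section r F G) (P j))"

text \<open>The kinds \<open>A\<close> and \<open>B\<close> have symbols with entries \<open>{4,4}\<^sup>(\<^sup>k\<^sup>)\<close> for \<open>k = n 3, \<dots>, n (d - 2), n (d - 1)\<close>
  and \<open>k = n 3, \<dots>, n (d - 2), m\<close>, respectively. For \<open>d = 4\<close> the facets meet along 4-gons.\<close>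

definition has_alternating_type ::
  "nat \<Rightarrow> 'a rel \<Rightarrow> ('a \<Rightarrow> int) \<Rightarrow> 'a set \<Rightarrow> 'a set \<Rightarrow> (nat \<Rightarrow> nat) \<Rightarrow> nat \<Rightarrow> bool" where
  "has_alternating_type d r rk A B n m \<longleftrightarrow>
     (\<forall>G \<in> A. has_symbol (d - 1) (face_poset r G) rk (\<lambda>j. torus44 (n j))) \<and>
     (\<forall>G \<in> B. has_symbol (d - 1) (face_poset r G) rk (\<lambda>j. torus44 ((n(d - 1 := m)) j))) \<and>
     (\<forall>G \<in> A. \<forall>G' \<in> B. \<forall>H \<in> faces_of_rank r rk (int d - 2). (H, G) \<in> r \<and> (H, G') \<in> r \<longrightarrow>
        (if d = 4 then isomorphic_posets (face_poset r H) four_gon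
         else has_symbol (d - 2) (face_poset r H) rk (\<lambda>j. torus44 (n j))))"

definition p_group :: "nat \<Rightarrow> ('a, 'b) monoid_scheme \<Rightarrow> bool" where
  "p_group p G \<longleftrightarrow> group G \<and> (\<forall>x \<in> carrier G. \<exists>k. group.ord G x = p ^ k)"

end

theory Submission
  imports Defs "HOL-Library.Product_Plus"
begin

text \<open>The polytope is read off from a group. Let \<open>\<Gamma>\<^sub>n\<close> be the group of \<open>{4,4}\<^sup>(\<^sup>n\<^sup>)\<close>, of order \<open>2\<^sup>n\<close>, with
involutory generators \<open>r\<^sub>0, r\<^sub>1, r\<^sub>2\<close>. Because the lattice of \<open>{4,4}\<^sup>(\<^sup>n\<^sup>)\<close> is so even, killing \<open>r\<^sub>2\<close> maps
\<open>\<Gamma>\<^sub>n\<close> onto the group \<open>D\<close> of the square, and this map is injective on \<open>\<langle>r\<^sub>0, r\<^sub>1\<rangle>\<close>; killing \<open>r\<^sub>0\<close> also maps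
onto \<open>D\<close>, injectively on \<open>\<langle>r\<^sub>1, r\<^sub>2\<rangle>\<close>. So polyhedra can be glued along squares as economically as
possible: if a group \<open>G\<close> has a homomorphism \<open>\<sigma>\<close> onto \<open>D\<close> that is injective on the subgroup of
two generators \<open>\<rho>\<^sub>a, \<rho>\<^sub>b\<close>, then the fibre product of \<open>G\<close> and \<open>\<Gamma>\<^sub>n\<close> over \<open>D\<close> has one more generator and
order \<open>|G| 2\<^bsup>n-3\<^esup>\<close>, and \<open>\<rho>\<^sub>a, \<rho>\<^sub>b\<close> and the new generator span a copy of \<open>\<Gamma>\<^sub>n\<close>.

Starting from \<open>D\<close> itself and gluing on \<open>\<Gamma>\<^bsub>n 3\<^esub>, \<dots>, \<Gamma>\<^bsub>n (d - 2)\<^esub>\<close>, each time along the last two generators,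
gives the group of a regular polytope with symbol \<open>{4,4}\<^bsup>(n 3)\<^esup>, \<dots>, {4,4}\<^bsup>(n (d-2))\<^esup>\<close> (lemma \<open>string_group\<close>).
To it \<open>\<Gamma>\<^bsub>n (d - 1)\<^esub>\<close> and \<open>\<Gamma>\<^sub>m\<close> are glued along the same two generators. The two last generators
\<open>\<alpha>, \<beta>\<close> commute, and omitting \<open>\<beta>\<close> or \<open>\<alpha>\<close> leaves the groups of the two kinds of facets.

The faces of the polytope are cosets of the subgroups generated by all generators but one, except
in the two highest proper ranks, where \<open>\<alpha>\<close> and \<open>\<beta>\<close> share their role. A flag is thus a pair of a group
element and a bit that says to which kind its facet belongs. Everything follows from the
intersection property \<open>\<langle>\<rho>\<^sub>i | i \<in> I\<rangle> \<inter> \<langle>\<rho>\<^sub>i | i \<in> J\<rangle> = \<langle>\<rho>\<^sub>i | i \<in> I \<inter> J\<rangle>\<close>, which for a fibre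
product is inherited from the factors because its parabolic subgroups can be recognised componentwise
(lemma \<open>par'_iff\<close>), and for \<open>\<Gamma>\<^sub>n\<close> holds because the subgroups in question are the stabilisers of faces
of the square tessellation.

An automorphism is determined by the image of one flag, and left multiplications already realise
every flag whose facet has the same kind. If \<open>n (d - 1) \<noteq> m\<close>, the facets of the two kinds have
different numbers of flags, so there are no other automorphisms; if \<open>n (d - 1) = m\<close>, exchanging the
last two factors is an automorphism that exchanges the kinds, and the order doubles.\<close>

section \<open>Polytopes from chamber systems\<close>

text \<open>Chambers stand for flags: \<open>\<phi> x i\<close> is the face of rank \<open>i\<close> of the chamber \<open>x\<close>, and faces are comparable
when they belong to a common chamber.\<close>

definition flag_rel :: "'x set \<Rightarrow> ('x \<Rightarrow> int \<Rightarrow> 'a) \<Rightarrow> int \<Rightarrow> 'a rel" where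
  "flag_rel \<Omega> \<phi> d = {(\<phi> x i, \<phi> x j) | x i j. x \<in> \<Omega> \<and> -1 \<le> i \<and> i \<le> j \<and> j \<le> d}"

lemma flag_relI: "x \<in> \<Omega> \<Longrightarrow> -1 \<le> i \<Longrightarrow> i \<le> j \<Longrightarrow> j \<le> d \<Longrightarrow> (\<phi> x i, \<phi> x j) \<in> flag_rel \<Omega> \<phi> d"
  unfolding flag_rel_def by blast

lemma Field_flag_rel: "Field (flag_rel \<Omega> \<phi> d) = {\<phi> x i | x i. x \<in> \<Omega> \<and> i \<in> {-1..d}}"
  unfolding Field_def flag_rel_def by (auto simp: Domain_iff Range_iff) (metis order_trans order_refl)+

lemma face_poset_eq_section:
  assumes "\<And>G. G \<in> Field r \<Longrightarrow> (F, G) \<in> r"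
  shows "face_poset r G = poly_section r F G"
proof -
  have "under r G \<subseteq> above r F" using assms by (auto simp: under_def above_def Field_def)
  then show ?thesis unfolding face_poset_def poly_section_def by (simp add: Int_absorb1)
qed

text \<open>A map of chambers that respects the relation "same face of rank \<open>i\<close>" in both directions is an
isomorphism of posets. The isomorphisms constructed below arise in this way: from group automorphisms,
from left multiplications, and from projections to one toroidal factor.\<close>

lemma flag_rel_isomorphism:
  fixes f :: "'x \<Rightarrow> 'y"
  assumes rk: "\<And>x i. x \<in> \<Omega> \<Longrightarrow> i \<in> {-1..d} \<Longrightarrow> rk (\<phi> x i) = i"
    and rk': "\<And>y i. y \<in> \<Omega>' \<Longrightarrow> i \<in> {-1..d} \<Longrightarrow> rk' (\<psi> y i) = i"
    and onto: "f ` \<Omega> = \<Omega>'"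
    and eq: "\<And>x y i. x \<in> \<Omega> \<Longrightarrow> y \<in> \<Omega> \<Longrightarrow> i \<in> {-1..d} \<Longrightarrow> \<psi> (f x) i = \<psi> (f y) i \<longleftrightarrow> \<phi> x i = \<phi> y i"
  obtains h where "h \<in> poset_isos (flag_rel \<Omega> \<phi> d) (flag_rel \<Omega>' \<psi> d)"
    and "\<And>x i. x \<in> \<Omega> \<Longrightarrow> i \<in> {-1..d} \<Longrightarrow> h (\<phi> x i) = \<psi> (f x) i"
proof -
  define h where "h F = \<psi> (f (SOME x. x \<in> \<Omega> \<and> \<phi> x (rk F) = F)) (rk F)" for F
  have h: "h (\<phi> x i) = \<psi> (f x) i" if x: "x \<in> \<Omega>" and i: "i \<in> {-1..d}" for x i
  proof -
    let ?y = "SOME y. y \<in> \<Omega> \<and> \<phi> y i = \<phi> x i"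
    have "?y \<in> \<Omega> \<and> \<phi> ?y i = \<phi> x i" by (rule someI[of _ x]) (use x in auto)
    then show ?thesis unfolding h_def rk[OF x i] using eq x i by blast
  qed
  have fX: "f x \<in> \<Omega>'" if "x \<in> \<Omega>" for x using onto that by blast
  have bij: "bij_betw h (Field (flag_rel \<Omega> \<phi> d)) (Field (flag_rel \<Omega>' \<psi> d))"
  proof (rule bij_betw_imageI)
    show "inj_on h (Field (flag_rel \<Omega> \<phi> d))"
    proof (rule inj_onI)
      fix F G assume "F \<in> Field (flag_rel \<Omega> \<phi> d)" "G \<in> Field (flag_rel \<Omega> \<phi> d)" and e: "h F = h G"
      then obtain x i y j where x: "x \<in> \<Omega>" "i \<in> {-1..d}" "F = \<phi> x i" and y: "y \<in> \<Omega>" "j \<in> {-1..d}" "G = \<phi> y j"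
        unfolding Field_flag_rel by blast
      have e': "\<psi> (f x) i = \<psi> (f y) j" using e x y h by simp
      then have "i = j" using rk'[OF fX[OF x(1)] x(2)] rk'[OF fX[OF y(1)] y(2)] by simp
      then show "F = G" using e' x y eq by simp
    qed
    show "h ` Field (flag_rel \<Omega> \<phi> d) = Field (flag_rel \<Omega>' \<psi> d)"
      unfolding Field_flag_rel onto[symmetric] using h by (auto simp: image_iff) (metis atLeastAtMost_iff)+
  qed
  have ord: "(\<phi> x i, \<phi> y j) \<in> flag_rel \<Omega> \<phi> d \<longleftrightarrow> (\<psi> (f x) i, \<psi> (f y) j) \<in> flag_rel \<Omega>' \<psi> d"
    if x: "x \<in> \<Omega>" "i \<in> {-1..d}" and y: "y \<in> \<Omega>" "j \<in> {-1..d}" for x y i j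
  proof
    assume "(\<phi> x i, \<phi> y j) \<in> flag_rel \<Omega> \<phi> d"
    then obtain z k l where z: "z \<in> \<Omega>" "-1 \<le> k" "k \<le> l" "l \<le> d" "\<phi> x i = \<phi> z k" "\<phi> y j = \<phi> z l"
      unfolding flag_rel_def by blast
    have "k = i" "l = j" using rk[of z k] rk[of z l] rk[of x i] rk[of y j] z x y by auto
    then have "\<psi> (f x) i = \<psi> (f z) k" "\<psi> (f y) j = \<psi> (f z) l" using eq z x y by auto
    then show "(\<psi> (f x) i, \<psi> (f y) j) \<in> flag_rel \<Omega>' \<psi> d"
      using flag_relI[of "f z" \<Omega>' k l d \<psi>] z fX by simp
  next
    assume "(\<psi> (f x) i, \<psi> (f y) j) \<in> flag_rel \<Omega>' \<psi> d"
    then obtain w k l where w: "w \<in> \<Omega>'" "-1 \<le> k" "k \<le> l" "l \<le> d" "\<psi> (f x) i = \<psi> w k" "\<psi> (f y) j = \<psi> w l"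
      unfolding flag_rel_def by blast
    obtain z where z: "z \<in> \<Omega>" "w = f z" using w onto by blast
    have "k = i" "l = j" using rk'[of w k] rk'[of w l] rk'[of "f x" i] rk'[of "f y" j] w x y fX by auto
    then have "\<phi> x i = \<phi> z k" "\<phi> y j = \<phi> z l" using eq z w x y by auto
    then show "(\<phi> x i, \<phi> y j) \<in> flag_rel \<Omega> \<phi> d"
      using flag_relI[of "z" \<Omega> k l d \<phi>] z w by simp
  qed
  have "\<forall>F \<in> Field (flag_rel \<Omega> \<phi> d). \<forall>G \<in> Field (flag_rel \<Omega> \<phi> d).
      (F, G) \<in> flag_rel \<Omega> \<phi> d \<longleftrightarrow> (h F, h G) \<in> flag_rel \<Omega>' \<psi> d"
  proof (intro ballI)
    fix F G assume "F \<in> Field (flag_rel \<Omega> \<phi> d)" "G \<in> Field (flag_rel \<Omega> \<phi> d)"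
    then obtain x i y j where x: "x \<in> \<Omega>" "i \<in> {-1..d}" "F = \<phi> x i" and y: "y \<in> \<Omega>" "j \<in> {-1..d}" "G = \<phi> y j"
      unfolding Field_flag_rel by blast
    show "(F, G) \<in> flag_rel \<Omega> \<phi> d \<longleftrightarrow> (h F, h G) \<in> flag_rel \<Omega>' \<psi> d"
      using ord[OF x(1,2) y(1,2)] h x y by simp
  qed
  then have "h \<in> poset_isos (flag_rel \<Omega> \<phi> d) (flag_rel \<Omega>' \<psi> d)"
    unfolding poset_isos_def using bij by blast
  then show thesis using that h by blast
qed

lemma poset_isos_inv:
  assumes "h \<in> poset_isos r s"
  shows "inv_into (Field r) h \<in> poset_isos s r"
proof -
  have b: "bij_betw h (Field r) (Field s)"
    and o: "\<forall>F\<in>Field r. \<forall>G\<in>Field r. (F, G) \<in> r \<longleftrightarrow> (h F, h G) \<in> s"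
    using assms unfolding poset_isos_def by auto
  have "(inv_into (Field r) h F, inv_into (Field r) h G) \<in> r \<longleftrightarrow> (F, G) \<in> s"
    if "F \<in> Field s" "G \<in> Field s" for F G
  proof -
    have "inv_into (Field r) h F \<in> Field r" "inv_into (Field r) h G \<in> Field r"
      using bij_betwE[OF bij_betw_inv_into[OF b]] that by auto
    then show ?thesis using o bij_betw_inv_into_right[OF b] that by simp
  qed
  then show ?thesis unfolding poset_isos_def using bij_betw_inv_into[OF b] by blast
qed

lemma poset_isos_compose:
  assumes "f \<in> poset_isos r s" "g \<in> poset_isos s t"
  shows "compose (Field r) g f \<in> poset_isos r t"
proof -
  have b: "bij_betw f (Field r) (Field s)" "bij_betw g (Field s) (Field t)"
    using assms unfolding poset_isos_def by auto
  have fr: "f F \<in> Field s" if "F \<in> Field r" for F using b(1) that by (meson bij_betwE)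
  show ?thesis using assms b fr unfolding poset_isos_def
    by (auto intro: bij_betw_compose simp: compose_eq)
qed

lemma group_aut_group: "group (aut_group r)"
proof -
  interpret B: group "BijGroup (Field r)" by (rule group_BijGroup)
  have "subgroup (Bij (Field r) \<inter> poset_isos r r) (BijGroup (Field r))"
  proof (rule B.subgroupI)
    show "Bij (Field r) \<inter> poset_isos r r \<subseteq> carrier (BijGroup (Field r))" by (simp add: BijGroup_def)
    have "(\<lambda>x\<in>Field r. x) \<in> Bij (Field r) \<inter> poset_isos r r"
      using id_Bij[of "Field r"] unfolding poset_isos_def Bij_def by auto
    then show "Bij (Field r) \<inter> poset_isos r r \<noteq> {}" by blast
  next
    fix f assume f: "f \<in> Bij (Field r) \<inter> poset_isos r r"
    then have "inv\<^bsub>BijGroup (Field r)\<^esub> f = restrict (inv_into (Field r) f) (Field r)"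
      using inv_BijGroup by blast
    moreover have "restrict (inv_into (Field r) f) (Field r) \<in> poset_isos r r"
      using poset_isos_inv[of f r r] f unfolding poset_isos_def
      by (auto simp: bij_betw_cong[where g="restrict (inv_into (Field r) f) (Field r)", symmetric] cong: bij_betw_cong)
    ultimately show "inv\<^bsub>BijGroup (Field r)\<^esub> f \<in> Bij (Field r) \<inter> poset_isos r r"
      using f restrict_inv_into_Bij[of f "Field r"] by simp
  next
    fix f g assume "f \<in> Bij (Field r) \<inter> poset_isos r r" "g \<in> Bij (Field r) \<inter> poset_isos r r"
    then show "f \<otimes>\<^bsub>BijGroup (Field r)\<^esub> g \<in> Bij (Field r) \<inter> poset_isos r r"
      using compose_Bij[of f "Field r" g] poset_isos_compose[of g r r f r] by (simp add: BijGroup_def)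
  qed
  then show ?thesis unfolding aut_group_def by (rule B.subgroup_imp_group)
qed

lemma aut_group_simps:
  "carrier (aut_group r) = Bij (Field r) \<inter> poset_isos r r"
  "f \<in> carrier (aut_group r) \<Longrightarrow> g \<in> carrier (aut_group r) \<Longrightarrow> f \<otimes>\<^bsub>aut_group r\<^esub> g = compose (Field r) f g"
  "\<one>\<^bsub>aut_group r\<^esub> = (\<lambda>x\<in>Field r. x)"
  by (auto simp: aut_group_def BijGroup_def)

text \<open>Conditions on the chambers that make \<^const>\<open>flag_rel\<close> an abstract polytope. Gluing gives transitivity
of the order and lets every chain be completed to a flag. The condition \<open>connected\<close> is strong flag
connectivity: a path from \<open>x\<close> to \<open>y\<close> may change only faces in which \<open>x\<close> and \<open>y\<close> differ.\<close>

locale flag_system =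
  fixes \<Omega> :: "'x set" and \<phi> :: "'x \<Rightarrow> int \<Rightarrow> 'a" and d :: int and rk :: "'a \<Rightarrow> int"
    and adj :: "int \<Rightarrow> 'x \<Rightarrow> 'x"
  assumes nonempty: "\<Omega> \<noteq> {}"
    and dim: "-1 \<le> d"
    and rk: "x \<in> \<Omega> \<Longrightarrow> i \<in> {-1..d} \<Longrightarrow> rk (\<phi> x i) = i"
    and least: "x \<in> \<Omega> \<Longrightarrow> y \<in> \<Omega> \<Longrightarrow> \<phi> x (-1) = \<phi> y (-1)"
    and greatest: "x \<in> \<Omega> \<Longrightarrow> y \<in> \<Omega> \<Longrightarrow> \<phi> x d = \<phi> y d"
    and glue: "x \<in> \<Omega> \<Longrightarrow> y \<in> \<Omega> \<Longrightarrow> k \<in> {-1..d} \<Longrightarrow> \<phi> x k = \<phi> y k \<Longrightarrow>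
       \<exists>z \<in> \<Omega>. (\<forall>i \<in> {-1..k}. \<phi> z i = \<phi> x i) \<and> (\<forall>i \<in> {k..d}. \<phi> z i = \<phi> y i)"
    and adj_closed: "x \<in> \<Omega> \<Longrightarrow> j \<in> {0..<d} \<Longrightarrow> adj j x \<in> \<Omega>"
    and adj_same: "x \<in> \<Omega> \<Longrightarrow> j \<in> {0..<d} \<Longrightarrow> i \<in> {-1..d} \<Longrightarrow> i \<noteq> j \<Longrightarrow> \<phi> (adj j x) i = \<phi> x i"
    and adj_diff: "x \<in> \<Omega> \<Longrightarrow> j \<in> {0..<d} \<Longrightarrow> \<phi> (adj j x) j \<noteq> \<phi> x j"
    and adj_adj: "x \<in> \<Omega> \<Longrightarrow> j \<in> {0..<d} \<Longrightarrow> adj j (adj j x) = x"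
    and connected: "x \<in> \<Omega> \<Longrightarrow> y \<in> \<Omega> \<Longrightarrow>
       (x, y) \<in> {(z, adj j z) | z j. z \<in> \<Omega> \<and> j \<in> {0..<d} \<and> \<phi> x j \<noteq> \<phi> y j}\<^sup>*"
begin

abbreviation "R \<equiv> flag_rel \<Omega> \<phi> d"

lemma relE:
  assumes "(F, G) \<in> R"
  obtains x where "x \<in> \<Omega>" "F = \<phi> x (rk F)" "G = \<phi> x (rk G)" "-1 \<le> rk F" "rk F \<le> rk G" "rk G \<le> d"
proof -
  obtain x i j where x: "x \<in> \<Omega>" "-1 \<le> i" "i \<le> j" "j \<le> d" "F = \<phi> x i" "G = \<phi> x j"
    using assms unfolding flag_rel_def by blast
  then have "rk F = i" "rk G = j" using rk[of x i] rk[of x j] by auto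
  then show thesis using that x by auto
qed

lemma FieldE:
  assumes "F \<in> Field R"
  obtains x where "x \<in> \<Omega>" "F = \<phi> x (rk F)" "rk F \<in> {-1..d}"
  using assms rk unfolding Field_flag_rel by auto

lemma FieldI: "x \<in> \<Omega> \<Longrightarrow> i \<in> {-1..d} \<Longrightarrow> \<phi> x i \<in> Field R"
  unfolding Field_flag_rel by blast

text \<open>The diamond condition is a special case of connectedness: if two chambers differ at most in rank \<open>j\<close>,
the path joining them uses only the involution \<open>adj j\<close>.\<close>

lemma thin:
  assumes "x \<in> \<Omega>" "y \<in> \<Omega>" "\<And>i. i \<in> {-1..d} \<Longrightarrow> i \<noteq> j \<Longrightarrow> \<phi> x i = \<phi> y i"
  shows "y = x \<or> (j \<in> {0..<d} \<and> y = adj j x)"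
  using connected[OF assms(1,2)]
proof (induction rule: rtrancl_induct)
  case base then show ?case by simp
next
  case (step z w)
  then obtain j' where j': "w = adj j' z" "z \<in> \<Omega>" "j' \<in> {0..<d}" "\<phi> x j' \<noteq> \<phi> y j'" by blast
  then have "j' = j" using assms(3)[of j'] by fastforce
  then show ?case using step.IH j' adj_adj assms(1) by auto
qed

lemma eq_iff:
  assumes "x \<in> \<Omega>" "y \<in> \<Omega>" "\<And>i. i \<in> {-1..d} \<Longrightarrow> \<phi> x i = \<phi> y i"
  shows "x = y"
  using thin[OF assms(1,2), of "-2"] assms(3) by auto

lemma antisym_R: "(F, G) \<in> R \<Longrightarrow> (G, F) \<in> R \<Longrightarrow> F = G"
  by (metis relE order_antisym)

lemma trans_R:
  assumes "(F, G) \<in> R" "(G, H) \<in> R" shows "(F, H) \<in> R"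
proof -
  obtain x where x: "x \<in> \<Omega>" "F = \<phi> x (rk F)" "G = \<phi> x (rk G)" "-1 \<le> rk F" "rk F \<le> rk G" "rk G \<le> d"
    using assms(1) by (rule relE)
  obtain y where y: "y \<in> \<Omega>" "G = \<phi> y (rk G)" "H = \<phi> y (rk H)" "-1 \<le> rk G" "rk G \<le> rk H" "rk H \<le> d"
    using assms(2) by (rule relE)
  obtain z where "z \<in> \<Omega>" "\<forall>i \<in> {-1..rk G}. \<phi> z i = \<phi> x i" "\<forall>i \<in> {rk G..d}. \<phi> z i = \<phi> y i"
    using glue[of x y "rk G"] x y by auto
  then show ?thesis using flag_relI[of z \<Omega> "rk F" "rk H" d \<phi>] x y by auto
qed

lemma Partial_order_R: "Partial_order R"
proof -
  have "(F, F) \<in> R" if "F \<in> Field R" for F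
    using that by (rule FieldE) (metis flag_relI atLeastAtMost_iff order_refl)
  then show ?thesis
    unfolding partial_order_on_def preorder_on_def refl_on_def antisym_def trans_def
    using antisym_R trans_R by (auto intro: FieldI2 FieldI1)
qed

lemma chamber_chain: "x \<in> \<Omega> \<Longrightarrow> \<phi> x ` {-1..d} \<in> Chains R"
  unfolding Chains_def by (auto simp: image_iff) (metis flag_relI linear)

text \<open>Induction on the rank up to which the chain is already covered: the next face of the chain is
incident with the highest face covered so far, and gluing at that face extends the chamber.\<close>

lemma chain_in_chamber:
  assumes "C \<in> Chains R"
  obtains x where "x \<in> \<Omega>" "C \<subseteq> \<phi> x ` {-1..d}"
proof -
  have cmp: "(F, G) \<in> R \<or> (G, F) \<in> R" if "F \<in> C" "G \<in> C" for F G
    using assms that unfolding Chains_def by blast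
  have CF: "C \<subseteq> Field R" using cmp by (auto simp: Field_def)
  have rkC: "rk F \<in> {-1..d}" if "F \<in> C" for F using CF that FieldE by blast
  have "k \<le> d \<longrightarrow> (\<exists>x\<in>\<Omega>. \<forall>F\<in>C. rk F \<le> k \<longrightarrow> F = \<phi> x (rk F))" if "-1 \<le> k" for k
    using that
  proof (induction k rule: int_ge_induct)
    case base
    obtain x where x: "x \<in> \<Omega>" using nonempty by blast
    have "F = \<phi> x (rk F)" if "F \<in> C" "rk F \<le> -1" for F
    proof -
      obtain y where y: "y \<in> \<Omega>" "F = \<phi> y (rk F)" "rk F \<in> {-1..d}" using FieldE CF \<open>F \<in> C\<close> by blast
      then have "rk F = -1" using that by simp
      then show ?thesis using y(2) least[OF x y(1)] by simp
    qed
    then show ?case using x by blast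
  next
    case (step k)
    show ?case
    proof
      assume kd: "k + 1 \<le> d"
      then obtain x where x: "x \<in> \<Omega>" "\<forall>F\<in>C. rk F \<le> k \<longrightarrow> F = \<phi> x (rk F)" using step by auto
      show "\<exists>x\<in>\<Omega>. \<forall>F\<in>C. rk F \<le> k + 1 \<longrightarrow> F = \<phi> x (rk F)"
      proof (cases "\<exists>F\<in>C. rk F = k + 1")
        case False
        then have "\<forall>F\<in>C. rk F \<le> k + 1 \<longrightarrow> rk F \<le> k" by force
        then show ?thesis using x by blast
      next
        case True
        then obtain F where F: "F \<in> C" "rk F = k + 1" by blast
        have uniq: "G = F" if "G \<in> C" "rk G = k + 1" for G
          using cmp[OF F(1) that(1)] F(2) that(2) by (metis relE)
        have low: "(E, F) \<in> R" if "E \<in> C" "rk E \<le> k" for E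
        proof -
          have "(F, E) \<notin> R" using F that by (auto elim!: relE)
          then show ?thesis using cmp F that by blast
        qed
        show ?thesis
        proof (cases "\<exists>E\<in>C. rk E \<le> k")
          case False
          obtain y where y: "y \<in> \<Omega>" "F = \<phi> y (rk F)" using FieldE F CF by blast
          then have "G = \<phi> y (rk G)" if "G \<in> C" "rk G \<le> k + 1" for G
            using uniq[of G] that False by force
          then show ?thesis using y by blast
        next
          case True
          define Q where "Q = rk ` {E \<in> C. rk E \<le> k}"
          have "Q \<subseteq> {-1..k}" unfolding Q_def using CF FieldE by force
          then have fin: "finite Q" by (rule finite_subset) simp
          have "Q \<noteq> {}" using True unfolding Q_def by blast
          then have "Max Q \<in> Q" using fin by (rule Max_in[rotated])
          then obtain E where E: "E \<in> C" "rk E \<le> k" "rk E = Max Q" unfolding Q_def by auto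
          have mx: "rk G \<le> rk E" if "G \<in> C" "rk G \<le> k" for G
            using Max_ge[OF fin, of "rk G"] that E unfolding Q_def by auto
          obtain y where y: "y \<in> \<Omega>" "E = \<phi> y (rk E)" "F = \<phi> y (rk F)" "-1 \<le> rk E"
            using low[OF E(1,2)] by (rule relE)
          obtain z where z: "z \<in> \<Omega>" "\<forall>i \<in> {-1..rk E}. \<phi> z i = \<phi> x i" "\<forall>i \<in> {rk E..d}. \<phi> z i = \<phi> y i"
            using glue[of x y "rk E"] x(1) y E kd x(2)[rule_format, OF E(1,2)] by auto
          have "G = \<phi> z (rk G)" if G: "G \<in> C" "rk G \<le> k + 1" for G
          proof (cases "rk G = k + 1")
            case True then show ?thesis using uniq G y z E kd F by auto
          next
            case False
            then have "rk G \<le> k" using G by simp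
            then have "rk G \<in> {-1..rk E}" using mx[OF G(1)] rkC[OF G(1)] by simp
            then show ?thesis using x(2) z(2) G(1) \<open>rk G \<le> k\<close> by simp
          qed
          then show ?thesis using z by blast
        qed
      qed
    qed
  qed
  from this[OF dim] obtain x where "x \<in> \<Omega>" "\<forall>F\<in>C. rk F \<le> d \<longrightarrow> F = \<phi> x (rk F)" by blast
  then show thesis using that[of x] rkC by (metis atLeastAtMost_iff image_eqI subsetI)
qed

lemma chamber_le:
  assumes "x \<in> \<Omega>" "y \<in> \<Omega>" "\<phi> x ` {-1..d} \<subseteq> \<phi> y ` {-1..d}"
  shows "x = y"
proof (rule eq_iff[OF assms(1,2)])
  fix i assume i: "i \<in> {-1..d}"
  then obtain j where "j \<in> {-1..d}" "\<phi> x i = \<phi> y j" using assms(3) by blast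
  then show "\<phi> x i = \<phi> y i" using rk[OF assms(1) i] rk[OF assms(2)] by metis
qed

lemma flags_R: "flags R = (\<lambda>x. \<phi> x ` {-1..d}) ` \<Omega>"
proof
  show "flags R \<subseteq> (\<lambda>x. \<phi> x ` {-1..d}) ` \<Omega>"
  proof
    fix \<Phi> assume "\<Phi> \<in> flags R"
    then have c: "\<Phi> \<in> Chains R" and m: "\<forall>\<Psi> \<in> Chains R. \<Phi> \<subseteq> \<Psi> \<longrightarrow> \<Psi> = \<Phi>" unfolding flags_def by auto
    obtain x where "x \<in> \<Omega>" "\<Phi> \<subseteq> \<phi> x ` {-1..d}" using c by (rule chain_in_chamber)
    then show "\<Phi> \<in> (\<lambda>x. \<phi> x ` {-1..d}) ` \<Omega>" using m chamber_chain by blast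
  qed
  have "\<Psi> = \<phi> x ` {-1..d}" if x: "x \<in> \<Omega>" and \<Psi>: "\<Psi> \<in> Chains R" "\<phi> x ` {-1..d} \<subseteq> \<Psi>" for x \<Psi>
  proof -
    obtain y where y: "y \<in> \<Omega>" "\<Psi> \<subseteq> \<phi> y ` {-1..d}" using \<Psi>(1) by (rule chain_in_chamber)
    then have "x = y" using chamber_le[OF x, of y] \<Psi>(2) by blast
    then show ?thesis using y \<Psi> by blast
  qed
  then show "(\<lambda>x. \<phi> x ` {-1..d}) ` \<Omega> \<subseteq> flags R" unfolding flags_def using chamber_chain by auto
qed

lemma rk_inj: "x \<in> \<Omega> \<Longrightarrow> y \<in> \<Omega> \<Longrightarrow> i \<in> {-1..d} \<Longrightarrow> j \<in> {-1..d} \<Longrightarrow> \<phi> x i = \<phi> y j \<Longrightarrow> i = j"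
  using rk by metis

lemma adjacent_chambers:
  assumes x: "x \<in> \<Omega>" and j: "j \<in> {0..<d}"
  shows "adjacent_flags (\<phi> x ` {-1..d}) (\<phi> (adj j x) ` {-1..d})"
proof -
  have *: "\<phi> y ` {-1..d} - \<phi> z ` {-1..d} = {\<phi> y j}"
    if "y \<in> \<Omega>" "z \<in> \<Omega>" "\<phi> y j \<noteq> \<phi> z j" and eq: "\<forall>i\<in>{-1..d}. i \<noteq> j \<longrightarrow> \<phi> y i = \<phi> z i" for y z
  proof -
    have 1: "\<phi> y j \<notin> \<phi> z ` {-1..d}"
    proof
      assume "\<phi> y j \<in> \<phi> z ` {-1..d}"
      then obtain i where i: "i \<in> {-1..d}" "\<phi> y j = \<phi> z i" by blast
      have "j = i" using rk_inj[OF that(1,2) _ i(1,2)] j by simp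
      then show False using i that(3) by simp
    qed
    have 2: "F = \<phi> y j" if F: "F \<in> \<phi> y ` {-1..d}" "F \<notin> \<phi> z ` {-1..d}" for F
      using F eq by fastforce
    have 3: "\<phi> y j \<in> \<phi> y ` {-1..d}" using j by simp
    show ?thesis
    proof (intro equalityI subsetI)
      fix F assume "F \<in> \<phi> y ` {-1..d} - \<phi> z ` {-1..d}"
      then show "F \<in> {\<phi> y j}" by (metis 2 DiffD1 DiffD2 singletonI)
    next
      fix F assume "F \<in> {\<phi> y j}"
      then show "F \<in> \<phi> y ` {-1..d} - \<phi> z ` {-1..d}" by (metis 1 3 DiffI singletonD)
    qed
  qed
  have "\<phi> x ` {-1..d} - \<phi> (adj j x) ` {-1..d} = {\<phi> x j}"
    using *[OF x adj_closed[OF x j] adj_diff[OF x j, symmetric]] adj_same[OF x j] by simp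
  moreover have "\<phi> (adj j x) ` {-1..d} - \<phi> x ` {-1..d} = {\<phi> (adj j x) j}"
    using *[OF adj_closed[OF x j] x adj_diff[OF x j]] adj_same[OF x j] by simp
  ultimately show ?thesis unfolding adjacent_flags_def by simp
qed

lemma flag_connected:
  assumes "\<Phi> \<in> flags R" "\<Psi> \<in> flags R"
  shows "(\<Phi>, \<Psi>) \<in> {(A, B). A \<in> flags R \<and> B \<in> flags R \<and> adjacent_flags A B
                  \<and> \<Phi> \<inter> \<Psi> \<subseteq> A \<and> \<Phi> \<inter> \<Psi> \<subseteq> B}\<^sup>*" (is "_ \<in> ?S\<^sup>*")
proof -
  obtain x y where x: "x \<in> \<Omega>" "\<Phi> = \<phi> x ` {-1..d}" and y: "y \<in> \<Omega>" "\<Psi> = \<phi> y ` {-1..d}"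
    using assms flags_R by auto
  have common: "\<Phi> \<inter> \<Psi> \<subseteq> \<phi> z ` {-1..d}" if "\<forall>i\<in>{-1..d}. \<phi> x i = \<phi> y i \<longrightarrow> \<phi> z i = \<phi> x i" for z
  proof
    fix F assume "F \<in> \<Phi> \<inter> \<Psi>"
    then obtain i j where i: "i \<in> {-1..d}" "F = \<phi> x i" and j: "j \<in> {-1..d}" "F = \<phi> y j" using x y by blast
    have "\<phi> x i = \<phi> y i" using rk_inj[OF x(1) y(1) i(1) j(1)] i j by simp
    then show "F \<in> \<phi> z ` {-1..d}" using that i by (metis image_eqI)
  qed
  have "v \<in> \<Omega> \<and> (\<forall>i\<in>{-1..d}. \<phi> x i = \<phi> y i \<longrightarrow> \<phi> v i = \<phi> x i) \<and> (\<Phi>, \<phi> v ` {-1..d}) \<in> ?S\<^sup>*"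
    if "(x, v) \<in> {(z, adj j z) | z j. z \<in> \<Omega> \<and> j \<in> {0..<d} \<and> \<phi> x j \<noteq> \<phi> y j}\<^sup>*" for v
    using that
  proof (induction rule: rtrancl_induct)
    case base then show ?case using x by simp
  next
    case (step z w)
    then obtain j where j: "w = adj j z" "z \<in> \<Omega>" "j \<in> {0..<d}" "\<phi> x j \<noteq> \<phi> y j" by blast
    have w: "w \<in> \<Omega>" using j adj_closed by simp
    have zi: "\<forall>i\<in>{-1..d}. \<phi> x i = \<phi> y i \<longrightarrow> \<phi> z i = \<phi> x i" using step.IH by blast
    have wi: "\<forall>i\<in>{-1..d}. \<phi> x i = \<phi> y i \<longrightarrow> \<phi> w i = \<phi> x i"
    proof (intro ballI impI)
      fix i assume i: "i \<in> {-1..d}" "\<phi> x i = \<phi> y i"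
      then have "i \<noteq> j" using j(4) by blast
      then show "\<phi> w i = \<phi> x i" using zi i adj_same[OF j(2,3) i(1)] j(1) by simp
    qed
    have "(\<phi> z ` {-1..d}, \<phi> w ` {-1..d}) \<in> ?S"
      using common[OF zi] common[OF wi] adjacent_chambers[OF j(2,3)] flags_R w j by auto
    then show ?case using step.IH w wi by (meson rtrancl.rtrancl_into_rtrancl)
  qed
  from this[OF connected[OF x(1) y(1)]] show ?thesis using y by simp
qed

lemma diamond_R:
  assumes FG: "(F, G) \<in> R" and F: "rk F = j - 1" and G: "rk G = j + 1"
  shows "card {H \<in> Field R. rk H = j \<and> (F, H) \<in> R \<and> (H, G) \<in> R} = 2"
proof -
  obtain x where x: "x \<in> \<Omega>" "F = \<phi> x (j - 1)" "G = \<phi> x (j + 1)" "-1 \<le> j - 1" "j + 1 \<le> d"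
    using relE[OF FG] F G by metis
  have j: "j \<in> {0..<d}" using x by simp
  let ?y = "adj j x"
  have y: "?y \<in> \<Omega>" "\<phi> ?y (j - 1) = F" "\<phi> ?y (j + 1) = G"
    using adj_closed[OF x(1) j] adj_same[OF x(1) j, of "j-1"] adj_same[OF x(1) j, of "j+1"] x by auto
  have "{H \<in> Field R. rk H = j \<and> (F, H) \<in> R \<and> (H, G) \<in> R} = {\<phi> x j, \<phi> ?y j}" (is "?L = ?r")
  proof
    show "?r \<subseteq> ?L"
      using rk[of x j] rk[of ?y j] x y j flag_relI[of x \<Omega> "j-1" j d \<phi>] flag_relI[of x \<Omega> j "j+1" d \<phi>]
        flag_relI[of ?y \<Omega> "j-1" j d \<phi>] flag_relI[of ?y \<Omega> j "j+1" d \<phi>] FieldI[of x j] FieldI[of ?y j]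
      by auto
    show "?L \<subseteq> ?r"
    proof
      fix H assume "H \<in> ?L"
      then have H: "rk H = j" "(F, H) \<in> R" "(H, G) \<in> R" by auto
      obtain u where u: "u \<in> \<Omega>" "F = \<phi> u (j - 1)" "H = \<phi> u j" using relE[OF H(2)] F H(1) by metis
      obtain v where v: "v \<in> \<Omega>" "H = \<phi> v j" "G = \<phi> v (j + 1)" using relE[OF H(3)] G H(1) by metis
      obtain a where a: "a \<in> \<Omega>" "\<forall>i\<in>{-1..j-1}. \<phi> a i = \<phi> x i" "\<forall>i\<in>{j-1..d}. \<phi> a i = \<phi> u i"
        using glue[of x u "j-1"] x u by auto
      obtain b where b: "b \<in> \<Omega>" "\<forall>i\<in>{-1..j+1}. \<phi> b i = \<phi> v i" "\<forall>i\<in>{j+1..d}. \<phi> b i = \<phi> x i"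
        using glue[of v x "j+1"] x v by auto
      have "\<phi> a j = \<phi> b j" using a b u v x by auto
      then obtain z where z: "z \<in> \<Omega>" "\<forall>i\<in>{-1..j}. \<phi> z i = \<phi> a i" "\<forall>i\<in>{j..d}. \<phi> z i = \<phi> b i"
        using glue[of a b j] a(1) b(1) x by auto
      have "\<phi> x i = \<phi> z i" if i: "i \<in> {-1..d}" "i \<noteq> j" for i
      proof (cases "i < j")
        case True then show ?thesis using z(2) a(2) i by auto
      next
        case False then show ?thesis using z(3) b(3) i by auto
      qed
      then have "z = x \<or> z = ?y" using thin[OF x(1) z(1)] by blast
      moreover have "\<phi> z j = H" using z(3) b(2) v(2) x by simp
      ultimately show "H \<in> ?r" by auto
    qed
  qed
  then show ?thesis using adj_diff[OF x(1) j] by (simp add: card_2_iff)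
qed

text \<open>The flags are the chambers (lemma \<open>flags_R\<close>), so the axioms about flags are the conditions of the
locale.\<close>

theorem abstract_polytope_R: "abstract_polytope d R rk"
proof
  show "Partial_order R" by (rule Partial_order_R)
  show "rk F \<in> {-1..d}" if "F \<in> Field R" for F using that by (rule FieldE)
  show "rk F < rk G" if "(F, G) \<in> R" "F \<noteq> G" for F G
    using that by (metis relE order_less_le)
  obtain x where x: "x \<in> \<Omega>" using nonempty by blast
  have b: "(\<phi> x (-1), G) \<in> R" if G: "G \<in> Field R" for G
  proof -
    obtain y where y: "y \<in> \<Omega>" "G = \<phi> y (rk G)" "rk G \<in> {-1..d}" using G by (rule FieldE)
    have "(\<phi> y (-1), \<phi> y (rk G)) \<in> R" using y by (intro flag_relI) auto
    then show ?thesis using y least[OF x y(1)] by simp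
  qed
  have t: "(G, \<phi> x d) \<in> R" if G: "G \<in> Field R" for G
  proof -
    obtain y where y: "y \<in> \<Omega>" "G = \<phi> y (rk G)" "rk G \<in> {-1..d}" using G by (rule FieldE)
    have "(\<phi> y (rk G), \<phi> y d) \<in> R" using y by (intro flag_relI) auto
    then show ?thesis using y greatest[OF x y(1)] by simp
  qed
  show "\<exists>F\<in>Field R. rk F = -1 \<and> (\<forall>G\<in>Field R. (F, G) \<in> R)"
    using b rk[OF x, of "-1"] FieldI[OF x, of "-1"] dim by auto
  show "\<exists>F\<in>Field R. rk F = d \<and> (\<forall>G\<in>Field R. (G, F) \<in> R)"
    using t rk[OF x, of d] FieldI[OF x, of d] dim by auto
  show "bij_betw rk \<Phi> {-1..d}" if \<Phi>: "\<Phi> \<in> flags R" for \<Phi>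
  proof -
    obtain y where y: "y \<in> \<Omega>" "\<Phi> = \<phi> y ` {-1..d}" using \<Phi> unfolding flags_R by blast
    show ?thesis unfolding y(2) by (rule bij_betwI[of _ _ _ "\<phi> y"]) (use y rk in auto)
  qed
qed (use flag_connected diamond_R in auto)

text \<open>The chambers that can differ from \<open>x\<close> only strictly between the ranks \<open>i\<close> and \<open>j\<close>. By gluing, every
face of the section between the two faces of \<open>x\<close> lies in one of them.\<close>

definition section_chambers :: "'x \<Rightarrow> int \<Rightarrow> int \<Rightarrow> 'x set" where
  "section_chambers x i j = {y \<in> \<Omega>. \<forall>k\<in>{-1..d}. k \<le> i \<or> j \<le> k \<longrightarrow> \<phi> y k = \<phi> x k}"

lemma section_chambersD:
  "y \<in> section_chambers x i j \<Longrightarrow> k \<in> {-1..d} \<Longrightarrow> k \<le> i \<or> j \<le> k \<Longrightarrow> \<phi> y k = \<phi> x k"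
  unfolding section_chambers_def by blast

text \<open>The conditions of a flag system are local enough to pass to sections: paths never change a face in
which their end points agree.\<close>

lemma section_flag_system:
  assumes x0: "x0 \<in> \<Omega>" and ij: "-1 \<le> i" "i \<le> j" "j \<le> d"
  shows "flag_system (section_chambers x0 i j) (\<lambda>x k. \<phi> x (k + i + 1)) (j - i - 1)
    (\<lambda>F. rk F - i - 1) (\<lambda>k. adj (k + i + 1))"
proof
  let ?Y = "section_chambers x0 i j"
  show "?Y \<noteq> {}" using x0 unfolding section_chambers_def by blast
  show "-1 \<le> j - i - 1" using ij by simp
  show "rk (\<phi> x (k + i + 1)) - i - 1 = k" if "x \<in> ?Y" "k \<in> {-1..j-i-1}" for x k
    using rk[of x "k+i+1"] that ij unfolding section_chambers_def by auto
  show "\<phi> x (-1 + i + 1) = \<phi> y (-1 + i + 1)" if "x \<in> ?Y" "y \<in> ?Y" for x y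
    using that ij unfolding section_chambers_def by auto
  show "\<phi> x (j - i - 1 + i + 1) = \<phi> y (j - i - 1 + i + 1)" if "x \<in> ?Y" "y \<in> ?Y" for x y
    using that ij unfolding section_chambers_def by auto
  show "\<exists>z\<in>?Y. (\<forall>l\<in>{-1..k}. \<phi> z (l + i + 1) = \<phi> x (l + i + 1)) \<and>
                (\<forall>l\<in>{k..j-i-1}. \<phi> z (l + i + 1) = \<phi> y (l + i + 1))"
    if x: "x \<in> ?Y" and y: "y \<in> ?Y" and k: "k \<in> {-1..j-i-1}" and e: "\<phi> x (k + i + 1) = \<phi> y (k + i + 1)" for x y k
  proof -
    obtain z where z: "z \<in> \<Omega>" "\<forall>l\<in>{-1..k+i+1}. \<phi> z l = \<phi> x l" "\<forall>l\<in>{k+i+1..d}. \<phi> z l = \<phi> y l"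
      using glue[of x y "k+i+1"] x y k e ij unfolding section_chambers_def by auto
    have "\<phi> z l = \<phi> x0 l" if l: "l \<in> {-1..d}" "l \<le> i \<or> j \<le> l" for l
      using l z(2,3) x y k unfolding section_chambers_def by (cases "l \<le> k + i + 1") auto
    then show ?thesis using z k ij unfolding section_chambers_def by (intro bexI[of _ z]) auto
  qed
  fix x k assume x: "x \<in> ?Y" and k: "k \<in> {0..<j - i - 1}"
  have xX: "x \<in> \<Omega>" and k': "k + i + 1 \<in> {0..<d}" using x k ij unfolding section_chambers_def by auto
  show "adj (k + i + 1) x \<in> ?Y"
    using adj_closed[OF xX k'] adj_same[OF xX k'] x k unfolding section_chambers_def by auto
  show "\<phi> (adj (k+i+1) x) (l + i + 1) = \<phi> x (l + i + 1)" if "l \<in> {-1..j-i-1}" "l \<noteq> k" for l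
    using adj_same[OF xX k', of "l+i+1"] that ij by auto
  show "\<phi> (adj (k+i+1) x) (k + i + 1) \<noteq> \<phi> x (k + i + 1)" by (rule adj_diff[OF xX k'])
  show "adj (k+i+1) (adj (k+i+1) x) = x" by (rule adj_adj[OF xX k'])
next
  let ?Y = "section_chambers x0 i j"
  fix x y assume x: "x \<in> ?Y" and y: "y \<in> ?Y"
  let ?S = "{(z, adj (k + i + 1) z) |z k. z \<in> ?Y \<and> k \<in> {0..<j - i - 1} \<and> \<phi> x (k + i + 1) \<noteq> \<phi> y (k + i + 1)}"
  from x y have xX: "x \<in> \<Omega>" and yX: "y \<in> \<Omega>" unfolding section_chambers_def by auto
  have "v \<in> ?Y \<and> (x, v) \<in> ?S\<^sup>*"
    if "(x, v) \<in> {(z, adj j z) | z j. z \<in> \<Omega> \<and> j \<in> {0..<d} \<and> \<phi> x j \<noteq> \<phi> y j}\<^sup>*" for v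
    using that
  proof (induction rule: rtrancl_induct)
    case base then show ?case using x by simp
  next
    case (step z w)
    then obtain l where l: "w = adj l z" "z \<in> \<Omega>" "l \<in> {0..<d}" "\<phi> x l \<noteq> \<phi> y l" by blast
    have "l \<in> {-1..d}" using l(3) by simp
    then have "\<phi> x l = \<phi> y l" if "l \<le> i \<or> j \<le> l"
      using x y that unfolding section_chambers_def by (metis (mono_tags, lifting) mem_Collect_eq)
    then have lij: "i < l" "l < j" using l(4) by (meson not_le)+
    have w: "w \<in> ?Y"
      unfolding section_chambers_def
    proof (intro CollectI conjI ballI impI)
      show "w \<in> \<Omega>" using l adj_closed by blast
      fix k assume k: "k \<in> {-1..d}" "k \<le> i \<or> j \<le> k"
      then have "k \<noteq> l" using lij by auto
      then show "\<phi> w k = \<phi> x0 k"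
        using adj_same[OF l(2,3) k(1)] section_chambersD[OF conjunct1[OF step.IH] k] l(1) by simp
    qed
    have "(z, w) \<in> ?S" using step.IH l lij by (intro CollectI exI[of _ z] exI[of _ "l - i - 1"]) auto
    then show ?case using step.IH w by (meson rtrancl.rtrancl_into_rtrancl)
  qed
  from this[OF connected[OF xX yX]] show "(x, y) \<in> ?S\<^sup>*" ..
qed

lemma section_rel:
  assumes x0: "x0 \<in> \<Omega>" and ij: "-1 \<le> i" "i \<le> j" "j \<le> d"
  shows "poly_section R (\<phi> x0 i) (\<phi> x0 j) =
    flag_rel (section_chambers x0 i j) (\<lambda>x k. \<phi> x (k + i + 1)) (j - i - 1)"
proof
  let ?F = "\<phi> x0 i" and ?G = "\<phi> x0 j" and ?Y = "section_chambers x0 i j"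
  let ?T = "flag_rel ?Y (\<lambda>x k. \<phi> x (k + i + 1)) (j - i - 1)"
  have rkF: "rk ?F = i" and rkG: "rk ?G = j" using rk x0 ij by auto
  show "?T \<subseteq> poly_section R ?F ?G"
  proof
    fix p assume "p \<in> ?T"
    then obtain x k l where p: "p = (\<phi> x (k+i+1), \<phi> x (l+i+1))" "x \<in> ?Y" "-1 \<le> k" "k \<le> l" "l \<le> j-i-1"
      unfolding flag_rel_def by blast
    have x: "x \<in> \<Omega>" "\<phi> x i = ?F" "\<phi> x j = ?G" using p(2) ij unfolding section_chambers_def by auto
    have "(\<phi> x (k+i+1), \<phi> x (l+i+1)) \<in> R" "(\<phi> x i, \<phi> x (k+i+1)) \<in> R" "(\<phi> x i, \<phi> x (l+i+1)) \<in> R"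
      "(\<phi> x (k+i+1), \<phi> x j) \<in> R" "(\<phi> x (l+i+1), \<phi> x j) \<in> R"
      by (rule flag_relI; use p ij x in simp)+
    then show "p \<in> poly_section R ?F ?G" unfolding poly_section_def above_def under_def
      using p(1) x by auto
  qed
  show "poly_section R ?F ?G \<subseteq> ?T"
  proof
    fix p assume "p \<in> poly_section R ?F ?G"
    then obtain P Q where p: "p = (P, Q)" "(P, Q) \<in> R" "(?F, P) \<in> R" "(Q, ?G) \<in> R"
      unfolding poly_section_def above_def under_def by auto
    obtain y where y: "y \<in> \<Omega>" "P = \<phi> y (rk P)" "Q = \<phi> y (rk Q)" "rk P \<le> rk Q" using relE[OF p(2)] by metis
    obtain u where u: "u \<in> \<Omega>" "?F = \<phi> u i" "P = \<phi> u (rk P)" "i \<le> rk P" using relE[OF p(3)] rkF by metis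
    obtain v where v: "v \<in> \<Omega>" "Q = \<phi> v (rk Q)" "?G = \<phi> v j" "rk Q \<le> j" using relE[OF p(4)] rkG by metis
    obtain a where a: "a \<in> \<Omega>" "\<forall>l\<in>{-1..i}. \<phi> a l = \<phi> x0 l" "\<forall>l\<in>{i..d}. \<phi> a l = \<phi> u l"
      using glue[of x0 u i] x0 u ij by auto
    obtain b where b: "b \<in> \<Omega>" "\<forall>l\<in>{-1..rk P}. \<phi> b l = \<phi> a l" "\<forall>l\<in>{rk P..d}. \<phi> b l = \<phi> y l"
      using glue[of a y "rk P"] a u y v ij by auto
    obtain c where c: "c \<in> \<Omega>" "\<forall>l\<in>{-1..rk Q}. \<phi> c l = \<phi> b l" "\<forall>l\<in>{rk Q..d}. \<phi> c l = \<phi> v l"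
      using glue[of b v "rk Q"] a b u y v ij by auto
    obtain e where e: "e \<in> \<Omega>" "\<forall>l\<in>{-1..j}. \<phi> e l = \<phi> c l" "\<forall>l\<in>{j..d}. \<phi> e l = \<phi> x0 l"
      using glue[of c x0 j] c v x0 ij by auto
    have eY: "e \<in> ?Y" unfolding section_chambers_def using a b c e u y v ij by auto
    have P: "\<phi> e (rk P) = P" and Q: "\<phi> e (rk Q) = Q" using a b c e u y v ij by auto
    have "p = (\<phi> e (rk P - i - 1 + i + 1), \<phi> e (rk Q - i - 1 + i + 1))" using p P Q by simp
    moreover have "-1 \<le> rk P - i - 1" "rk P - i - 1 \<le> rk Q - i - 1" "rk Q - i - 1 \<le> j - i - 1"
      using u(4) y(4) v(4) by auto
    ultimately show "p \<in> ?T" unfolding flag_rel_def using eY by blast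
  qed
qed

lemma face_rel:
  assumes x0: "x0 \<in> \<Omega>" and j: "-1 \<le> j" "j \<le> d"
  shows "face_poset R (\<phi> x0 j) = flag_rel (section_chambers x0 (-1) j) \<phi> j"
proof -
  have "(\<phi> x0 (-1), G) \<in> R" if G: "G \<in> Field R" for G
  proof -
    obtain y where y: "y \<in> \<Omega>" "G = \<phi> y (rk G)" "rk G \<in> {-1..d}" using G by (rule FieldE)
    have "(\<phi> y (-1), \<phi> y (rk G)) \<in> R" using y by (intro flag_relI) auto
    then show ?thesis using y least[OF x0 y(1)] by simp
  qed
  from face_poset_eq_section[OF this] show ?thesis using section_rel[OF x0, of "-1" j] j by simp
qed

lemma face_flag_system:
  assumes x0: "x0 \<in> \<Omega>" and j: "-1 \<le> j" "j \<le> d"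
  shows "flag_system (section_chambers x0 (-1) j) \<phi> j rk adj"
  using section_flag_system[OF x0, of "-1" j] j by simp

lemma automorphism_of_chamber_map:
  assumes onto: "f ` \<Omega> = \<Omega>"
    and eq: "\<And>x y i. x \<in> \<Omega> \<Longrightarrow> y \<in> \<Omega> \<Longrightarrow> i \<in> {-1..d} \<Longrightarrow> \<phi> (f x) i = \<phi> (f y) i \<longleftrightarrow> \<phi> x i = \<phi> y i"
  obtains h where "h \<in> carrier (aut_group R)"
    and "\<And>x i. x \<in> \<Omega> \<Longrightarrow> i \<in> {-1..d} \<Longrightarrow> h (\<phi> x i) = \<phi> (f x) i"
proof -
  obtain h where h: "h \<in> poset_isos R R" "\<And>x i. x \<in> \<Omega> \<Longrightarrow> i \<in> {-1..d} \<Longrightarrow> h (\<phi> x i) = \<phi> (f x) i"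
    using flag_rel_isomorphism[where \<phi>=\<phi> and \<psi>=\<phi> and d=d and rk=rk and rk'=rk, OF rk rk onto eq] by blast
  let ?h = "restrict h (Field R)"
  have "bij_betw ?h (Field R) (Field R)" using h(1) unfolding poset_isos_def by (simp cong: bij_betw_cong)
  then have "?h \<in> carrier (aut_group R)"
    using h(1) unfolding aut_group_simps Bij_def poset_isos_def by simp
  moreover have "?h (\<phi> x i) = \<phi> (f x) i" if "x \<in> \<Omega>" "i \<in> {-1..d}" for x i
    using h(2) FieldI that by simp
  ultimately show thesis using that by blast
qed

text \<open>Isomorphisms of polytopes preserve ranks, although this is not part of their definition: along a
flag the ranks of the images increase strictly, starting at \<open>-1\<close> or higher. Applying this to the
inverse gives equality.\<close>

lemma iso_rank_le:
  assumes h: "h \<in> poset_isos R s" and s: "\<And>F G. (F, G) \<in> s \<Longrightarrow> F \<noteq> G \<Longrightarrow> rk' F < rk' G"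
    "\<And>F. F \<in> Field s \<Longrightarrow> (-1::int) \<le> rk' F" and F: "F \<in> Field R"
  shows "rk F \<le> rk' (h F)"
proof -
  obtain x where x: "x \<in> \<Omega>" "F = \<phi> x (rk F)" "rk F \<in> {-1..d}" using F by (rule FieldE)
  have hF: "h G \<in> Field s" if "G \<in> Field R" for G
    using h that unfolding poset_isos_def by (auto dest: bij_betwE)
  have "i \<le> d \<longrightarrow> i \<le> rk' (h (\<phi> x i))" if "-1 \<le> i" for i
    using that
  proof (induction i rule: int_ge_induct)
    case base then show ?case using s(2) hF FieldI[OF x(1), of "-1"] by auto
  next
    case (step i)
    show ?case
    proof
      assume i: "i + 1 \<le> d"
      have r: "(\<phi> x i, \<phi> x (i+1)) \<in> R" using step i x by (intro flag_relI) auto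
      have ne: "\<phi> x i \<noteq> \<phi> x (i+1)" using rk[OF x(1), of i] rk[OF x(1), of "i+1"] step i by auto
      have f: "\<phi> x i \<in> Field R" "\<phi> x (i+1) \<in> Field R" using r by (auto intro: FieldI1 FieldI2)
      have "(h (\<phi> x i), h (\<phi> x (i+1))) \<in> s" using h r f unfolding poset_isos_def by blast
      moreover have "h (\<phi> x i) \<noteq> h (\<phi> x (i+1))"
        using h ne f unfolding poset_isos_def bij_betw_def inj_on_def by blast
      ultimately have "rk' (h (\<phi> x i)) < rk' (h (\<phi> x (i+1)))" by (rule s(1))
      then show "i + 1 \<le> rk' (h (\<phi> x (i + 1)))" using step i by simp
    qed
  qed
  then show ?thesis using x by (metis atLeastAtMost_iff)
qed

end

context
  fixes \<Omega> :: "'x set" and \<phi> :: "'x \<Rightarrow> int \<Rightarrow> 'a" and d rk adj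
    and \<Omega>' :: "'y set" and \<psi> :: "'y \<Rightarrow> int \<Rightarrow> 'b" and rk' adj' h
  assumes X1: "flag_system \<Omega> \<phi> d rk adj" and Y1: "flag_system \<Omega>' \<psi> d rk' adj'"
    and h: "h \<in> poset_isos (flag_rel \<Omega> \<phi> d) (flag_rel \<Omega>' \<psi> d)"
begin

interpretation X: flag_system \<Omega> \<phi> d rk adj by (rule X1)
interpretation Y: flag_system \<Omega>' \<psi> d rk' adj' by (rule Y1)

lemma iso_rank:
  assumes F: "F \<in> Field X.R" shows "rk' (h F) = rk F"
proof (rule order_antisym)
  have b: "bij_betw h (Field X.R) (Field Y.R)" using h unfolding poset_isos_def by blast
  interpret PX: abstract_polytope d X.R rk by (rule X.abstract_polytope_R)
  interpret PY: abstract_polytope d Y.R rk' by (rule Y.abstract_polytope_R)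
  show "rk F \<le> rk' (h F)"
    by (rule X.iso_rank_le[OF h _ _ F]) (use PY.rank_strict_mono PY.rank_range in auto)
  have "rk' (h F) \<le> rk (inv_into (Field X.R) h (h F))"
    by (rule Y.iso_rank_le[OF poset_isos_inv[OF h]])
      (use PX.rank_strict_mono PX.rank_range F b in \<open>auto dest: bij_betwE\<close>)
  then show "rk' (h F) \<le> rk F" using bij_betw_inv_into_left[OF b F] by simp
qed

text \<open>The image of a flag is a chain, hence lies in a chamber, and it fills that chamber because ranks are
preserved.\<close>

lemma iso_chamber:
  assumes x: "x \<in> \<Omega>"
  obtains y where "y \<in> \<Omega>'" "\<And>i. i \<in> {-1..d} \<Longrightarrow> h (\<phi> x i) = \<psi> y i"
proof -
  have "h ` \<phi> x ` {-1..d} \<in> Chains Y.R"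
    using X.chamber_chain[OF x] h X.FieldI[OF x] unfolding Chains_def poset_isos_def by (auto 0 4)
  then obtain y where y: "y \<in> \<Omega>'" "h ` \<phi> x ` {-1..d} \<subseteq> \<psi> y ` {-1..d}" by (rule Y.chain_in_chamber)
  have "h (\<phi> x i) = \<psi> y i" if i: "i \<in> {-1..d}" for i
  proof -
    obtain j where j: "j \<in> {-1..d}" "h (\<phi> x i) = \<psi> y j" using y(2) i by blast
    have "rk' (h (\<phi> x i)) = i" using iso_rank[OF X.FieldI[OF x i]] X.rk[OF x i] by simp
    then show ?thesis using j Y.rk[OF y(1) j(1)] by simp
  qed
  then show thesis using that y by blast
qed

lemma iso_card_le:
  assumes fin: "finite \<Omega>'" shows "card \<Omega> \<le> card \<Omega>'"
proof -
  define f where "f x = (SOME y. y \<in> \<Omega>' \<and> (\<forall>i\<in>{-1..d}. h (\<phi> x i) = \<psi> y i))" for x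
  have f: "f x \<in> \<Omega>' \<and> (\<forall>i\<in>{-1..d}. h (\<phi> x i) = \<psi> (f x) i)" if "x \<in> \<Omega>" for x
    unfolding f_def by (rule someI_ex) (use iso_chamber[OF that] in metis)
  have inj: "inj_on h (Field X.R)" using h unfolding poset_isos_def bij_betw_def by blast
  have "inj_on f \<Omega>"
  proof (rule inj_onI)
    fix x y assume xy: "x \<in> \<Omega>" "y \<in> \<Omega>" "f x = f y"
    show "x = y"
    proof (rule X.eq_iff[OF xy(1,2)])
      fix i assume i: "i \<in> {-1..d}"
      have "h (\<phi> x i) = h (\<phi> y i)" using f xy i by metis
      then show "\<phi> x i = \<phi> y i" using inj X.FieldI xy i by (meson inj_onD)
    qed
  qed
  then show ?thesis using f fin by (intro card_inj_on_le[of f]) auto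
qed

text \<open>Isomorphisms that agree on one chamber agree on all chambers, since the adjacent chamber in rank \<open>j\<close>
is determined by the chamber and \<open>j\<close>. In particular automorphisms act freely on flags.\<close>

lemma iso_agree:
  assumes g: "g \<in> poset_isos (flag_rel \<Omega> \<phi> d) (flag_rel \<Omega>' \<psi> d)"
    and x: "x \<in> \<Omega>" and e: "\<And>i. i \<in> {-1..d} \<Longrightarrow> h (\<phi> x i) = g (\<phi> x i)"
    and F: "F \<in> Field (flag_rel \<Omega> \<phi> d)"
    and g_chamber: "\<And>x. x \<in> \<Omega> \<Longrightarrow> \<exists>y\<in>\<Omega>'. \<forall>i\<in>{-1..d}. g (\<phi> x i) = \<psi> y i"
  shows "h F = g F"
proof -
  obtain y where y: "y \<in> \<Omega>" "F = \<phi> y (rk F)" "rk F \<in> {-1..d}" using F by (rule X.FieldE)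
  have adj_image: "\<psi> u j = \<psi> (adj' j z) j"
    if k: "k \<in> poset_isos X.R Y.R" and w: "w \<in> \<Omega>" "j \<in> {0..<d}"
      and z: "z \<in> \<Omega>'" "\<forall>i\<in>{-1..d}. k (\<phi> w i) = \<psi> z i"
      and u: "u \<in> \<Omega>'" "\<forall>i\<in>{-1..d}. k (\<phi> (adj j w) i) = \<psi> u i" for k w j z u
  proof -
    have "\<psi> z i = \<psi> u i" if "i \<in> {-1..d}" "i \<noteq> j" for i
      using z u X.adj_same[OF w that] that by metis
    then have "u = z \<or> u = adj' j z" using Y.thin[OF z(1) u(1), of j] by blast
    moreover have "\<psi> u j \<noteq> \<psi> z j"
    proof
      have j: "j \<in> {-1..d}" using w by auto
      assume "\<psi> u j = \<psi> z j"
      then have "k (\<phi> (adj j w) j) = k (\<phi> w j)" using z u j by simp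
      then have "\<phi> (adj j w) j = \<phi> w j"
        using k X.FieldI[OF w(1) j] X.FieldI[OF X.adj_closed[OF w] j]
        unfolding poset_isos_def bij_betw_def inj_on_def by blast
      then show False using X.adj_diff[OF w] by simp
    qed
    ultimately show ?thesis by blast
  qed
  from X.connected[OF x y(1)] have "y \<in> \<Omega> \<and> (\<forall>i\<in>{-1..d}. h (\<phi> y i) = g (\<phi> y i))"
  proof (induction rule: rtrancl_induct)
    case base then show ?case using x e by blast
  next
    case (step w v)
    then obtain j where j: "v = adj j w" "w \<in> \<Omega>" "j \<in> {0..<d}" by blast
    have v: "v \<in> \<Omega>" using j X.adj_closed by blast
    have hg: "\<forall>i\<in>{-1..d}. h (\<phi> w i) = g (\<phi> w i)" using step.IH by blast
    obtain z where z: "z \<in> \<Omega>'" "\<And>i. i \<in> {-1..d} \<Longrightarrow> h (\<phi> w i) = \<psi> z i"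
      using iso_chamber[OF j(2)] by blast
    obtain u where u: "u \<in> \<Omega>'" "\<And>i. i \<in> {-1..d} \<Longrightarrow> h (\<phi> v i) = \<psi> u i"
      using iso_chamber[OF v] by blast
    obtain u' where u': "u' \<in> \<Omega>'" "\<forall>i\<in>{-1..d}. g (\<phi> v i) = \<psi> u' i" using g_chamber[OF v] by blast
    have "\<psi> u j = \<psi> (adj' j z) j" using adj_image[OF h j(2,3) z(1) _ u(1)] z u j(1) by blast
    moreover have "\<psi> u' j = \<psi> (adj' j z) j" using adj_image[OF g j(2,3) z(1) _ u'(1)] z u' j(1) hg by metis
    ultimately have "h (\<phi> v j) = g (\<phi> v j)" using u u' j by simp
    moreover have "h (\<phi> v i) = g (\<phi> v i)" if "i \<in> {-1..d}" "i \<noteq> j" for i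
      using X.adj_same[OF j(2,3) that] hg that j(1) by simp
    ultimately show ?case using v by blast
  qed
  then show ?thesis using y by metis
qed

end

context flag_system begin

lemma automorphism_chamber:
  assumes h: "h \<in> carrier (aut_group R)" and x: "x \<in> \<Omega>"
  obtains y where "y \<in> \<Omega>" "\<And>i. i \<in> {-1..d} \<Longrightarrow> h (\<phi> x i) = \<phi> y i"
  using iso_chamber[OF flag_system_axioms flag_system_axioms _ x] h unfolding aut_group_simps by blast

lemma automorphism_eqI:
  assumes h: "h \<in> carrier (aut_group R)" and g: "g \<in> carrier (aut_group R)" and x: "x \<in> \<Omega>"
    and e: "\<And>i. i \<in> {-1..d} \<Longrightarrow> h (\<phi> x i) = g (\<phi> x i)"
  shows "h = g"
proof (rule extensionalityI[of _ "Field R"])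
  show "h \<in> extensional (Field R)" "g \<in> extensional (Field R)" using h g unfolding aut_group_simps Bij_def by auto
  show "h F = g F" if "F \<in> Field R" for F
  proof (rule iso_agree[where g=g and h=h and \<phi>=\<phi> and \<psi>=\<phi>, OF flag_system_axioms flag_system_axioms _ _ x e that])
    show "\<exists>y\<in>\<Omega>. \<forall>i\<in>{-1..d}. g (\<phi> x i) = \<phi> y i" if "x \<in> \<Omega>" for x
      using automorphism_chamber[OF g that] by metis
  qed (use h g in \<open>auto simp: aut_group_simps\<close>)
qed

end

lemma face_poset_iso:
  assumes h: "h \<in> poset_isos r s" and r: "Refl r" and s: "Refl s" and G: "G \<in> Field r"
  shows "isomorphic_posets (face_poset r G) (face_poset s (h G))"
proof -
  have fld: "Field (face_poset t F) = under t F" if "Refl t" for t :: "'c rel" and F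
    using that unfolding face_poset_def Field_def under_def refl_on_def by auto
  have b: "bij_betw h (Field r) (Field s)"
    and o: "\<And>F K. F \<in> Field r \<Longrightarrow> K \<in> Field r \<Longrightarrow> (F, K) \<in> r \<longleftrightarrow> (h F, h K) \<in> s"
    using h unfolding poset_isos_def by auto
  have u: "under r G \<subseteq> Field r" unfolding under_def by (auto intro: FieldI1)
  have im: "h ` under r G = under s (h G)"
  proof (intro equalityI subsetI)
    fix F assume "F \<in> h ` under r G"
    then show "F \<in> under s (h G)" using o G unfolding under_def by (auto intro: FieldI1)
  next
    fix F assume F: "F \<in> under s (h G)"
    then have "F \<in> Field s" unfolding under_def by (auto intro: FieldI1)
    then obtain K where K: "K \<in> Field r" "F = h K" using b unfolding bij_betw_def by blast
    then show "F \<in> h ` under r G" using F o[OF K(1) G] unfolding under_def by blast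
  qed
  have "h \<in> poset_isos (face_poset r G) (face_poset s (h G))"
    unfolding poset_isos_def fld[OF r] fld[OF s]
  proof (intro CollectI conjI ballI)
    show "bij_betw h (under r G) (under s (h G))"
      using b u im unfolding bij_betw_def by (auto intro: inj_on_subset)
    fix F K assume FK: "F \<in> under r G" "K \<in> under r G"
    then have "h F \<in> under s (h G)" "h K \<in> under s (h G)" using im by blast+
    then show "(F, K) \<in> face_poset r G \<longleftrightarrow> (h F, h K) \<in> face_poset s (h G)"
      using FK u o unfolding face_poset_def by blast
  qed
  then show ?thesis unfolding isomorphic_posets_def by blast
qed

context flag_system begin

lemma Refl_R: "Refl R"
  using Partial_order_R unfolding partial_order_on_def preorder_on_def by blast

text \<open>Counting automorphisms by the image of a fixed chamber, which determines them.\<close>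

lemma card_automorphisms:
  assumes x: "x \<in> \<Omega>" and Z: "Z \<subseteq> \<Omega>"
    and real: "\<And>z. z \<in> Z \<Longrightarrow> \<exists>h \<in> carrier (aut_group R). \<forall>i\<in>{-1..d}. h (\<phi> x i) = \<phi> z i"
  shows "card {h \<in> carrier (aut_group R). \<exists>z\<in>Z. \<forall>i\<in>{-1..d}. h (\<phi> x i) = \<phi> z i} = card Z"
proof -
  let ?H = "{h \<in> carrier (aut_group R). \<exists>z\<in>Z. \<forall>i\<in>{-1..d}. h (\<phi> x i) = \<phi> z i}"
  define f where "f z = (SOME h. h \<in> carrier (aut_group R) \<and> (\<forall>i\<in>{-1..d}. h (\<phi> x i) = \<phi> z i))" for z
  have f: "f z \<in> carrier (aut_group R) \<and> (\<forall>i\<in>{-1..d}. f z (\<phi> x i) = \<phi> z i)" if "z \<in> Z" for z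
    unfolding f_def using someI_ex[OF real[OF that, unfolded Bex_def]] .
  have "bij_betw f Z ?H"
  proof (rule bij_betw_imageI)
    show "inj_on f Z"
    proof (rule inj_onI)
      fix z w assume zw: "z \<in> Z" "w \<in> Z" "f z = f w"
      have "\<phi> z i = \<phi> w i" if "i \<in> {-1..d}" for i
        using f[OF zw(1)] f[OF zw(2)] zw(3) that by metis
      then show "z = w" using eq_iff zw Z by blast
    qed
    show "f ` Z = ?H"
    proof (intro equalityI subsetI)
      fix h assume "h \<in> f ` Z" then show "h \<in> ?H" using f by blast
    next
      fix h assume "h \<in> ?H"
      then obtain z where z: "h \<in> carrier (aut_group R)" "z \<in> Z" "\<forall>i\<in>{-1..d}. h (\<phi> x i) = \<phi> z i" by blast
      have "h (\<phi> x i) = f z (\<phi> x i)" if "i \<in> {-1..d}" for i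
        using bspec[OF z(3) that] bspec[OF conjunct2[OF f[OF z(2)]] that] by simp
      with automorphism_eqI[OF z(1) conjunct1[OF f[OF z(2)]] x] have "h = f z" .
      then show "h \<in> f ` Z" using z by blast
    qed
  qed
  from bij_betw_same_card[OF this] show ?thesis by (rule sym)
qed

end

section \<open>Tail-triangle groups\<close>

text \<open>The generators \<open>\<rho> 0, \<dots>, \<rho> (d - 2)\<close> form a string; the additional generator \<open>\<rho> (d - 1)\<close> is a second
end of it: like \<open>\<rho> (d - 2)\<close> it fails to commute only with \<open>\<rho> (d - 3)\<close>.\<close>

locale tail_triangle = group G for G :: "'a monoid" (structure) +
  fixes d :: nat and \<rho> :: "nat \<Rightarrow> 'a"
  assumes d3: "3 \<le> d"
    and finite_carrier: "finite (carrier G)"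
    and gen_closed: "i < d \<Longrightarrow> \<rho> i \<in> carrier G"
    and invol: "i < d \<Longrightarrow> \<rho> i \<otimes> \<rho> i = \<one>"
    and nontrivial: "i < d \<Longrightarrow> \<rho> i \<noteq> \<one>"
    and commute: "i + 2 \<le> j \<Longrightarrow> j < d - 1 \<Longrightarrow> \<rho> i \<otimes> \<rho> j = \<rho> j \<otimes> \<rho> i"
    and commute_last: "i < d \<Longrightarrow> i \<noteq> d - 3 \<Longrightarrow> \<rho> i \<otimes> \<rho> (d - 1) = \<rho> (d - 1) \<otimes> \<rho> i"
    and generates: "generate G (\<rho> ` {..<d}) = carrier G"
    and intersection: "I \<subseteq> {..<d} \<Longrightarrow> J \<subseteq> {..<d} \<Longrightarrow>
      generate G (\<rho> ` I) \<inter> generate G (\<rho> ` J) \<subseteq> generate G (\<rho> ` (I \<inter> J))"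
begin

abbreviation par :: "nat set \<Rightarrow> 'a set" where "par I \<equiv> generate G (\<rho> ` I)"

lemma gens_closed: "I \<subseteq> {..<d} \<Longrightarrow> \<rho> ` I \<subseteq> carrier G"
  using gen_closed by auto

lemma par_subgroup: "I \<subseteq> {..<d} \<Longrightarrow> subgroup (par I) G"
  by (rule generate_is_subgroup[OF gens_closed])

lemma par_carrier: "I \<subseteq> {..<d} \<Longrightarrow> g \<in> par I \<Longrightarrow> g \<in> carrier G"
  using generate_in_carrier gens_closed by blast

lemma par_mono: "I \<subseteq> J \<Longrightarrow> par I \<subseteq> par J"
  by (intro mono_generate image_mono)

lemma gen_par: "i \<in> I \<Longrightarrow> \<rho> i \<in> par I"
  by (intro generate.incl imageI)

lemma inv_gen: "i < d \<Longrightarrow> inv \<rho> i = \<rho> i"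
  using inv_equality[OF invol] gen_closed by simp

lemma par_induct [consumes 2, case_names one step]:
  assumes I: "I \<subseteq> {..<d}" and g: "g \<in> par I" and 1: "Q \<one>"
    and step: "\<And>h i. h \<in> par I \<Longrightarrow> Q h \<Longrightarrow> i \<in> I \<Longrightarrow> Q (h \<otimes> \<rho> i)"
  shows "Q g"
proof -
  note cl = par_carrier[OF I]
  from g have "\<forall>h. h \<in> par I \<longrightarrow> Q h \<longrightarrow> Q (h \<otimes> g)"
  proof (induction rule: generate.induct)
    case one then show ?case using cl by simp
  next
    case (incl r) then show ?case using step by blast
  next
    case (inv r)
    then obtain i where "i \<in> I" "r = \<rho> i" by blast
    then show ?case using step I inv_gen by fastforce
  next
    case (eng a b)
    show ?case
    proof (intro allI impI)
      fix h assume h: "h \<in> par I" "Q h"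
      have "Q ((h \<otimes> a) \<otimes> b)" using eng h generate.eng[of h G _ a] by blast
      then show "Q (h \<otimes> (a \<otimes> b))" using m_assoc[of h a b] eng h cl by simp
    qed
  qed
  then have "Q (\<one> \<otimes> g)" using 1 generate.one by blast
  then show ?thesis using cl[OF g] by simp
qed

lemma par_Int: "I \<subseteq> {..<d} \<Longrightarrow> J \<subseteq> {..<d} \<Longrightarrow> par I \<inter> par J = par (I \<inter> J)"
  using intersection par_mono by (intro equalityI Int_greatest) auto

lemma par_INT:
  assumes "finite K" "\<And>k. k \<in> K \<Longrightarrow> f k \<subseteq> {..<d}" "g \<in> carrier G" "\<And>k. k \<in> K \<Longrightarrow> g \<in> par (f k)"
  shows "g \<in> par {i. i < d \<and> (\<forall>k\<in>K. i \<in> f k)}"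
  using assms
proof (induction K rule: finite_induct)
  case empty
  have "{i. i < d \<and> (\<forall>k\<in>{}. i \<in> f k)} = {..<d}" by auto
  then show ?case using empty(2) generates by simp
next
  case (insert k K)
  have "{i. i < d \<and> (\<forall>k\<in>insert k K. i \<in> f k)} = f k \<inter> {i. i < d \<and> (\<forall>k\<in>K. i \<in> f k)}"
    using insert.prems(1)[of k] by auto
  moreover have "g \<in> par (f k) \<inter> par {i. i < d \<and> (\<forall>k\<in>K. i \<in> f k)}" using insert by simp
  moreover have "par (f k) \<inter> par {i. i < d \<and> (\<forall>k\<in>K. i \<in> f k)} = par (f k \<inter> {i. i < d \<and> (\<forall>k\<in>K. i \<in> f k)})"
    by (rule par_Int) (use insert.prems in auto)
  ultimately show ?case by simp
qed

lemma gen_notin_par: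
  assumes "i < d" "I \<subseteq> {..<d}" "i \<notin> I" shows "\<rho> i \<notin> par I"
proof
  assume "\<rho> i \<in> par I"
  then have "\<rho> i \<in> par {i} \<inter> par I" using gen_par[of i "{i}"] by simp
  then have "\<rho> i \<in> par ({i} \<inter> I)" using par_Int[of "{i}" I] assms(1,2) by blast
  then have "\<rho> i \<in> generate G {}" using assms(3) by simp
  then show False using nontrivial[OF assms(1)] generate_empty by simp
qed

text \<open>The algebraic form of gluing: two chambers with a common face of rank \<open>k\<close> differ by an element that
splits into a part changing only higher faces and a part changing only lower faces.\<close>

lemma commuting_product:
  assumes I: "I \<subseteq> {..<d}" and J: "J \<subseteq> {..<d}"
    and c: "\<And>i j. i \<in> I \<Longrightarrow> j \<in> J \<Longrightarrow> \<rho> i \<otimes> \<rho> j = \<rho> j \<otimes> \<rho> i"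
    and g: "g \<in> par (I \<union> J)"
  obtains u v where "u \<in> par I" "v \<in> par J" "g = u \<otimes> v"
proof -
  have IJ: "I \<union> J \<subseteq> {..<d}" using I J by simp
  have comm: "v \<otimes> \<rho> i = \<rho> i \<otimes> v" if "v \<in> par J" "i \<in> I" for v i
    using J that(1)
  proof (induction rule: par_induct)
    case one then show ?case using gen_closed I that by auto
  next
    case (step h j)
    have cl: "h \<in> carrier G" "\<rho> i \<in> carrier G" "\<rho> j \<in> carrier G"
      using par_carrier[OF J] step gen_closed I J that by auto
    have "h \<otimes> \<rho> j \<otimes> \<rho> i = h \<otimes> (\<rho> i \<otimes> \<rho> j)" using c[OF that(2) step.hyps(2)] cl m_assoc by simp
    also have "\<dots> = \<rho> i \<otimes> (h \<otimes> \<rho> j)" using step.IH cl by (simp add: m_assoc[symmetric])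
    finally show ?case .
  qed
  from IJ g have "\<exists>u\<in>par I. \<exists>v\<in>par J. g = u \<otimes> v"
  proof (induction rule: par_induct)
    case one
    show ?case by (intro bexI[of _ "\<one>"]) (auto intro: generate.one)
  next
    case (step h i)
    then obtain u v where uv: "u \<in> par I" "v \<in> par J" "h = u \<otimes> v" by blast
    have cl: "u \<in> carrier G" "v \<in> carrier G" using par_carrier I J uv by blast+
    have ci: "\<rho> i \<in> carrier G" using step IJ gen_closed by auto
    show ?case
    proof (cases "i \<in> I")
      case True
      have "h \<otimes> \<rho> i = (u \<otimes> \<rho> i) \<otimes> v" using comm[OF uv(2) True] uv(3) cl ci m_assoc by simp
      then show ?thesis using generate.eng[OF uv(1) gen_par[OF True]] uv(2) by blast
    next
      case False
      then have "i \<in> J" using step by blast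
      then have "v \<otimes> \<rho> i \<in> par J" using uv(2) gen_par generate.eng by metis
      moreover have "h \<otimes> \<rho> i = u \<otimes> (v \<otimes> \<rho> i)" using uv(3) cl ci m_assoc by simp
      ultimately show ?thesis using uv(1) by blast
    qed
  qed
  then show thesis using that by blast
qed

text \<open>The bit of a chamber is \<open>False\<close> if its facet is of the kind that uses \<open>\<rho> (d - 2)\<close>, and \<open>True\<close> if it uses
\<open>\<rho> (d - 1)\<close>.\<close>

definition \<Omega> :: "('a \<times> bool) set" where "\<Omega> = carrier G \<times> UNIV"

text \<open>The indices of the generators that fix the face of rank \<open>k\<close> of the chamber \<open>(\<one>, b)\<close>. All generators
fix the least and the greatest face, so these need no separate case; in rank \<open>d - 2\<close> both ends of the
diagram have to be omitted.\<close>

definition fixing_gens :: "int \<Rightarrow> bool \<Rightarrow> nat set" where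
  "fixing_gens k b = (if k = int d - 2 then {..<d - 2}
     else if k = int d - 1 then {..<d} - {if b then d - 2 else d - 1}
     else {i. i < d \<and> int i \<noteq> k})"

definition same :: "int \<Rightarrow> 'a \<times> bool \<Rightarrow> 'a \<times> bool \<Rightarrow> bool" where
  "same k x y \<longleftrightarrow> inv (fst x) \<otimes> fst y \<in> par (fixing_gens k (snd x)) \<and> (k = int d - 1 \<longrightarrow> snd x = snd y)"

text \<open>The generator that changes the face of rank \<open>j \<le> d - 2\<close>; in rank \<open>d - 2\<close> it depends on the kind of the
facet. The facet itself is changed by flipping the bit.\<close>

definition branch :: "bool \<Rightarrow> nat \<Rightarrow> nat" where
  "branch b j = (if b \<and> j = d - 2 then d - 1 else j)"

definition adj :: "int \<Rightarrow> 'a \<times> bool \<Rightarrow> 'a \<times> bool" where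
  "adj j x = (if j = int d - 1 then (fst x, \<not> snd x) else (fst x \<otimes> \<rho> (branch (snd x) (nat j)), snd x))"

lemma fixing_gens_sub: "fixing_gens k b \<subseteq> {..<d}"
  using d3 unfolding fixing_gens_def by auto

lemma fixing_gens_eq: "k \<noteq> int d - 1 \<Longrightarrow> fixing_gens k b = fixing_gens k c"
  unfolding fixing_gens_def by simp

lemma branch_less: assumes "j < d - 1" shows "branch b j < d"
proof -
  have "j < d" "d - 1 < d" using assms d3 by linarith+
  then show ?thesis unfolding branch_def by simp
qed

lemma nat_rank_less: "0 \<le> j \<Longrightarrow> j < int d \<Longrightarrow> j \<noteq> int d - 1 \<Longrightarrow> nat j < d - 1"
  by arith

lemma branch_fixing_gens: "j < d - 1 \<Longrightarrow> int j \<noteq> k \<Longrightarrow> branch b j \<in> fixing_gens k b"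
  unfolding branch_def fixing_gens_def using d3 by auto

lemma branch_notin_fixing_gens: "j < d - 1 \<Longrightarrow> branch b j \<notin> fixing_gens (int j) b"
  unfolding branch_def fixing_gens_def using d3 by auto

lemma same_refl: "x \<in> \<Omega> \<Longrightarrow> same k x x"
  unfolding same_def \<Omega>_def by (auto intro: generate.one)

lemma same_sym: assumes "x \<in> \<Omega>" "y \<in> \<Omega>" "same k x y" shows "same k y x"
proof -
  have e: "fixing_gens k (snd y) = fixing_gens k (snd x)"
    using assms(3) fixing_gens_eq[of k "snd y" "snd x"] unfolding same_def by (cases "k = int d - 1") auto
  have "inv (inv (fst x) \<otimes> fst y) \<in> par (fixing_gens k (snd x))"
    using assms(3) subgroup.m_inv_closed[OF par_subgroup[OF fixing_gens_sub]] unfolding same_def by blast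
  moreover have "inv (inv (fst x) \<otimes> fst y) = inv (fst y) \<otimes> fst x"
    using assms unfolding \<Omega>_def by (auto simp: inv_mult_group)
  ultimately show ?thesis using assms(3) e unfolding same_def by simp
qed

lemma same_trans: assumes "x \<in> \<Omega>" "y \<in> \<Omega>" "z \<in> \<Omega>" "same k x y" "same k y z" shows "same k x z"
proof -
  have e: "fixing_gens k (snd y) = fixing_gens k (snd x)"
    using assms(4) fixing_gens_eq[of k "snd y" "snd x"] unfolding same_def by (cases "k = int d - 1") auto
  have "(inv (fst x) \<otimes> fst y) \<otimes> (inv (fst y) \<otimes> fst z) \<in> par (fixing_gens k (snd x))"
    using assms(4,5) e generate.eng unfolding same_def by metis
  moreover have "(inv (fst x) \<otimes> fst y) \<otimes> (inv (fst y) \<otimes> fst z) = inv (fst x) \<otimes> fst z"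
  proof -
    have "fst x \<in> carrier G" "fst y \<in> carrier G" "fst z \<in> carrier G" using assms(1-3) unfolding \<Omega>_def by auto
    then show ?thesis by (simp add: m_assoc) (simp add: m_assoc[symmetric])
  qed
  ultimately show ?thesis using assms(4,5) unfolding same_def by simp
qed

lemma ends_same: assumes "x \<in> \<Omega>" "y \<in> \<Omega>" "k = -1 \<or> k = int d" shows "same k x y"
proof -
  have "fixing_gens k b = {..<d}" for b using assms(3) d3 unfolding fixing_gens_def by auto
  then show ?thesis using assms d3 generates unfolding same_def \<Omega>_def by auto
qed

lemma same_mult:
  assumes "g \<in> carrier G" "w \<in> par (fixing_gens k b)"
  shows "same k (g, b) (g \<otimes> w, b)"
proof -
  have "w \<in> carrier G" using assms par_carrier fixing_gens_sub by blast
  then have "inv g \<otimes> (g \<otimes> w) = w" using assms(1) by (simp add: m_assoc[symmetric])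
  then show ?thesis using assms unfolding same_def by simp
qed

end

text \<open>There are finitely many cosets, so faces can be labelled by natural numbers.\<close>

lemma (in tail_triangle) face_labels:
  obtains \<phi> :: "'a \<times> bool \<Rightarrow> int \<Rightarrow> nat" and rk where
    "\<And>x k. x \<in> \<Omega> \<Longrightarrow> k \<in> {-1..int d} \<Longrightarrow> rk (\<phi> x k) = k"
    "\<And>x y k. x \<in> \<Omega> \<Longrightarrow> y \<in> \<Omega> \<Longrightarrow> k \<in> {-1..int d} \<Longrightarrow> \<phi> x k = \<phi> y k \<longleftrightarrow> same k x y"
proof -
  define c where "c k x = (k, {y \<in> \<Omega>. same k x y})" for k x
  have fin: "finite \<Omega>" unfolding \<Omega>_def using finite_carrier by simp
  have "finite ({-1..int d} \<times> Pow \<Omega>)" using fin by simp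
  then obtain e :: "int \<times> ('a \<times> bool) set \<Rightarrow> nat" where e: "inj_on e ({-1..int d} \<times> Pow \<Omega>)"
    using finite_imp_inj_to_nat_seg by metis
  have c: "c k x \<in> {-1..int d} \<times> Pow \<Omega>" if "k \<in> {-1..int d}" for k x
    using that unfolding c_def by auto
  have ceq: "c k x = c k y \<longleftrightarrow> same k x y" if "x \<in> \<Omega>" "y \<in> \<Omega>" for k x y
  proof
    assume "c k x = c k y"
    then have "y \<in> {z \<in> \<Omega>. same k x z}" using same_refl that unfolding c_def by auto
    then show "same k x y" by simp
  next
    assume s: "same k x y"
    have "same k x z \<longleftrightarrow> same k y z" if "z \<in> \<Omega>" for z
      using same_trans same_sym s that \<open>x \<in> \<Omega>\<close> \<open>y \<in> \<Omega>\<close> by metis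
    then show "c k x = c k y" unfolding c_def by auto
  qed
  show thesis
  proof (rule that[of "\<lambda>n. fst (inv_into ({-1..int d} \<times> Pow \<Omega>) e n)" "\<lambda>x k. e (c k x)"])
    show "fst (inv_into ({-1..int d} \<times> Pow \<Omega>) e (e (c k x))) = k" if "k \<in> {-1..int d}" for x k
      using inv_into_f_f[OF e c[OF that]] unfolding c_def by simp
    show "e (c k x) = e (c k y) \<longleftrightarrow> same k x y" if "x \<in> \<Omega>" "y \<in> \<Omega>" "k \<in> {-1..int d}" for x y k
      using inj_on_eq_iff[OF e c[OF that(3)] c[OF that(3)]] ceq that by simp
  qed
qed

locale tail_triangle_polytope = tail_triangle +
  fixes \<phi> :: "'a \<times> bool \<Rightarrow> int \<Rightarrow> 'b" and rk :: "'b \<Rightarrow> int"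
  assumes rk_\<phi>: "x \<in> \<Omega> \<Longrightarrow> k \<in> {-1..int d} \<Longrightarrow> rk (\<phi> x k) = k"
    and \<phi>_eq: "x \<in> \<Omega> \<Longrightarrow> y \<in> \<Omega> \<Longrightarrow> k \<in> {-1..int d} \<Longrightarrow> \<phi> x k = \<phi> y k \<longleftrightarrow> same k x y"
begin

lemma \<Omega>_mem: "(g, b) \<in> \<Omega> \<longleftrightarrow> g \<in> carrier G"
  unfolding \<Omega>_def by simp

lemma chamber_glue:
  assumes x: "x \<in> \<Omega>" and y: "y \<in> \<Omega>" and k: "k \<in> {-1..int d}" and s: "same k x y"
  shows "\<exists>z \<in> \<Omega>. (\<forall>i \<in> {-1..k}. same i z x) \<and> (\<forall>i \<in> {k..int d}. same i z y)"
proof -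
  obtain g b where gb: "x = (g, b)" "g \<in> carrier G" using x unfolding \<Omega>_def by auto
  obtain h c where hc: "y = (h, c)" "h \<in> carrier G" using y unfolding \<Omega>_def by auto
  consider "k = -1" | "k = int d" | "k = int d - 1" | "k = int d - 2" | "0 \<le> k" "k \<le> int d - 3"
    using k by force
  then show ?thesis
  proof cases
    case 1
    then show ?thesis using ends_same[OF y x] same_refl[OF y] y by (intro bexI[of _ y]) auto
  next
    case 2
    then show ?thesis using ends_same[OF x y] same_refl[OF x] x by (intro bexI[of _ x]) auto
  next
    case 3
    have "same i x y" if "i \<in> {k..int d}" for i
    proof (cases "i = k")
      case False
      then have "i = int d" using that 3 by auto
      then show ?thesis using ends_same[OF x y] by blast
    qed (use s in simp)
    then show ?thesis using same_refl[OF x] x by (intro bexI[of _ x]) auto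
  next
    case 4
    let ?z = "(g, c)"
    have z: "?z \<in> \<Omega>" using gb \<Omega>_mem by simp
    have "same i ?z x" if "i \<in> {-1..k}" for i
      using that 4 gb same_refl[OF x, of i] unfolding same_def by (auto intro: generate.one)
    moreover have "same i ?z y" if "i \<in> {k..int d}" for i
    proof (cases "i = int d")
      case True then show ?thesis using ends_same[OF z y] by blast
    next
      case False
      have "fixing_gens k b \<subseteq> fixing_gens i c" using that 4 d3 False unfolding fixing_gens_def by auto
      then show ?thesis using s gb hc par_mono[of "fixing_gens k b" "fixing_gens i c"] unfolding same_def by auto
    qed
    ultimately show ?thesis using z by blast
  next
    case 5
    define I where "I = {i. i < d \<and> k < int i}"
    define J where "J = {i. i < d \<and> int i < k}"
    have IJ: "I \<subseteq> {..<d}" "J \<subseteq> {..<d}" unfolding I_def J_def by auto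
    have "fixing_gens k b = I \<union> J" using 5 unfolding fixing_gens_def I_def J_def by auto
    then have gh: "inv g \<otimes> h \<in> par (I \<union> J)" using s gb hc unfolding same_def by simp
    have c: "\<rho> i \<otimes> \<rho> j = \<rho> j \<otimes> \<rho> i" if "i \<in> I" "j \<in> J" for i j
    proof (cases "i = d - 1")
      case True
      then show ?thesis using commute_last[of j] that 5 unfolding I_def J_def by force
    next
      case False
      then have "j + 2 \<le> i" "i < d - 1" using that 5 unfolding I_def J_def by auto
      then show ?thesis using commute[of j i] by simp
    qed
    obtain u v where uv: "u \<in> par I" "v \<in> par J" "inv g \<otimes> h = u \<otimes> v"
      by (rule commuting_product[OF IJ c gh])
    have cl: "u \<in> carrier G" "v \<in> carrier G" using uv par_carrier IJ by blast+
    let ?z = "(g \<otimes> u, c)"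
    have z: "?z \<in> \<Omega>" using gb cl \<Omega>_mem by simp
    have h: "h = g \<otimes> u \<otimes> v" using uv(3) gb hc cl by (metis inv_solve_left' m_assoc m_closed)
    have "same i ?z x" if i: "i \<in> {-1..k}" for i
    proof -
      have "I \<subseteq> fixing_gens i b" using i 5 unfolding fixing_gens_def I_def by auto
      then have "same i (g, b) (g \<otimes> u, b)" using same_mult gb(2) uv(1) par_mono by blast
      then have "same i x ?z" using i 5 gb unfolding same_def by simp
      then show ?thesis using same_sym x z by blast
    qed
    moreover have "same i ?z y" if i: "i \<in> {k..int d}" for i
    proof -
      have "J \<subseteq> fixing_gens i c" using i 5 unfolding fixing_gens_def J_def by auto
      then show ?thesis unfolding hc(1) h using same_mult[of "g \<otimes> u" v i c] gb(2) cl(1) uv(2) par_mono by blast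
    qed
    ultimately show ?thesis using z by blast
  qed
qed

lemma adj_same_face:
  assumes x: "x \<in> \<Omega>" and j: "j \<in> {0..<int d}" and i: "i \<noteq> j"
  shows "same i x (adj j x)"
proof -
  obtain g b where gb: "x = (g, b)" "g \<in> carrier G" using x unfolding \<Omega>_def by auto
  show ?thesis
  proof (cases "j = int d - 1")
    case True
    then show ?thesis using gb i unfolding adj_def same_def by (auto intro: generate.one)
  next
    case False
    then have "\<rho> (branch b (nat j)) \<in> par (fixing_gens i b)" using branch_fixing_gens[of "nat j" i b] nat_rank_less[of j] gen_par j i by auto
    then show ?thesis using same_mult[OF gb(2)] False gb unfolding adj_def by simp
  qed
qed

lemma adj_closed_\<Omega>: "x \<in> \<Omega> \<Longrightarrow> j \<in> {0..<int d} \<Longrightarrow> adj j x \<in> \<Omega>"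
  unfolding adj_def \<Omega>_def using branch_less[of "nat j"] nat_rank_less[of j] gen_closed by auto

lemma adj_neq_face:
  assumes x: "x \<in> \<Omega>" and j: "j \<in> {0..<int d}"
  shows "\<not> same j x (adj j x)"
proof -
  obtain g b where gb: "x = (g, b)" "g \<in> carrier G" using x unfolding \<Omega>_def by auto
  show ?thesis
  proof (cases "j = int d - 1")
    case True then show ?thesis unfolding same_def adj_def by simp
  next
    case False
    let ?i = "branch b (nat j)"
    have i: "?i < d" "?i \<notin> fixing_gens j b" using branch_less[of "nat j" b] branch_notin_fixing_gens[of "nat j" b] nat_rank_less[of j] j False by auto
    have "inv g \<otimes> (g \<otimes> \<rho> ?i) = \<rho> ?i" using gb gen_closed[OF i(1)] by (simp add: m_assoc[symmetric])
    then show ?thesis using gen_notin_par[OF i(1) fixing_gens_sub i(2)] False gb unfolding same_def adj_def by simp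
  qed
qed

text \<open>By the intersection property the group elements of two chambers differ by a product of generators
that fix all common faces. Each factor is one step of a path. If the facets may change, a factor
\<open>\<rho> (d - 2)\<close> or \<open>\<rho> (d - 1)\<close> is preceded by setting the bit to the value for which it is an adjacency;
otherwise only one of the two can occur.\<close>

lemma chamber_connected:
  assumes x: "x \<in> \<Omega>" and y: "y \<in> \<Omega>"
  shows "(x, y) \<in> {(z, adj j z) | z j. z \<in> \<Omega> \<and> j \<in> {0..<int d} \<and> \<not> same j x y}\<^sup>*" (is "_ \<in> ?S\<^sup>*")
proof -
  obtain g b where gb: "x = (g, b)" "g \<in> carrier G" using x unfolding \<Omega>_def by auto
  obtain h c where hc: "y = (h, c)" "h \<in> carrier G" using y unfolding \<Omega>_def by auto
  define J where "J = {j \<in> {0..<int d}. same j x y}"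
  define I where "I = {i. i < d \<and> (\<forall>k\<in>J. i \<in> fixing_gens k b)}"
  have I: "I \<subseteq> {..<d}" unfolding I_def by auto
  have gh: "inv g \<otimes> h \<in> par I" unfolding I_def
  proof (rule par_INT)
    show "finite J" unfolding J_def by (rule finite_subset[of _ "{0..<int d}"]) auto
    show "fixing_gens k b \<subseteq> {..<d}" for k by (rule fixing_gens_sub)
    show "inv g \<otimes> h \<in> carrier G" using gb hc by simp
    show "inv g \<otimes> h \<in> par (fixing_gens k b)" if "k \<in> J" for k
      using that gb hc unfolding J_def same_def by simp
  qed
  have S: "(z, adj j z) \<in> ?S" if "z \<in> \<Omega>" "j \<in> {0..<int d}" "j \<notin> J" for z j
    using that unfolding J_def by blast
  have low: "int i \<notin> J" if "i \<in> I" "i < d - 2" for i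
  proof
    assume "int i \<in> J"
    then have "branch b i \<in> fixing_gens (int i) b" using that unfolding I_def branch_def by simp
    then show False using branch_notin_fixing_gens[of i b] that by simp
  qed
  have high: "int d - 2 \<notin> J" if "i \<in> I" "d - 2 \<le> i" for i
  proof
    assume "int d - 2 \<in> J"
    then have "i \<in> fixing_gens (int d - 2) b" using that unfolding I_def by simp
    then show False using that unfolding fixing_gens_def by simp
  qed
  have top: "i = branch b (d - 2)" if "i \<in> I" "d - 2 \<le> i" "int d - 1 \<in> J" for i
  proof -
    have "i \<in> fixing_gens (int d - 1) b" using that unfolding I_def by simp
    then show ?thesis using that(2) d3 unfolding fixing_gens_def branch_def by (auto split: if_splits)
  qed
  have flip: "((z, e), (z, e')) \<in> ?S\<^sup>*" if "z \<in> carrier G" "int d - 1 \<notin> J \<or> e = e'" for z e e'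
  proof (cases "e = e'")
    case False
    then have "(z, e') = adj (int d - 1) (z, e)" unfolding adj_def by auto
    moreover have "((z, e), adj (int d - 1) (z, e)) \<in> ?S"
      by (rule S) (use that False d3 \<Omega>_mem in auto)
    ultimately show ?thesis by (metis (no_types, lifting) r_into_rtrancl)
  qed simp
  have "\<exists>e. (x, (g \<otimes> w, e)) \<in> ?S\<^sup>* \<and> (int d - 1 \<in> J \<longrightarrow> e = b)" if "w \<in> par I" for w
    using I that
  proof (induction rule: par_induct)
    case one then show ?case using gb by auto
  next
    case (step w i)
    then obtain e where e: "(x, (g \<otimes> w, e)) \<in> ?S\<^sup>*" "int d - 1 \<in> J \<longrightarrow> e = b" by blast
    have cl: "w \<in> carrier G" "i < d" "\<rho> i \<in> carrier G" using step I par_carrier gen_closed by auto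
    have gw: "g \<otimes> w \<in> carrier G" "g \<otimes> w \<otimes> \<rho> i = g \<otimes> (w \<otimes> \<rho> i)" using cl gb m_assoc by auto
    show ?case
    proof (cases "i < d - 2")
      case True
      then have "adj (int i) (g \<otimes> w, e) = (g \<otimes> w \<otimes> \<rho> i, e)" unfolding adj_def branch_def by auto
      then have "((g \<otimes> w, e), (g \<otimes> (w \<otimes> \<rho> i), e)) \<in> ?S"
        using S[of "(g \<otimes> w, e)" "int i"] low[OF step.hyps(2) True] gw \<Omega>_mem cl(2) by simp
      then show ?thesis using e by (meson rtrancl.rtrancl_into_rtrancl)
    next
      case False
      \<comment> \<open>the bit for which \<open>\<rho> i\<close> is the adjacency in rank \<open>d - 2\<close>\<close>
      define e' where "e' = (if int d - 1 \<in> J then b else i = d - 1)"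
      have i: "i = branch e' (d - 2)"
        using False top[OF step.hyps(2)] cl(2) d3 unfolding e'_def branch_def by auto
      have 1: "((g \<otimes> w, e), (g \<otimes> w, e')) \<in> ?S\<^sup>*" using flip[OF gw(1)] e(2) unfolding e'_def by auto
      have "adj (int d - 2) (g \<otimes> w, e') = (g \<otimes> w \<otimes> \<rho> i, e')" using i d3 unfolding adj_def by (auto simp: nat_diff_distrib)
      then have "((g \<otimes> w, e'), (g \<otimes> (w \<otimes> \<rho> i), e')) \<in> ?S"
        using S[of "(g \<otimes> w, e')" "int d - 2"] high[OF step.hyps(2)] False gw \<Omega>_mem d3 by simp
      then have "(x, (g \<otimes> (w \<otimes> \<rho> i), e')) \<in> ?S\<^sup>*"
        using e(1) 1 by (meson rtrancl.rtrancl_into_rtrancl rtrancl_trans)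
      then show ?thesis unfolding e'_def by auto
    qed
  qed
  from this[OF gh] obtain e where e: "(x, (g \<otimes> (inv g \<otimes> h), e)) \<in> ?S\<^sup>*" "int d - 1 \<in> J \<longrightarrow> e = b" by blast
  have "g \<otimes> (inv g \<otimes> h) = h" using gb hc by (simp add: m_assoc[symmetric])
  moreover have "int d - 1 \<notin> J \<or> e = c" using e(2) gb hc unfolding J_def same_def by auto
  ultimately show ?thesis using e(1) flip[OF hc(2), of e c] hc by (metis (no_types, lifting) rtrancl_trans)
qed

sublocale flag_system \<Omega> \<phi> "int d" rk adj
proof
  show "\<Omega> \<noteq> {}" unfolding \<Omega>_def by auto
  show "-1 \<le> int d" by simp
  show "rk (\<phi> x i) = i" if "x \<in> \<Omega>" "i \<in> {-1..int d}" for x i by (rule rk_\<phi>[OF that])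
  show "\<phi> x (-1) = \<phi> y (-1)" "\<phi> x (int d) = \<phi> y (int d)" if "x \<in> \<Omega>" "y \<in> \<Omega>" for x y
    using \<phi>_eq ends_same that by auto
  show "\<exists>z\<in>\<Omega>. (\<forall>i\<in>{-1..k}. \<phi> z i = \<phi> x i) \<and> (\<forall>i\<in>{k..int d}. \<phi> z i = \<phi> y i)"
    if x: "x \<in> \<Omega>" and y: "y \<in> \<Omega>" and k: "k \<in> {-1..int d}" and e: "\<phi> x k = \<phi> y k" for x y k
  proof -
    obtain z where z: "z \<in> \<Omega>" "\<forall>i \<in> {-1..k}. same i z x" "\<forall>i \<in> {k..int d}. same i z y"
      using chamber_glue[OF x y k] \<phi>_eq[OF x y k] e by blast
    then show ?thesis using \<phi>_eq[OF z(1) x] \<phi>_eq[OF z(1) y] k by (intro bexI[OF _ z(1)]) auto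
  qed
  show "\<phi> (adj j x) i = \<phi> x i" if "x \<in> \<Omega>" "j \<in> {0..<int d}" "i \<in> {-1..int d}" "i \<noteq> j" for x i j
    using adj_same_face[OF that(1,2,4)] \<phi>_eq[OF that(1) adj_closed_\<Omega>[OF that(1,2)] that(3)] by simp
  show "\<phi> (adj j x) j \<noteq> \<phi> x j" if "x \<in> \<Omega>" "j \<in> {0..<int d}" for x j
    using adj_neq_face[OF that] \<phi>_eq[OF that(1) adj_closed_\<Omega>[OF that], of j] that by auto
  show "adj j (adj j x) = x" if "x \<in> \<Omega>" "j \<in> {0..<int d}" for x j
  proof (cases "j = int d - 1")
    case False
    then have "branch (snd x) (nat j) < d" using that branch_less nat_rank_less by simp
    then show ?thesis using False that invol gen_closed unfolding adj_def \<Omega>_def by (auto simp: m_assoc)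
  qed (simp add: adj_def)
  show "(x, y) \<in> {(z, adj j z) |z j. z \<in> \<Omega> \<and> j \<in> {0..<int d} \<and> \<phi> x j \<noteq> \<phi> y j}\<^sup>*"
    if "x \<in> \<Omega>" "y \<in> \<Omega>" for x y
  proof (rule subsetD[OF rtrancl_mono chamber_connected[OF that]])
    show "{(z, adj j z) |z j. z \<in> \<Omega> \<and> j \<in> {0..<int d} \<and> \<not> same j x y} \<subseteq>
      {(z, adj j z) |z j. z \<in> \<Omega> \<and> j \<in> {0..<int d} \<and> \<phi> x j \<noteq> \<phi> y j}"
    proof
      fix p assume "p \<in> {(z, adj j z) |z j. z \<in> \<Omega> \<and> j \<in> {0..<int d} \<and> \<not> same j x y}"
      then obtain z j where p: "p = (z, adj j z)" "z \<in> \<Omega>" "j \<in> {0..<int d}" "\<not> same j x y" by blast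
      have "\<phi> x j \<noteq> \<phi> y j" using \<phi>_eq[OF that, of j] p(3,4) by simp
      then show "p \<in> {(z, adj j z) |z j. z \<in> \<Omega> \<and> j \<in> {0..<int d} \<and> \<phi> x j \<noteq> \<phi> y j}" using p by blast
    qed
  qed
qed (rule adj_closed_\<Omega>)

end

section \<open>Sections and symbols\<close>

context tail_triangle_polytope
begin

definition shift :: "'a \<Rightarrow> 'a \<times> bool \<Rightarrow> 'a \<times> bool" where
  "shift a x = (a \<otimes> fst x, snd x)"

lemma fst_\<Omega>: "x \<in> \<Omega> \<Longrightarrow> fst x \<in> carrier G"
  unfolding \<Omega>_def by auto

lemma shift_\<Omega>: "a \<in> carrier G \<Longrightarrow> x \<in> \<Omega> \<Longrightarrow> shift a x \<in> \<Omega>"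
  unfolding shift_def \<Omega>_def by auto

lemma inv_mult_mult:
  "a \<in> carrier G \<Longrightarrow> g \<in> carrier G \<Longrightarrow> h \<in> carrier G \<Longrightarrow> inv (a \<otimes> g) \<otimes> (a \<otimes> h) = inv g \<otimes> h"
  by (simp add: inv_mult_group m_assoc) (simp add: m_assoc[symmetric])

lemma shift_same: "a \<in> carrier G \<Longrightarrow> x \<in> \<Omega> \<Longrightarrow> y \<in> \<Omega> \<Longrightarrow> same k (shift a x) (shift a y) \<longleftrightarrow> same k x y"
  unfolding same_def shift_def using inv_mult_mult fst_\<Omega> by simp

lemma shift_inverse: "a \<in> carrier G \<Longrightarrow> x \<in> \<Omega> \<Longrightarrow> shift a (shift (inv a) x) = x"
  unfolding shift_def using fst_\<Omega>[of x] by (simp add: m_assoc[symmetric])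

lemma shift_eq:
  assumes a: "a \<in> carrier G" and x: "x \<in> \<Omega>" "y \<in> \<Omega>" and k: "k \<in> {-1..int d}"
  shows "\<phi> (shift a x) k = \<phi> (shift a y) k \<longleftrightarrow> \<phi> x k = \<phi> y k"
  using \<phi>_eq[OF x k] \<phi>_eq[OF shift_\<Omega>[OF a x(1)] shift_\<Omega>[OF a x(2)] k] shift_same[OF a x] by simp

lemma left_automorphism:
  assumes a: "a \<in> carrier G"
  obtains h where "h \<in> carrier (aut_group R)"
    "\<And>x i. x \<in> \<Omega> \<Longrightarrow> i \<in> {-1..int d} \<Longrightarrow> h (\<phi> x i) = \<phi> (shift a x) i"
proof (rule automorphism_of_chamber_map)
  show "shift a ` \<Omega> = \<Omega>"
  proof (intro equalityI subsetI)
    fix x assume x: "x \<in> \<Omega>"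
    have "shift (inv a) x \<in> \<Omega>" using shift_\<Omega> a x by simp
    then show "x \<in> shift a ` \<Omega>" using shift_inverse[OF a x] by (metis image_eqI)
  qed (use shift_\<Omega> a in auto)
qed (use shift_eq[OF a] that in auto)

lemma shift_to:
  assumes "x \<in> \<Omega>" "y \<in> \<Omega>" "snd x = snd y"
  shows "shift (fst y \<otimes> inv fst x) x = y" "fst y \<otimes> inv fst x \<in> carrier G"
  using fst_\<Omega>[OF assms(1)] fst_\<Omega>[OF assms(2)] assms(3) unfolding shift_def by (auto simp: m_assoc prod_eq_iff)

lemma faces_of_rank_R: "k \<in> {-1..int d} \<Longrightarrow> faces_of_rank R rk k = (\<lambda>x. \<phi> x k) ` \<Omega>"
proof (intro equalityI subsetI)
  fix F assume k: "k \<in> {-1..int d}" and F: "F \<in> faces_of_rank R rk k"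
  have "F \<in> Field R" "rk F = k" using F unfolding faces_of_rank_def by auto
  then show "F \<in> (\<lambda>x. \<phi> x k) ` \<Omega>" using FieldE[of F] by (metis image_eqI)
next
  fix F assume k: "k \<in> {-1..int d}" and "F \<in> (\<lambda>x. \<phi> x k) ` \<Omega>"
  then obtain x where "x \<in> \<Omega>" "F = \<phi> x k" by blast
  then show "F \<in> faces_of_rank R rk k" using FieldI[of x k] rk_\<phi>[of x k] k unfolding faces_of_rank_def by simp
qed

lemma move_face:
  assumes "x \<in> \<Omega>" "y \<in> \<Omega>" "snd x = snd y" "k \<in> {-1..int d}"
  shows "\<exists>h \<in> carrier (aut_group R). h (\<phi> x k) = \<phi> y k"
proof -
  obtain h where "h \<in> carrier (aut_group R)"
    "\<And>z i. z \<in> \<Omega> \<Longrightarrow> i \<in> {-1..int d} \<Longrightarrow> h (\<phi> z i) = \<phi> (shift (fst y \<otimes> inv fst x) z) i"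
    using left_automorphism[OF shift_to(2)[OF assms(1-3)]] by blast
  then show ?thesis using shift_to(1)[OF assms(1-3)] assms by metis
qed

lemma bit_irrelevant:
  assumes "g \<in> carrier G" "k \<in> {-1..int d}" "k \<noteq> int d - 1" shows "\<phi> (g, b) k = \<phi> (g, c) k"
proof -
  have "same k (g, b) (g, c)" using assms unfolding same_def by (auto intro: generate.one)
  then show ?thesis using \<phi>_eq[of "(g, b)" "(g, c)" k] assms \<Omega>_mem by blast
qed

text \<open>Below rank \<open>d - 1\<close> faces do not depend on the bit, so left multiplications move any vertex to any
other.\<close>

lemma vertex_transitive:
  assumes "u \<in> faces_of_rank R rk 0" "v \<in> faces_of_rank R rk 0"
  shows "\<exists>f \<in> carrier (aut_group R). f u = v"
proof -
  obtain x y where x: "x \<in> \<Omega>" "u = \<phi> x 0" and y: "y \<in> \<Omega>" "v = \<phi> y 0"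
    using assms faces_of_rank_R[of 0] by auto
  let ?y = "(fst y, snd x)"
  have "?y \<in> \<Omega>" using fst_\<Omega>[OF y(1)] \<Omega>_mem by simp
  then have "\<exists>h \<in> carrier (aut_group R). h (\<phi> x 0) = \<phi> ?y 0" by (intro move_face[OF x(1)]) auto
  moreover have "\<phi> ?y 0 = \<phi> (fst y, snd y) 0"
    by (rule bit_irrelevant) (use fst_\<Omega>[OF y(1)] d3 in auto)
  ultimately show ?thesis using x y by simp
qed

text \<open>Sections of facets correspond to cosets of parabolic subgroups, again by the intersection property.
Since \<open>j \<le> d - 1\<close>, the facet and hence the bit are fixed.\<close>

lemma section_chambers_eq:
  assumes x: "x \<in> \<Omega>" and ij: "-1 \<le> i" "i \<le> j" "j \<le> int d - 1"
  shows "section_chambers x i j = {y \<in> \<Omega>. snd y = snd x \<and>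
    inv fst x \<otimes> fst y \<in> par (branch (snd x) ` {l. i < int l \<and> int l < j})}" (is "_ = ?S")
proof (intro equalityI subsetI)
  let ?b = "snd x"
  fix y assume y: "y \<in> section_chambers x i j"
  have y\<Omega>: "y \<in> \<Omega>" using y unfolding section_chambers_def by blast
  have s: "same k x y" if "k \<in> {-1..int d}" "k \<le> i \<or> j \<le> k" for k
    using section_chambersD[OF y that] \<phi>_eq[OF x y\<Omega> that(1)] by simp
  have top: "snd y = ?b" using s[of "int d - 1"] ij d3 unfolding same_def by auto
  define K where "K = {k \<in> {-1..int d}. k \<le> i \<or> j \<le> k}"
  have K: "inv fst x \<otimes> fst y \<in> par {m. m < d \<and> (\<forall>k\<in>K. m \<in> fixing_gens k ?b)}"
  proof (rule par_INT)
    show "finite K" unfolding K_def by (rule finite_subset[of _ "{-1..int d}"]) auto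
    show "fixing_gens k ?b \<subseteq> {..<d}" for k by (rule fixing_gens_sub)
    show "inv fst x \<otimes> fst y \<in> carrier G" using fst_\<Omega>[OF x] fst_\<Omega>[OF y\<Omega>] by simp
    show "inv fst x \<otimes> fst y \<in> par (fixing_gens k ?b)" if "k \<in> K" for k
      using s[of k] that unfolding K_def same_def by simp
  qed
  have sub: "{m. m < d \<and> (\<forall>k\<in>K. m \<in> fixing_gens k ?b)} \<subseteq> branch ?b ` {l. i < int l \<and> int l < j}"
  proof
    fix m assume "m \<in> {m. m < d \<and> (\<forall>k\<in>K. m \<in> fixing_gens k ?b)}"
    then have m: "m < d" "\<And>k. k \<in> K \<Longrightarrow> m \<in> fixing_gens k ?b" by auto
    define l where "l = (if m < d - 2 then m else d - 2)"
    have "m \<in> fixing_gens (int d - 1) ?b" using m(2) ij d3 unfolding K_def by auto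
    then have ml: "m = branch ?b l" using m(1) d3 unfolding l_def fixing_gens_def branch_def by (auto split: if_splits)
    have ld: "l < d - 1" using d3 unfolding l_def by auto
    have "int l \<notin> K" using m(2)[of "int l"] branch_notin_fixing_gens[OF ld, of ?b] ml by blast
    then have "i < int l" "int l < j" using ld unfolding K_def by auto
    then show "m \<in> branch ?b ` {l. i < int l \<and> int l < j}" using ml by blast
  qed
  show "y \<in> ?S" using K par_mono[OF sub] top y\<Omega> by blast
next
  let ?b = "snd x"
  fix y assume y: "y \<in> ?S"
  then have y\<Omega>: "y \<in> \<Omega>" and b: "snd y = ?b" and w: "inv fst x \<otimes> fst y \<in> par (branch ?b ` {l. i < int l \<and> int l < j})" by auto
  have "\<phi> y k = \<phi> x k" if k: "k \<in> {-1..int d}" "k \<le> i \<or> j \<le> k" for k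
  proof -
    have "branch ?b ` {l. i < int l \<and> int l < j} \<subseteq> fixing_gens k ?b"
    proof
      fix m assume "m \<in> branch ?b ` {l. i < int l \<and> int l < j}"
      then obtain l where l: "i < int l" "int l < j" "m = branch ?b l" by blast
      have "l < d - 1" "int l \<noteq> k" using l(1,2) ij k(2) by auto
      then show "m \<in> fixing_gens k ?b" using branch_fixing_gens l(3) by blast
    qed
    then have "same k x y" using w b par_mono unfolding same_def by blast
    then show ?thesis using \<phi>_eq[OF x y\<Omega> k(1)] by simp
  qed
  then show "y \<in> section_chambers x i j" using y\<Omega> unfolding section_chambers_def by blast
qed

lemma branch_set_sub:
  assumes "j \<le> int d - 1" shows "branch b ` {l. i < int l \<and> int l < j} \<subseteq> {..<d}"
proof
  fix m assume "m \<in> branch b ` {l. i < int l \<and> int l < j}"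
  then obtain l where l: "int l < j" "m = branch b l" by blast
  then have "l < d - 1" using assms by auto
  then show "m \<in> {..<d}" using branch_less l(2) by simp
qed

lemma card_section_chambers:
  assumes x: "x \<in> \<Omega>" and ij: "-1 \<le> i" "i \<le> j" "j \<le> int d - 1"
  shows "card (section_chambers x i j) = card (par (branch (snd x) ` {l. i < int l \<and> int l < j}))"
    (is "_ = card ?P")
proof -
  have cl: "w \<in> carrier G" if "w \<in> ?P" for w using par_carrier[OF branch_set_sub[OF ij(3)] that] .
  have "bij_betw (\<lambda>w. (fst x \<otimes> w, snd x)) ?P (section_chambers x i j)"
  proof (rule bij_betwI[of _ _ _ "\<lambda>y. inv fst x \<otimes> fst y"])
    show "(\<lambda>w. (fst x \<otimes> w, snd x)) \<in> ?P \<rightarrow> section_chambers x i j"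
      unfolding section_chambers_eq[OF assms] using fst_\<Omega>[OF x] cl \<Omega>_mem by (auto simp: m_assoc[symmetric])
    show "(\<lambda>y. inv fst x \<otimes> fst y) \<in> section_chambers x i j \<rightarrow> ?P"
      unfolding section_chambers_eq[OF assms] by auto
    show "inv fst x \<otimes> fst (fst x \<otimes> w, snd x) = w" if "w \<in> ?P" for w
      using fst_\<Omega>[OF x] cl[OF that] by (simp add: m_assoc[symmetric])
    show "(fst x \<otimes> (inv fst x \<otimes> fst y), snd x) = y" if "y \<in> section_chambers x i j" for y
      using that fst_\<Omega>[OF x] fst_\<Omega>[of y] unfolding section_chambers_eq[OF assms]
      by (auto simp: m_assoc[symmetric] prod_eq_iff)
  qed
  from bij_betw_same_card[OF this] show ?thesis by (rule sym)
qed

text \<open>Two flags of a face of rank at most \<open>d - 1\<close> have the same bit and are exchanged by a left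
multiplication, which preserves the face.\<close>

lemma section_regular:
  assumes x: "x \<in> \<Omega>" and k: "-1 \<le> k" "k \<le> int d - 1"
  shows "regular_polytope k (face_poset R (\<phi> x k)) rk"
proof -
  have kd: "k \<le> int d" using k by simp
  let ?S = "section_chambers x (-1) k"
  interpret S: flag_system ?S \<phi> k rk adj by (rule face_flag_system[OF x k(1) kd])
  have rel: "face_poset R (\<phi> x k) = flag_rel ?S \<phi> k" by (rule face_rel[OF x k(1) kd])
  have S\<Omega>: "u \<in> \<Omega>" if "u \<in> ?S" for u using that unfolding section_chambers_def by blast
  have Sb: "snd u = snd x" if "u \<in> ?S" for u
    using that unfolding section_chambers_eq[OF x order_refl k] by blast
  have "\<exists>f \<in> carrier (aut_group (flag_rel ?S \<phi> k)). f ` \<Phi> = \<Psi>"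
    if \<Phi>: "\<Phi> \<in> flags (flag_rel ?S \<phi> k)" and \<Psi>: "\<Psi> \<in> flags (flag_rel ?S \<phi> k)" for \<Phi> \<Psi>
  proof -
    obtain u where u: "u \<in> ?S" "\<Phi> = \<phi> u ` {-1..k}" using \<Phi> unfolding S.flags_R by blast
    obtain v where v: "v \<in> ?S" "\<Psi> = \<phi> v ` {-1..k}" using \<Psi> unfolding S.flags_R by blast
    define a where "a = fst v \<otimes> inv fst u"
    have au: "shift a u = v" and a: "a \<in> carrier G"
      using shift_to[OF S\<Omega>[OF u(1)] S\<Omega>[OF v(1)]] Sb u v unfolding a_def by auto
    have au': "shift (inv a) v = u"
      using shift_inverse[OF inv_closed[OF a] S\<Omega>[OF u(1)]] au a by simp
    have clos: "shift c y \<in> ?S" if c: "c \<in> carrier G" "shift c p = q" and pq: "p \<in> ?S" "q \<in> ?S" and y: "y \<in> ?S" for c p q y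
    proof -
      have "\<phi> (shift c y) l = \<phi> x l" if l: "l \<in> {-1..int d}" "l \<le> -1 \<or> k \<le> l" for l
      proof -
        have "\<phi> y l = \<phi> p l" using section_chambersD[OF y l] section_chambersD[OF pq(1) l] by simp
        then have "\<phi> (shift c y) l = \<phi> (shift c p) l" using shift_eq[OF c(1) S\<Omega>[OF y] S\<Omega>[OF pq(1)] l(1)] by simp
        then show ?thesis using c(2) section_chambersD[OF pq(2) l] by simp
      qed
      then show ?thesis using shift_\<Omega>[OF c(1) S\<Omega>[OF y]] unfolding section_chambers_def by blast
    qed
    have onto: "shift a ` ?S = ?S"
    proof (intro equalityI subsetI)
      fix y assume "y \<in> shift a ` ?S" then show "y \<in> ?S" using clos[OF a au u(1) v(1)] by blast
    next
      fix y assume y: "y \<in> ?S"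
      have "shift (inv a) y \<in> ?S" using clos[OF inv_closed[OF a] au' v(1) u(1) y] .
      then show "y \<in> shift a ` ?S" using shift_inverse[OF a S\<Omega>[OF y]] by (metis image_eqI)
    qed
    have eq: "\<phi> (shift a y) i = \<phi> (shift a z) i \<longleftrightarrow> \<phi> y i = \<phi> z i"
      if "y \<in> ?S" "z \<in> ?S" "i \<in> {-1..k}" for y z i
      using shift_eq[OF a S\<Omega>[OF that(1)] S\<Omega>[OF that(2)], of i] that(3) kd by simp
    obtain h where h: "h \<in> carrier (aut_group S.R)"
      "\<And>y i. y \<in> ?S \<Longrightarrow> i \<in> {-1..k} \<Longrightarrow> h (\<phi> y i) = \<phi> (shift a y) i"
      using S.automorphism_of_chamber_map[OF onto eq] by blast
    have "h ` \<Phi> = \<Psi>" unfolding u(2) v(2) image_image using h(2)[OF u(1)] au by (intro image_cong) auto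
    then show ?thesis using h(1) by blast
  qed
  then show ?thesis unfolding regular_polytope_def rel using S.abstract_polytope_R by blast
qed

text \<open>The poset \<open>T\<close> is the coset geometry of the subgroup generated by \<open>\<rho> (s 0), \<dots>, \<rho> (s (c - 1))\<close>: its faces
of rank \<open>k\<close> correspond to the cosets of the subgroup without \<open>\<rho> (s k)\<close>. For \<open>k = -1\<close> and \<open>k = c\<close> no
generator is left out.\<close>

definition section_model :: "nat \<Rightarrow> (nat \<Rightarrow> nat) \<Rightarrow> 'c rel \<Rightarrow> bool" where
  "section_model c s T \<longleftrightarrow> (\<exists>\<psi> rk'. T = flag_rel (par (s ` {..<c})) \<psi> (int c) \<and>
     (\<forall>g \<in> par (s ` {..<c}). \<forall>k \<in> {-1..int c}. rk' (\<psi> g k) = k) \<and>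
     (\<forall>g \<in> par (s ` {..<c}). \<forall>h \<in> par (s ` {..<c}). \<forall>k \<in> {-1..int c}.
        \<psi> g k = \<psi> h k \<longleftrightarrow> inv g \<otimes> h \<in> par (s ` {l. l < c \<and> int l \<noteq> k})))"

lemma section_iso:
  assumes x: "x \<in> \<Omega>" and ij: "-1 \<le> i" "j = i + 1 + int c" "j \<le> int d - 1"
    and T: "section_model c (\<lambda>l. branch (snd x) (nat (i + 1) + l)) T"
  shows "isomorphic_posets (flag_rel (section_chambers x i j) (\<lambda>y k. \<phi> y (k + i + 1)) (j - i - 1)) T"
proof -
  let ?b = "snd x" and ?S = "section_chambers x i j"
  let ?s = "\<lambda>l. branch ?b (nat (i + 1) + l)"
  let ?P = "par (?s ` {..<c})"
  have ij': "i \<le> j" "j \<le> int d" using ij by auto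
  have set: "branch ?b ` {l. i < int l \<and> int l < j} = ?s ` {..<c}"
  proof -
    have "{l. i < int l \<and> int l < j} = (\<lambda>l. nat (i + 1) + l) ` {..<c}"
    proof (intro equalityI subsetI)
      fix l assume "l \<in> {l. i < int l \<and> int l < j}"
      then have "l = nat (i + 1) + (l - nat (i + 1))" "l - nat (i + 1) < c" using ij by auto
      then show "l \<in> (\<lambda>l. nat (i + 1) + l) ` {..<c}" by blast
    qed (use ij in auto)
    then show ?thesis by (simp add: image_image)
  qed
  have subd: "?s ` {..<c} \<subseteq> {..<d}" using branch_set_sub[OF ij(3), of ?b i] set by simp
  note S = section_chambers_eq[OF x ij(1) ij'(1) ij(3), unfolded set]
  obtain \<psi> rk' where \<psi>: "T = flag_rel ?P \<psi> (int c)"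
      "\<And>g k. g \<in> ?P \<Longrightarrow> k \<in> {-1..int c} \<Longrightarrow> rk' (\<psi> g k) = k"
      "\<And>g h k. g \<in> ?P \<Longrightarrow> h \<in> ?P \<Longrightarrow> k \<in> {-1..int c} \<Longrightarrow>
        \<psi> g k = \<psi> h k \<longleftrightarrow> inv g \<otimes> h \<in> par (?s ` {l. l < c \<and> int l \<noteq> k})"
    using T unfolding section_model_def by blast
  define f where "f y = inv fst x \<otimes> fst y" for y :: "'a \<times> bool"
  interpret S: flag_system ?S "\<lambda>y k. \<phi> y (k + i + 1)" "j - i - 1" "\<lambda>F. rk F - i - 1" "\<lambda>k. adj (k + i + 1)"
    by (rule section_flag_system[OF x ij(1) ij'])
  have onto: "f ` ?S = ?P"
  proof (intro equalityI subsetI)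
    fix w assume "w \<in> f ` ?S" then show "w \<in> ?P" unfolding f_def S by auto
  next
    fix w assume w: "w \<in> ?P"
    have cl: "w \<in> carrier G" using par_carrier[OF subd w] .
    have e: "inv fst x \<otimes> (fst x \<otimes> w) = w" using cl fst_\<Omega>[OF x] by (simp add: m_assoc[symmetric])
    have "(fst x \<otimes> w, ?b) \<in> ?S" unfolding S using w cl fst_\<Omega>[OF x] \<Omega>_mem e by simp
    then show "w \<in> f ` ?S" unfolding f_def using e by (metis fst_conv image_eqI)
  qed
  have eq: "\<psi> (f y) k = \<psi> (f z) k \<longleftrightarrow> \<phi> y (k + i + 1) = \<phi> z (k + i + 1)"
    if y: "y \<in> ?S" and z: "z \<in> ?S" and k: "k \<in> {-1..j - i - 1}" for y z k
  proof -
    have y\<Omega>: "y \<in> \<Omega>" "snd y = ?b" and z\<Omega>: "z \<in> \<Omega>" "snd z = ?b" using y z unfolding S by auto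
    have fy: "f y \<in> ?P" and fz: "f z \<in> ?P" using onto y z by blast+
    have k': "k + i + 1 \<in> {-1..int d}" "k \<in> {-1..int c}" using k ij by auto
    have e: "inv f y \<otimes> f z = inv fst y \<otimes> fst z"
      unfolding f_def by (rule inv_mult_mult) (use fst_\<Omega> x y\<Omega> z\<Omega> in auto)
    have inP: "inv f y \<otimes> f z \<in> ?P"
      using fy fz par_subgroup[OF subd] by (meson subgroup.m_closed subgroup.m_inv_closed)
    have "?s ` {..<c} \<inter> fixing_gens (k + i + 1) ?b = ?s ` {l. l < c \<and> int l \<noteq> k}"
    proof (intro equalityI subsetI)
      fix m assume m: "m \<in> ?s ` {..<c} \<inter> fixing_gens (k + i + 1) ?b"
      then obtain l where l: "l < c" "m = ?s l" by blast
      have lt: "nat (i + 1) + l < d - 1" using l(1) ij by auto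
      have "int l \<noteq> k"
      proof
        assume "int l = k"
        then have "int (nat (i + 1) + l) = k + i + 1" using ij by simp
        then show False using branch_notin_fixing_gens[OF lt, of ?b] m l(2) by simp
      qed
      then show "m \<in> ?s ` {l. l < c \<and> int l \<noteq> k}" using l by blast
    next
      fix m assume "m \<in> ?s ` {l. l < c \<and> int l \<noteq> k}"
      then obtain l where l: "l < c" "int l \<noteq> k" "m = ?s l" by blast
      have lt: "nat (i + 1) + l < d - 1" using l(1) ij by auto
      have "int (nat (i + 1) + l) \<noteq> k + i + 1" using l(2) ij by simp
      then show "m \<in> ?s ` {..<c} \<inter> fixing_gens (k + i + 1) ?b" using branch_fixing_gens[OF lt, of "k+i+1" ?b] l by auto
    qed
    then have "par (?s ` {l. l < c \<and> int l \<noteq> k}) = ?P \<inter> par (fixing_gens (k + i + 1) ?b)"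
      using par_Int[OF subd fixing_gens_sub] by metis
    then have "\<psi> (f y) k = \<psi> (f z) k \<longleftrightarrow> inv f y \<otimes> f z \<in> par (fixing_gens (k + i + 1) ?b)"
      using \<psi>(3)[OF fy fz k'(2)] inP by blast
    also have "\<dots> \<longleftrightarrow> same (k + i + 1) y z" unfolding same_def e using y\<Omega> z\<Omega> by auto
    finally show ?thesis using \<phi>_eq[OF y\<Omega>(1) z\<Omega>(1) k'(1)] by simp
  qed
  have cji: "j - i - 1 = int c" using ij by simp
  obtain h where "h \<in> poset_isos (flag_rel ?S (\<lambda>y k. \<phi> y (k + i + 1)) (j - i - 1)) (flag_rel ?P \<psi> (j - i - 1))"
    by (rule flag_rel_isomorphism[where rk="\<lambda>F. rk F - i - 1" and rk'=rk' and \<phi>="\<lambda>y k. \<phi> y (k + i + 1)"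
      and \<psi>=\<psi>, OF S.rk _ onto eq]) (use \<psi>(2) cji in auto)
  then show ?thesis unfolding isomorphic_posets_def \<psi>(1) cji by blast
qed

lemma face_symbol:
  assumes x: "x \<in> \<Omega>" and c: "c < d"
    and P: "\<And>j. j \<in> {3..c} \<Longrightarrow> section_model 3 (\<lambda>l. branch (snd x) (j - 3 + l)) (P j)"
  shows "has_symbol c (face_poset R (\<phi> x (int c))) rk P"
proof -
  have kc: "-1 \<le> int c" "int c \<le> int d - 1" "int c \<le> int d" using c by auto
  let ?S = "section_chambers x (-1) (int c)"
  interpret S: flag_system ?S \<phi> "int c" rk adj by (rule face_flag_system[OF x kc(1,3)])
  have rel: "face_poset R (\<phi> x (int c)) = flag_rel ?S \<phi> (int c)" by (rule face_rel[OF x kc(1,3)])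
  have xS: "x \<in> ?S" using x unfolding section_chambers_def by blast
  have "isomorphic_posets (poly_section S.R F K) (P j)"
    if j: "j \<in> {3..c}" and F: "F \<in> \<phi> x ` {-1..int c}" "rk F = int j - 4"
      and K: "K \<in> \<phi> x ` {-1..int c}" "rk K = int j" for j F K
  proof -
    have F': "F = \<phi> x (int j - 4)" using F S.rk[OF xS] by auto
    have K': "K = \<phi> x (int j)" using K S.rk[OF xS] by auto
    have sec: "S.section_chambers x (int j - 4) (int j) = section_chambers x (int j - 4) (int j)"
    proof (intro equalityI subsetI)
      fix y assume y: "y \<in> S.section_chambers x (int j - 4) (int j)"
      then have yS: "y \<in> ?S" unfolding S.section_chambers_def by blast
      have "\<phi> y k = \<phi> x k" if k: "k \<in> {-1..int d}" "k \<le> int j - 4 \<or> int j \<le> k" for k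
      proof (cases "k \<le> int c")
        case True then show ?thesis using S.section_chambersD[OF y, of k] k by simp
      next
        case False then show ?thesis using section_chambersD[OF yS k(1)] by simp
      qed
      then show "y \<in> section_chambers x (int j - 4) (int j)" using yS unfolding section_chambers_def by blast
    next
      fix y assume y: "y \<in> section_chambers x (int j - 4) (int j)"
      have "\<phi> y k = \<phi> x k" if k: "k \<in> {-1..int d}" "k \<le> -1 \<or> int c \<le> k" for k
        using section_chambersD[OF y k(1)] k(2) j by auto
      then have "y \<in> ?S" using y unfolding section_chambers_def by blast
      moreover have "\<phi> y k = \<phi> x k" if k: "k \<in> {-1..int c}" "k \<le> int j - 4 \<or> int j \<le> k" for k
        using section_chambersD[OF y _ k(2)] k(1) kc by simp
      ultimately show "y \<in> S.section_chambers x (int j - 4) (int j)" unfolding S.section_chambers_def by blast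
    qed
    have "poly_section S.R F K = flag_rel (section_chambers x (int j - 4) (int j)) (\<lambda>y k. \<phi> y (k + (int j - 4) + 1)) (int j - (int j - 4) - 1)"
      unfolding F' K' sec[symmetric] by (rule S.section_rel[OF xS]) (use j in auto)
    moreover have "isomorphic_posets (flag_rel (section_chambers x (int j - 4) (int j)) (\<lambda>y k. \<phi> y (k + (int j - 4) + 1)) (int j - (int j - 4) - 1)) (P j)"
    proof (rule section_iso[OF x, where c=3])
      have "nat (int j - 4 + 1) = j - 3" using j by auto
      then show "section_model 3 (\<lambda>l. branch (snd x) (nat (int j - 4 + 1) + l)) (P j)" using P[OF j] by simp
    qed (use j c in auto)
    ultimately show ?thesis by simp
  qed
  then have "\<exists>\<Phi> \<in> flags S.R. \<forall>j \<in> {3..c}. \<forall>F \<in> \<Phi>. \<forall>K \<in> \<Phi>. rk F = int j - 4 \<and> rk K = int j \<longrightarrow>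
        isomorphic_posets (poly_section S.R F K) (P j)"
    unfolding S.flags_R using xS by blast
  then show ?thesis unfolding has_symbol_def using section_regular[OF x kc(1,2)] rel by simp
qed

lemma face_iso:
  assumes x: "x \<in> \<Omega>" and c: "c < d" and T: "section_model c (branch (snd x)) T"
  shows "isomorphic_posets (face_poset R (\<phi> x (int c))) T"
proof -
  have "isomorphic_posets (flag_rel (section_chambers x (-1) (int c)) (\<lambda>y k. \<phi> y (k + -1 + 1)) (int c - -1 - 1)) T"
    by (rule section_iso[OF x, where c=c]) (use c T in auto)
  then show ?thesis using face_rel[OF x, of "int c"] c by simp
qed

end

section \<open>Facets and automorphisms\<close>

context tail_triangle_polytope
begin

definition facets :: "bool \<Rightarrow> 'b set" where
  "facets b = (\<lambda>g. \<phi> (g, b) (int d - 1)) ` carrier G"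

lemma facet_rank: "int d - 1 \<in> {-1..int d}" using d3 by simp

lemma facet_bit:
  assumes "x \<in> \<Omega>" shows "\<phi> x (int d - 1) \<in> facets b \<longleftrightarrow> snd x = b"
proof
  assume "\<phi> x (int d - 1) \<in> facets b"
  then obtain g where g: "g \<in> carrier G" "\<phi> x (int d - 1) = \<phi> (g, b) (int d - 1)" unfolding facets_def by blast
  then show "snd x = b" using \<phi>_eq[OF assms _ facet_rank, of "(g, b)"] \<Omega>_mem unfolding same_def by simp
next
  assume "snd x = b"
  then have "x = (fst x, b)" by (simp add: prod_eq_iff)
  then show "\<phi> x (int d - 1) \<in> facets b" unfolding facets_def using fst_\<Omega>[OF assms] by (metis image_eqI)
qed

lemma facetsE:
  assumes "F \<in> facets b"
  obtains x where "x \<in> \<Omega>" "snd x = b" "F = \<phi> x (int d - 1)"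
  using assms \<Omega>_mem unfolding facets_def by fastforce

lemma facets_Un: "facets b \<union> facets (\<not> b) = faces_of_rank R rk (int d - 1)"
proof (intro equalityI subsetI)
  fix F assume "F \<in> facets b \<union> facets (\<not> b)"
  then obtain x where "x \<in> \<Omega>" "F = \<phi> x (int d - 1)" by (blast elim: facetsE)
  then show "F \<in> faces_of_rank R rk (int d - 1)" unfolding faces_of_rank_R[OF facet_rank] by blast
next
  fix F assume "F \<in> faces_of_rank R rk (int d - 1)"
  then obtain x where "x \<in> \<Omega>" "F = \<phi> x (int d - 1)" unfolding faces_of_rank_R[OF facet_rank] by blast
  then show "F \<in> facets b \<union> facets (\<not> b)" using facet_bit[of x b] facet_bit[of x "\<not> b"] by auto
qed

lemma facets_Int: "facets b \<inter> facets (\<not> b) = {}"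
  using facet_bit by (blast elim: facetsE)

lemma facets_nonempty: "facets b \<noteq> {}"
  unfolding facets_def by auto

lemma finite_\<Omega>: "finite \<Omega>"
  unfolding \<Omega>_def using finite_carrier by simp

lemma finite_Field: "finite (Field R)"
proof (rule finite_subset)
  show "Field R \<subseteq> (\<lambda>(x, i). \<phi> x i) ` (\<Omega> \<times> {-1..int d})" unfolding Field_flag_rel by auto
  show "finite ((\<lambda>(x, i). \<phi> x i) ` (\<Omega> \<times> {-1..int d}))" using finite_\<Omega> by simp
qed

lemma face_poset_aut:
  assumes "h \<in> carrier (aut_group R)" "F \<in> Field R"
  shows "isomorphic_posets (face_poset R F) (face_poset R (h F))"
  by (rule face_poset_iso[OF _ Refl_R Refl_R assms(2)]) (use assms(1) aut_group_simps in auto)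

lemma facets_isomorphic:
  assumes "F \<in> facets b" "F' \<in> facets b"
  shows "isomorphic_posets (face_poset R F) (face_poset R F')"
proof -
  obtain x where x: "x \<in> \<Omega>" "snd x = b" "F = \<phi> x (int d - 1)" using assms(1) by (rule facetsE)
  obtain y where y: "y \<in> \<Omega>" "snd y = b" "F' = \<phi> y (int d - 1)" using assms(2) by (rule facetsE)
  obtain h where h: "h \<in> carrier (aut_group R)" "h F = F'"
    using move_face[OF x(1) y(1) _ facet_rank] x y by auto
  have "F \<in> Field R" using FieldI[OF x(1) facet_rank] x(3) by simp
  from face_poset_aut[OF h(1) this] show ?thesis unfolding h(2) .
qed

lemma semiregular: "semiregular_polytope (int d) R rk"
  unfolding semiregular_polytope_def
proof (intro conjI ballI)
  show "abstract_polytope (int d) R rk" by (rule abstract_polytope_R)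
  fix F assume "F \<in> faces_of_rank R rk (int d - 1)"
  then obtain x where x: "x \<in> \<Omega>" "F = \<phi> x (int d - 1)" unfolding faces_of_rank_R[OF facet_rank] by blast
  show "regular_polytope (int d - 1) (face_poset R F) rk"
    unfolding x(2) by (rule section_regular[OF x(1)]) auto
next
  show "\<exists>f\<in>carrier (aut_group R). f u = v"
    if "u \<in> faces_of_rank R rk 0" "v \<in> faces_of_rank R rk 0" for u v
    by (rule vertex_transitive[OF that])
qed

text \<open>If two chambers have the same face of rank \<open>d - 2\<close> and the same bit, then they differ by an element of
\<open>\<langle>\<rho> 0, \<dots>, \<rho> (d - 3)\<rangle>\<close>, which fixes both kinds of facets; so distinct facets on it have distinct bits.\<close>

lemma alternating: "alternate_around (int d) R rk (facets False) (facets True) F"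
  unfolding alternate_around_def
proof (intro ballI impI)
  fix H K K'
  assume H: "H \<in> faces_of_rank R rk (int d - 2)" and K: "K \<in> faces_of_rank R rk (int d - 1)"
    and K': "K' \<in> faces_of_rank R rk (int d - 1)"
    and inc: "(F, H) \<in> R \<and> (H, K) \<in> R \<and> (H, K') \<in> R \<and> K \<noteq> K'"
  have r: "rk H = int d - 2" "rk K = int d - 1" "rk K' = int d - 1"
    using H K K' unfolding faces_of_rank_def by auto
  obtain x where x: "x \<in> \<Omega>" "H = \<phi> x (int d - 2)" "K = \<phi> x (int d - 1)"
    using relE[of H K] inc r by metis
  obtain y where y: "y \<in> \<Omega>" "H = \<phi> y (int d - 2)" "K' = \<phi> y (int d - 1)"
    using relE[of H K'] inc r by metis
  have "snd x \<noteq> snd y"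
  proof
    assume b: "snd x = snd y"
    have "same (int d - 2) x y" using \<phi>_eq[OF x(1) y(1), of "int d - 2"] x(2) y(2) d3 by simp
    moreover have "fixing_gens (int d - 2) (snd x) \<subseteq> fixing_gens (int d - 1) (snd x)"
      unfolding fixing_gens_def using d3 by auto
    ultimately have "same (int d - 1) x y" using b par_mono unfolding same_def by blast
    then have "K = K'" using \<phi>_eq[OF x(1) y(1) facet_rank] x(3) y(3) by simp
    then show False using inc by blast
  qed
  then show "K \<in> facets False \<and> K' \<in> facets True \<or> K \<in> facets True \<and> K' \<in> facets False"
    using facet_bit x y by (cases "snd x"; cases "snd y") auto
qed

lemma alternating_semiregularI:
  assumes "(\<forall>F \<in> facets False. \<forall>F' \<in> facets True. \<not> isomorphic_posets (face_poset R F) (face_poset R F')) \<or>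
      (\<forall>F \<in> facets False. \<forall>F' \<in> facets True. isomorphic_posets (face_poset R F) (face_poset R F')) \<and>
      (\<exists>N. subgroup N (aut_group R) \<and> card (rcosets\<^bsub>aut_group R\<^esub> N) = 2 \<and>
           orbits (aut_group R \<lparr>carrier := N\<rparr>) (faces_of_rank R rk (int d - 1)) (\<lambda>f. f) = {facets False, facets True})"
  shows "alternating_semiregular (int d) R rk (facets False) (facets True)"
  unfolding alternating_semiregular_def
  using assms semiregular facets_nonempty facets_Un[of False] facets_Int[of False] alternating facets_isomorphic
  by auto

lemma one_\<Omega>: "(\<one>, b) \<in> \<Omega>" using \<Omega>_mem by simp

lemma reach_same_bit:
  assumes "g \<in> carrier G"
  shows "\<exists>h \<in> carrier (aut_group R). \<forall>i\<in>{-1..int d}. h (\<phi> (\<one>, b) i) = \<phi> (g, b) i"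
proof -
  obtain h where h: "h \<in> carrier (aut_group R)"
    "\<And>x i. x \<in> \<Omega> \<Longrightarrow> i \<in> {-1..int d} \<Longrightarrow> h (\<phi> x i) = \<phi> (shift g x) i"
    using left_automorphism[OF assms] by blast
  have "shift g (\<one>, b) = (g, b)" using assms unfolding shift_def by simp
  then show ?thesis using h one_\<Omega> by (intro bexI[OF _ h(1)]) auto
qed

lemma card_bit_fixing:
  "card {h \<in> carrier (aut_group R). \<exists>z\<in>carrier G \<times> {b}. \<forall>i\<in>{-1..int d}. h (\<phi> (\<one>, b) i) = \<phi> z i}
    = card (carrier G)"
proof -
  have "card {h \<in> carrier (aut_group R). \<exists>z\<in>carrier G \<times> {b}. \<forall>i\<in>{-1..int d}. h (\<phi> (\<one>, b) i) = \<phi> z i}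
      = card (carrier G \<times> {b})"
    by (rule card_automorphisms[OF one_\<Omega>]) (use reach_same_bit \<Omega>_mem in auto)
  also have "\<dots> = card (carrier G)" by (simp add: card_cartesian_product)
  finally show ?thesis .
qed

lemma card_facet_flags:
  assumes "x \<in> \<Omega>" shows "card (section_chambers x (-1) (int d - 1)) = card (par (branch (snd x) ` {..<d - 1}))"
proof -
  have "{l. -1 < int l \<and> int l < int d - 1} = {..<d - 1}" using d3 by auto
  then show ?thesis using card_section_chambers[OF assms, of "-1" "int d - 1"] d3 by simp
qed

text \<open>A facet has as many flags as its group has elements.\<close>

lemma facets_not_isomorphic:
  assumes ne: "card (par (branch False ` {..<d - 1})) \<noteq> card (par (branch True ` {..<d - 1}))"
    and F: "F \<in> facets False" "F' \<in> facets True"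
  shows "\<not> isomorphic_posets (face_poset R F) (face_poset R F')"
proof
  assume iso: "isomorphic_posets (face_poset R F) (face_poset R F')"
  obtain x where x: "x \<in> \<Omega>" "snd x = False" "F = \<phi> x (int d - 1)" using F(1) by (rule facetsE)
  obtain y where y: "y \<in> \<Omega>" "snd y = True" "F' = \<phi> y (int d - 1)" using F(2) by (rule facetsE)
  have b: "-1 \<le> int d - 1" "int d - 1 \<le> int d" by auto
  let ?X = "section_chambers x (-1) (int d - 1)" and ?Y = "section_chambers y (-1) (int d - 1)"
  have X: "flag_system ?X \<phi> (int d - 1) rk adj" by (rule face_flag_system[OF x(1) b])
  have Y: "flag_system ?Y \<phi> (int d - 1) rk adj" by (rule face_flag_system[OF y(1) b])
  have fin: "finite ?X" "finite ?Y"
    using finite_\<Omega> unfolding section_chambers_def by auto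
  obtain h where h: "h \<in> poset_isos (flag_rel ?X \<phi> (int d - 1)) (flag_rel ?Y \<phi> (int d - 1))"
    using iso unfolding isomorphic_posets_def x(3) y(3) face_rel[OF x(1) b] face_rel[OF y(1) b] by blast
  have "card ?X \<le> card ?Y" by (rule iso_card_le[OF X Y h fin(2)])
  moreover have "card ?Y \<le> card ?X" by (rule iso_card_le[OF Y X poset_isos_inv[OF h] fin(1)])
  ultimately show False using ne card_facet_flags[OF x(1)] card_facet_flags[OF y(1)] x y by simp
qed

text \<open>No automorphism changes the bit of a flag, so left multiplications are all automorphisms.\<close>

theorem distinct_kinds:
  assumes ne: "card (par (branch False ` {..<d - 1})) \<noteq> card (par (branch True ` {..<d - 1}))"
  shows "alternating_semiregular (int d) R rk (facets False) (facets True)"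
    and "order (aut_group R) = card (carrier G)"
proof -
  show "alternating_semiregular (int d) R rk (facets False) (facets True)"
    by (rule alternating_semiregularI) (use facets_not_isomorphic[OF ne] in blast)
  have "\<exists>z\<in>carrier G \<times> {False}. \<forall>i\<in>{-1..int d}. h (\<phi> (\<one>, False) i) = \<phi> z i"
    if h: "h \<in> carrier (aut_group R)" for h
  proof -
    obtain z where z: "z \<in> \<Omega>" "\<And>i. i \<in> {-1..int d} \<Longrightarrow> h (\<phi> (\<one>, False) i) = \<phi> z i"
      using automorphism_chamber[OF h one_\<Omega>] by blast
    have "\<phi> (\<one>, False) (int d - 1) \<in> facets False" using facet_bit[OF one_\<Omega>, of False] by simp
    moreover have "isomorphic_posets (face_poset R (\<phi> (\<one>, False) (int d - 1))) (face_poset R (\<phi> z (int d - 1)))"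
      using face_poset_aut[OF h FieldI[OF one_\<Omega>[of False] facet_rank]] z(2)[OF facet_rank] by simp
    ultimately have "\<phi> z (int d - 1) \<notin> facets True" using facets_not_isomorphic[OF ne] by blast
    then have "snd z = False" using facet_bit[OF z(1), of True] by simp
    then have "z \<in> carrier G \<times> {False}" using z(1) unfolding \<Omega>_def by auto
    then show ?thesis using z(2) by blast
  qed
  then have "carrier (aut_group R) =
      {h \<in> carrier (aut_group R). \<exists>z\<in>carrier G \<times> {False}. \<forall>i\<in>{-1..int d}. h (\<phi> (\<one>, False) i) = \<phi> z i}"
    by blast
  then show "order (aut_group R) = card (carrier G)" unfolding order_def using card_bit_fixing[of False] by simp
qed

text \<open>A group automorphism exchanging the two ends of the diagram permutes the parabolic subgroups in the
same way as flipping the bit does.\<close>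

lemma swap_automorphism:
  assumes \<tau>: "\<tau> \<in> iso G G" and \<tau>\<rho>: "\<And>i. i < d - 2 \<Longrightarrow> \<tau> (\<rho> i) = \<rho> i"
    "\<tau> (\<rho> (d - 2)) = \<rho> (d - 1)" "\<tau> (\<rho> (d - 1)) = \<rho> (d - 2)"
  obtains h where "h \<in> carrier (aut_group R)"
    "\<And>x i. x \<in> \<Omega> \<Longrightarrow> i \<in> {-1..int d} \<Longrightarrow> h (\<phi> x i) = \<phi> (\<tau> (fst x), \<not> snd x) i"
proof -
  interpret \<tau>: group_hom G G \<tau> using \<tau> unfolding iso_def group_hom_def group_hom_axioms_def by auto
  have bij: "bij_betw \<tau> (carrier G) (carrier G)" using \<tau> unfolding iso_def by blast
  have \<tau>cl: "\<tau> g \<in> carrier G" if "g \<in> carrier G" for g using that \<tau>.hom_closed by blast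
  have inj: "\<tau> g \<in> \<tau> ` P \<longleftrightarrow> g \<in> P" if "g \<in> carrier G" "P \<subseteq> carrier G" for g P
    using inj_on_image_mem_iff[OF bij_betw_imp_inj_on[OF bij] that] .
  define s where "s i = (if i = d - 2 then d - 1 else if i = d - 1 then d - 2 else i)" for i :: nat
  have \<tau>s: "\<tau> (\<rho> i) = \<rho> (s i)" if i: "i < d" for i
  proof -
    consider "i < d - 2" | "i = d - 2" | "i = d - 1" using i by linarith
    then show ?thesis using \<tau>\<rho> d3 unfolding s_def by cases auto
  qed
  have s_fix: "s ` fixing_gens k b = fixing_gens k (\<not> b)" for k b
  proof -
    have ss: "s (s i) = i" for i using d3 unfolding s_def by auto
    have sub: "s ` fixing_gens k b \<subseteq> fixing_gens k (\<not> b)" for b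
    proof
      fix m assume "m \<in> s ` fixing_gens k b"
      then obtain i where i: "i \<in> fixing_gens k b" "m = s i" by blast
      consider "k = int d - 2" | "k = int d - 1" | "k \<noteq> int d - 2" "k \<noteq> int d - 1" by blast
      then show "m \<in> fixing_gens k (\<not> b)"
      proof cases
        case 1
        then show ?thesis using i unfolding fixing_gens_def s_def by auto
      next
        case 2
        then show ?thesis using i d3 unfolding fixing_gens_def s_def by (auto split: if_splits)
      next
        case 3
        then show ?thesis using i d3 unfolding fixing_gens_def s_def by (auto split: if_splits)
      qed
    qed
    have "fixing_gens k (\<not> b) \<subseteq> s ` fixing_gens k b"
    proof
      fix i assume "i \<in> fixing_gens k (\<not> b)"
      then have "s i \<in> fixing_gens k b" using sub[of "\<not> b"] by auto
      then show "i \<in> s ` fixing_gens k b" using ss by (metis image_eqI)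
    qed
    then show ?thesis using sub by blast
  qed
  have \<tau>par: "\<tau> ` par (fixing_gens k b) = par (fixing_gens k (\<not> b))" for k b
  proof -
    have "\<tau> ` (\<rho> ` fixing_gens k b) = \<rho> ` s ` fixing_gens k b"
      unfolding image_image using \<tau>s fixing_gens_sub by (intro image_cong) auto
    then show ?thesis using \<tau>.generate_img[OF gens_closed[OF fixing_gens_sub]] s_fix by metis
  qed
  let ?f = "\<lambda>x. (\<tau> (fst x), \<not> snd x)"
  have f\<Omega>: "?f x \<in> \<Omega>" if "x \<in> \<Omega>" for x using \<tau>cl fst_\<Omega>[OF that] \<Omega>_mem by simp
  have same_f: "same k (?f x) (?f y) \<longleftrightarrow> same k x y" if "x \<in> \<Omega>" "y \<in> \<Omega>" for x y k
  proof -
    have cl: "fst x \<in> carrier G" "fst y \<in> carrier G" using fst_\<Omega> that by auto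
    have "inv \<tau> (fst x) \<otimes> \<tau> (fst y) = \<tau> (inv fst x \<otimes> fst y)" using cl by simp
    moreover have "\<tau> (inv fst x \<otimes> fst y) \<in> par (fixing_gens k (\<not> snd x)) \<longleftrightarrow> inv fst x \<otimes> fst y \<in> par (fixing_gens k (snd x))"
      unfolding \<tau>par[symmetric] by (rule inj) (use cl par_carrier[OF fixing_gens_sub] in auto)
    ultimately show ?thesis unfolding same_def by simp
  qed
  have onto: "?f ` \<Omega> = \<Omega>"
  proof (intro equalityI subsetI)
    fix x assume x: "x \<in> \<Omega>"
    obtain g where g: "g \<in> carrier G" "fst x = \<tau> g" using bij fst_\<Omega>[OF x] unfolding bij_betw_def by blast
    have "x = ?f (g, \<not> snd x)" using g by (simp add: prod_eq_iff)
    moreover have "(g, \<not> snd x) \<in> \<Omega>" using g \<Omega>_mem by simp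
    ultimately show "x \<in> ?f ` \<Omega>" by (rule image_eqI)
  qed (use f\<Omega> in auto)
  have eq: "\<phi> (?f x) i = \<phi> (?f y) i \<longleftrightarrow> \<phi> x i = \<phi> y i" if "x \<in> \<Omega>" "y \<in> \<Omega>" "i \<in> {-1..int d}" for x y i
    using \<phi>_eq[OF f\<Omega>[OF that(1)] f\<Omega>[OF that(2)] that(3)] \<phi>_eq[OF that] same_f[OF that(1,2)] by simp
  show thesis using automorphism_of_chamber_map[OF onto eq] that by blast
qed

text \<open>The automorphism group is now transitive on all flags. The subgroup of index 2 consists of the
automorphisms that preserve the kinds of facets, which are exactly the left multiplications.\<close>

theorem equal_kinds:
  assumes \<tau>: "\<tau> \<in> iso G G" and \<tau>\<rho>: "\<And>i. i < d - 2 \<Longrightarrow> \<tau> (\<rho> i) = \<rho> i"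
    "\<tau> (\<rho> (d - 2)) = \<rho> (d - 1)" "\<tau> (\<rho> (d - 1)) = \<rho> (d - 2)"
  shows "alternating_semiregular (int d) R rk (facets False) (facets True)"
    and "order (aut_group R) = 2 * card (carrier G)"
proof -
  let ?A = "aut_group R"
  interpret A: group ?A by (rule group_aut_group)
  have \<tau>1: "\<tau> \<one> = \<one>" using hom_one[of \<tau> G G] \<tau> unfolding iso_def by auto
  obtain t where t: "t \<in> carrier ?A"
    "\<And>x i. x \<in> \<Omega> \<Longrightarrow> i \<in> {-1..int d} \<Longrightarrow> t (\<phi> x i) = \<phi> (\<tau> (fst x), \<not> snd x) i"
    using swap_automorphism[OF \<tau> \<tau>\<rho>] by blast
  have t1: "t (\<phi> (\<one>, b) i) = \<phi> (\<one>, \<not> b) i" if "i \<in> {-1..int d}" for i b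
    using t(2)[OF one_\<Omega> that] \<tau>1 by simp
  have reach: "\<exists>h \<in> carrier ?A. \<forall>i\<in>{-1..int d}. h (\<phi> (\<one>, False) i) = \<phi> z i" if z: "z \<in> \<Omega>" for z
  proof -
    obtain h where h: "h \<in> carrier ?A" "\<forall>i\<in>{-1..int d}. h (\<phi> (\<one>, snd z) i) = \<phi> (fst z, snd z) i"
      using reach_same_bit[OF fst_\<Omega>[OF z]] by blast
    show ?thesis
    proof (cases "snd z")
      case False
      then have "z = (fst z, False)" by (simp add: prod_eq_iff)
      then show ?thesis using h False by metis
    next
      case True
      have "(h \<otimes>\<^bsub>?A\<^esub> t) (\<phi> (\<one>, False) i) = \<phi> z i" if i: "i \<in> {-1..int d}" for i
        using aut_group_simps(2)[OF h(1) t(1)] FieldI[OF one_\<Omega> i] t1[OF i, of False] h(2) i True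
        by (cases z) (simp add: compose_def)
      then show ?thesis using A.m_closed[OF h(1) t(1)] by blast
    qed
  qed
  have "carrier ?A = {h \<in> carrier ?A. \<exists>z\<in>\<Omega>. \<forall>i\<in>{-1..int d}. h (\<phi> (\<one>, False) i) = \<phi> z i}"
  proof (intro equalityI subsetI)
    fix h assume h: "h \<in> carrier ?A"
    obtain z where "z \<in> \<Omega>" "\<And>i. i \<in> {-1..int d} \<Longrightarrow> h (\<phi> (\<one>, False) i) = \<phi> z i"
      using automorphism_chamber[OF h one_\<Omega>] by blast
    then show "h \<in> {h \<in> carrier ?A. \<exists>z\<in>\<Omega>. \<forall>i\<in>{-1..int d}. h (\<phi> (\<one>, False) i) = \<phi> z i}" using h by blast
  qed simp
  then have "card (carrier ?A) = card \<Omega>"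
    using card_automorphisms[OF one_\<Omega> order_refl reach] by simp
  also have "\<dots> = 2 * card (carrier G)" unfolding \<Omega>_def by (simp add: card_cartesian_product)
  finally show order: "order ?A = 2 * card (carrier G)" unfolding order_def .
  \<comment> \<open>membership is tested on one kind only: the complement is then preserved automatically\<close>
  define N where "N = {h \<in> carrier ?A. h ` facets False \<subseteq> facets False}"
  have fin: "finite (facets b)" for b unfolding facets_def using finite_carrier by simp
  have facF: "facets b \<subseteq> Field R" for b unfolding facets_def using FieldI[OF _ facet_rank] \<Omega>_mem by auto
  have injh: "inj_on h (Field R)" if "h \<in> carrier ?A" for h
    using that unfolding aut_group_simps poset_isos_def bij_betw_def by blast
  have N_eq: "h ` facets False = facets False" if "h \<in> N" for h
  proof (rule card_subset_eq[OF fin])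
    show "h ` facets False \<subseteq> facets False" using that unfolding N_def by blast
    show "card (h ` facets False) = card (facets False)"
      using card_image[OF inj_on_subset[OF injh facF]] that unfolding N_def by blast
  qed
  have bit_h: "\<exists>y\<in>\<Omega>. h F = \<phi> y (int d - 1)" if h: "h \<in> carrier ?A" and F: "F \<in> facets b" for h F b
  proof -
    obtain x where x: "x \<in> \<Omega>" "snd x = b" "F = \<phi> x (int d - 1)" using F by (rule facetsE)
    obtain y where "y \<in> \<Omega>" "\<And>i. i \<in> {-1..int d} \<Longrightarrow> h (\<phi> x i) = \<phi> y i"
      using automorphism_chamber[OF h x(1)] by blast
    then show ?thesis using x(3) facet_rank by blast
  qed
  have N_True: "h F \<in> facets True" if h: "h \<in> N" and F: "F \<in> facets True" for h F
  proof -
    have hA: "h \<in> carrier ?A" using h unfolding N_def by blast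
    obtain y where y: "y \<in> \<Omega>" "h F = \<phi> y (int d - 1)" using bit_h[OF hA F] by blast
    have "h F \<notin> facets False"
    proof
      assume "h F \<in> facets False"
      then obtain F' where F': "F' \<in> facets False" "h F = h F'" using N_eq[OF h] by blast
      then have "F = F'" using inj_onD[OF injh[OF hA]] F facF by blast
      then show False using F F' facets_Int[of False] by auto
    qed
    then show ?thesis using facet_bit[OF y(1)] y(2) by (cases "snd y") auto
  qed
  have sub: "subgroup N ?A"
  proof (rule A.subgroupI)
    show "N \<subseteq> carrier ?A" unfolding N_def by blast
    have "\<one>\<^bsub>?A\<^esub> \<in> N" unfolding N_def using facF[of False] A.one_closed by (auto simp: aut_group_simps(3))
    then show "N \<noteq> {}" by blast
  next
    fix h assume h: "h \<in> N"
    then have hA: "h \<in> carrier ?A" unfolding N_def by blast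
    have iA: "inv\<^bsub>?A\<^esub> h \<in> carrier ?A" using hA by simp
    have "(inv\<^bsub>?A\<^esub> h) F \<in> facets False" if F: "F \<in> facets False" for F
    proof -
      obtain F' where F': "F' \<in> facets False" "F = h F'" using N_eq[OF h] F by blast
      have "(inv\<^bsub>?A\<^esub> h) (h F') = (inv\<^bsub>?A\<^esub> h \<otimes>\<^bsub>?A\<^esub> h) F'"
        using aut_group_simps(2)[OF iA hA] F'(1) facF by (auto simp: compose_def)
      also have "\<dots> = F'" using A.l_inv[OF hA] F'(1) facF by (auto simp: aut_group_simps(3))
      finally show ?thesis using F' by simp
    qed
    then show "inv\<^bsub>?A\<^esub> h \<in> N" unfolding N_def using iA by blast
  next
    fix h g assume h: "h \<in> N" and g: "g \<in> N"
    then have hg: "h \<in> carrier ?A" "g \<in> carrier ?A" unfolding N_def by auto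
    have "(h \<otimes>\<^bsub>?A\<^esub> g) F \<in> facets False" if F: "F \<in> facets False" for F
    proof -
      have "h (g F) \<in> facets False" using F h g unfolding N_def by blast
      then show ?thesis using aut_group_simps(2)[OF hg] facF F by (auto simp: compose_def)
    qed
    then show "h \<otimes>\<^bsub>?A\<^esub> g \<in> N" unfolding N_def using A.m_closed[OF hg] by blast
  qed
  have left_N: "h \<in> N" if h: "h \<in> carrier ?A" and g: "g \<in> carrier G"
    and hs: "\<And>x i. x \<in> \<Omega> \<Longrightarrow> i \<in> {-1..int d} \<Longrightarrow> h (\<phi> x i) = \<phi> (shift g x) i" for h g
  proof -
    have "h F \<in> facets False" if F: "F \<in> facets False" for F
    proof -
      obtain x where x: "x \<in> \<Omega>" "snd x = False" "F = \<phi> x (int d - 1)" using F by (rule facetsE)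
      have "h F = \<phi> (shift g x) (int d - 1)" using hs[OF x(1) facet_rank] x(3) by simp
      moreover have "snd (shift g x) = False" using x(2) unfolding shift_def by simp
      ultimately show ?thesis using facet_bit[OF shift_\<Omega>[OF g x(1)], of False] by simp
    qed
    then show ?thesis unfolding N_def using h by blast
  qed
  have N_alt: "N = {h \<in> carrier ?A. \<exists>z\<in>carrier G \<times> {False}. \<forall>i\<in>{-1..int d}. h (\<phi> (\<one>, False) i) = \<phi> z i}"
  proof (intro equalityI subsetI)
    fix h assume h: "h \<in> N"
    then have hA: "h \<in> carrier ?A" unfolding N_def by blast
    obtain z where z: "z \<in> \<Omega>" "\<And>i. i \<in> {-1..int d} \<Longrightarrow> h (\<phi> (\<one>, False) i) = \<phi> z i"
      using automorphism_chamber[OF hA one_\<Omega>] by blast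
    have "\<phi> (\<one>, False) (int d - 1) \<in> facets False" using facet_bit[OF one_\<Omega>, of False] by simp
    then have "\<phi> z (int d - 1) \<in> facets False" using h z(2)[OF facet_rank] unfolding N_def by auto
    then have "snd z = False" using facet_bit[OF z(1), of False] by simp
    then have "z \<in> carrier G \<times> {False}" using z(1) unfolding \<Omega>_def by auto
    then show "h \<in> {h \<in> carrier ?A. \<exists>z\<in>carrier G \<times> {False}. \<forall>i\<in>{-1..int d}. h (\<phi> (\<one>, False) i) = \<phi> z i}"
      using hA z(2) by blast
  next
    fix h assume "h \<in> {h \<in> carrier ?A. \<exists>z\<in>carrier G \<times> {False}. \<forall>i\<in>{-1..int d}. h (\<phi> (\<one>, False) i) = \<phi> z i}"
    then obtain g where h: "h \<in> carrier ?A" "g \<in> carrier G" "\<And>i. i \<in> {-1..int d} \<Longrightarrow> h (\<phi> (\<one>, False) i) = \<phi> (g, False) i"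
      by auto
    obtain k where k: "k \<in> carrier ?A"
      "\<And>x i. x \<in> \<Omega> \<Longrightarrow> i \<in> {-1..int d} \<Longrightarrow> k (\<phi> x i) = \<phi> (shift g x) i"
      using left_automorphism[OF h(2)] by blast
    have "h = k"
    proof (rule automorphism_eqI[OF h(1) k(1) one_\<Omega>])
      fix i assume i: "i \<in> {-1..int d}"
      show "h (\<phi> (\<one>, False) i) = k (\<phi> (\<one>, False) i)"
        using h(3)[OF i] k(2)[OF one_\<Omega> i] h(2) unfolding shift_def by simp
    qed
    then show "h \<in> N" using left_N[OF k(1) h(2) k(2)] by blast
  qed
  have "card N = card (carrier G)" unfolding N_alt by (rule card_bit_fixing)
  moreover have "card (rcosets\<^bsub>?A\<^esub> N) * card N = order ?A" by (rule A.lagrange[OF sub])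
  moreover have "card (carrier G) > 0" using finite_carrier one_closed by (metis card_gt_0_iff empty_iff)
  ultimately have idx: "card (rcosets\<^bsub>?A\<^esub> N) = 2" using order by simp
  have orb: "orbit (?A\<lparr>carrier := N\<rparr>) (\<lambda>f. f) F = facets b" if F: "F \<in> facets b" for F b
  proof (intro equalityI subsetI)
    fix K assume "K \<in> orbit (?A\<lparr>carrier := N\<rparr>) (\<lambda>f. f) F"
    then obtain h where h: "h \<in> N" "K = h F" unfolding orbit_def by auto
    then show "K \<in> facets b" using N_eq[OF h(1)] N_True[OF h(1)] F by (cases b) auto
  next
    fix K assume K: "K \<in> facets b"
    obtain x where x: "x \<in> \<Omega>" "snd x = b" "F = \<phi> x (int d - 1)" using F by (rule facetsE)
    obtain y where y: "y \<in> \<Omega>" "snd y = b" "K = \<phi> y (int d - 1)" using K by (rule facetsE)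
    have xy: "snd x = snd y" using x y by simp
    obtain h where h: "h \<in> carrier ?A"
      "\<And>z i. z \<in> \<Omega> \<Longrightarrow> i \<in> {-1..int d} \<Longrightarrow> h (\<phi> z i) = \<phi> (shift (fst y \<otimes> inv fst x) z) i"
      using left_automorphism[OF shift_to(2)[OF x(1) y(1) xy]] by blast
    have "h \<in> N" by (rule left_N[OF h(1) shift_to(2)[OF x(1) y(1) xy] h(2)])
    moreover have "K = h F" using h(2)[OF x(1) facet_rank] shift_to(1)[OF x(1) y(1) xy] x(3) y(3) by simp
    ultimately show "K \<in> orbit (?A\<lparr>carrier := N\<rparr>) (\<lambda>f. f) F" unfolding orbit_def by auto
  qed
  have "orbits (?A\<lparr>carrier := N\<rparr>) (faces_of_rank R rk (int d - 1)) (\<lambda>f. f) = {facets False, facets True}"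
  proof (intro equalityI subsetI)
    fix O' assume "O' \<in> orbits (?A\<lparr>carrier := N\<rparr>) (faces_of_rank R rk (int d - 1)) (\<lambda>f. f)"
    then obtain F where F: "F \<in> facets False \<union> facets True" "O' = orbit (?A\<lparr>carrier := N\<rparr>) (\<lambda>f. f) F"
      using facets_Un[of False] unfolding orbits_def by auto
    then show "O' \<in> {facets False, facets True}" using orb by blast
  next
    fix O' assume "O' \<in> {facets False, facets True}"
    then obtain b where b: "O' = facets b" by blast
    obtain F where F: "F \<in> facets b" using facets_nonempty[of b] by blast
    then have "F \<in> faces_of_rank R rk (int d - 1)" using facets_Un[of b] by blast
    then show "O' \<in> orbits (?A\<lparr>carrier := N\<rparr>) (faces_of_rank R rk (int d - 1)) (\<lambda>f. f)"
      unfolding orbits_def b using orb[OF F] by blast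
  qed
  moreover have "isomorphic_posets (face_poset R F) (face_poset R F')"
    if F: "F \<in> facets False" and F': "F' \<in> facets True" for F F'
  proof -
    have "F \<in> Field R" "F' \<in> Field R" using F F' facF by blast+
    obtain x where x: "x \<in> \<Omega>" "snd x = False" "F = \<phi> x (int d - 1)" using F by (rule facetsE)
    obtain y where y: "y \<in> \<Omega>" "snd y = True" "F' = \<phi> y (int d - 1)" using F' by (rule facetsE)
    obtain h where h: "h \<in> carrier ?A" "\<forall>i\<in>{-1..int d}. h (\<phi> (\<one>, False) i) = \<phi> y i" using reach[OF y(1)] by blast
    obtain k where k: "k \<in> carrier ?A" "\<forall>i\<in>{-1..int d}. k (\<phi> (\<one>, False) i) = \<phi> x i" using reach[OF x(1)] by blast
    have ik: "inv\<^bsub>?A\<^esub> k \<in> carrier ?A" using k by simp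
    let ?F0 = "\<phi> (\<one>, False) (int d - 1)"
    have F0: "?F0 \<in> Field R" by (rule FieldI[OF one_\<Omega> facet_rank])
    have kF0: "k ?F0 = F" and hF0: "h ?F0 = F'" using k(2) h(2) facet_rank x(3) y(3) by blast+
    have "(inv\<^bsub>?A\<^esub> k) F = (inv\<^bsub>?A\<^esub> k \<otimes>\<^bsub>?A\<^esub> k) ?F0"
      using aut_group_simps(2)[OF ik k(1)] F0 kF0 by (auto simp: compose_def)
    also have "\<dots> = ?F0" using A.l_inv[OF k(1)] F0 by (auto simp: aut_group_simps(3))
    finally have "(h \<otimes>\<^bsub>?A\<^esub> inv\<^bsub>?A\<^esub> k) F = F'"
      using aut_group_simps(2)[OF h(1) ik] \<open>F \<in> Field R\<close> hF0 by (auto simp: compose_def)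
    then show ?thesis using face_poset_aut[OF A.m_closed[OF h(1) ik] \<open>F \<in> Field R\<close>] by simp
  qed
  ultimately show "alternating_semiregular (int d) R rk (facets False) (facets True)"
    using sub idx by (intro alternating_semiregularI) blast
qed

end

section \<open>The symmetry groups of the toroidal polyhedra\<close>

type_synonym d4 = "bool \<times> bool \<times> bool"
type_synonym aff = "(int \<times> int) \<times> d4"

text \<open>The triple \<open>(a, b, p)\<close> is the linear map that first exchanges the coordinates if \<open>p\<close> holds, and then
changes the sign of the first or second coordinate if \<open>a\<close> or \<open>b\<close> holds.\<close>

fun d4_mult :: "d4 \<Rightarrow> d4 \<Rightarrow> d4" where
  "d4_mult (a, b, p) (c, e, q) = (if p then (a \<noteq> e, b \<noteq> c, p \<noteq> q) else (a \<noteq> c, b \<noteq> e, p \<noteq> q))"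

definition D4 :: "d4 monoid" where
  "D4 = \<lparr>carrier = UNIV, monoid.mult = d4_mult, one = (False, False, False)\<rparr>"

lemma D4_simps [simp]: "carrier D4 = UNIV" "x \<otimes>\<^bsub>D4\<^esub> y = d4_mult x y" "\<one>\<^bsub>D4\<^esub> = (False, False, False)"
  unfolding D4_def by auto

lemma d4_assoc: "d4_mult (d4_mult x y) z = d4_mult x (d4_mult y z)"
  by (cases x; cases y; cases z) auto

lemma group_D4: "group D4"
proof (rule groupI)
  fix x :: d4
  obtain a b p where x: "x = (a, b, p)" by (cases x) auto
  have "d4_mult (if p then (b, a, p) else (a, b, p)) x = (False, False, False)" unfolding x by auto
  then show "\<exists>y\<in>carrier D4. y \<otimes>\<^bsub>D4\<^esub> x = \<one>\<^bsub>D4\<^esub>"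
    by (intro bexI[of _ "if p then (b, a, p) else (a, b, p)"]) auto
qed (auto simp: d4_assoc split: prod.splits)

definition dgen :: "nat \<Rightarrow> d4" where
  "dgen k = (if k = 0 then (True, False, False) else if k = 1 then (False, False, True) else (False, False, False))"

text \<open>The outer automorphism of the group of the square: it exchanges the two classes of reflections, and
takes the generators \<open>(False, False, True)\<close> and \<open>(False, True, False)\<close> to \<open>dgen 0\<close> and \<open>dgen 1\<close>.\<close>

fun turn :: "d4 \<Rightarrow> d4" where
  "turn (a, b, p) = (if a \<noteq> b then (a, a \<noteq> p, True) else (a \<noteq> p, a, False))"

lemma turn_mult: "turn (d4_mult x y) = d4_mult (turn x) (turn y)"
  by (cases x; cases y) auto

lemma turn_inj: "turn x = (False, False, False) \<Longrightarrow> x = (False, False, False)"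
  by (cases x) (auto split: if_splits)

fun act :: "d4 \<Rightarrow> int \<times> int \<Rightarrow> int \<times> int" where
  "act (a, b, p) (x, y) = ((if a then -1 else 1) * (if p then y else x), (if b then -1 else 1) * (if p then x else y))"

lemma act_mult: "act (d4_mult A B) z = act A (act B z)"
  by (cases A; cases B; cases z) auto

lemma act_add: "act A (z + w) = act A z + act A w"
  by (cases A; cases z; cases w) auto

lemma act_uminus: "act A (- z) = - act A z"
  by (cases A; cases z) auto

lemma act_diff: "act A (z - w) = act A z - act A w"
  using act_add[of A z "- w"] act_uminus[of A w] by simp

lemma act_one [simp]: "act (False, False, False) z = z"
  by (cases z) auto

lemma act_zero [simp]: "act A (0, 0) = (0, 0)"
  by (cases A) auto

lemma zero_pair: "(0 :: int \<times> int) = (0, 0)" by (simp add: zero_prod_def)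

text \<open>The reflections in the sides of the fundamental triangle of the square tessellation, as pairs of a
translation and a linear part; they move the vertex, the edge and the square of the base flag. The
value for arguments greater than 2 is the identity, so that it can stand for an absent generator.\<close>

definition tgen :: "nat \<Rightarrow> aff" where
  "tgen k = (if k = 0 then ((1, 0), (True, False, False)) else if k = 1 then ((0, 0), (False, False, True))
     else if k = 2 then ((0, 0), (False, True, False)) else ((0, 0), (False, False, False)))"

text \<open>The homomorphism that kills the last generator: an isometry acts on the classes of vertices modulo
2, which form one square.\<close>

fun proj_left :: "aff \<Rightarrow> d4" where
  "proj_left ((u, v), (a, b, p)) = (odd u, odd v, p)"

text \<open>The homomorphism that kills the first generator, dual to \<^const>\<open>proj_left\<close>: the centres of the
squares take the role of the vertices. The automorphism \<^const>\<open>turn\<close> makes the second and third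
generators arrive at \<open>dgen 0\<close> and \<open>dgen 1\<close>.\<close>

fun proj_right :: "aff \<Rightarrow> d4" where
  "proj_right ((u, v), (a, b, p)) = turn (odd u \<noteq> a, odd v \<noteq> b, p)"

text \<open>The stabilisers of the vertex, the edge and the square of the base flag.\<close>

fun stab :: "nat \<Rightarrow> aff set" where
  "stab k = (if k = 0 then {((0, 0), A) | A. True}
     else if k = 1 then {((of_bool a, 0), (a, b, False)) | a b. True}
     else {((of_bool a, of_bool b), (a, b, p)) | a b p. True})"

declare stab.simps [simp del]

text \<open>The representative of a point modulo the lattice spanned by \<open>(s, t)\<close> and \<open>(-t, s)\<close> that lies in
\<open>{0..<s} \<times> {0..<s + t}\<close>. This is valid for \<open>t = 0\<close> and for \<open>t = s\<close>, where \<open>(s, s)\<close> and \<open>(0, 2 s)\<close> span the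
lattice.\<close>

fun red :: "int \<Rightarrow> int \<Rightarrow> int \<times> int \<Rightarrow> int \<times> int" where
  "red s t (x, y) = (x mod s, (y - t * (x div s)) mod (s + t))"

text \<open>The isometries of the square tessellation modulo lattice translations, in normal form.\<close>

definition torus_group :: "int \<Rightarrow> int \<Rightarrow> aff monoid" where
  "torus_group s t = \<lparr>carrier = ({0..<s} \<times> {0..<s + t}) \<times> UNIV,
     monoid.mult = (\<lambda>g h. (red s t (fst g + act (snd g) (fst h)), d4_mult (snd g) (snd h))),
     one = ((0, 0), (False, False, False))\<rparr>"

declare red.simps [simp del]

text \<open>Evenness of \<open>s\<close> puts the lattice inside the even points, as \<^const>\<open>proj_left\<close> and \<^const>\<open>proj_right\<close>
require.\<close>

locale torus =
  fixes s t :: int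
  assumes s2: "2 \<le> s" and even_s: "even s" and t_cases: "t = 0 \<or> t = s"
begin

abbreviation "\<Gamma> \<equiv> torus_group s t"
abbreviation "\<Lambda> \<equiv> torus_lattice s t"
abbreviation "rd \<equiv> red s t"

text \<open>A description that treats \<open>t = 0\<close> and \<open>t = s\<close> alike and is visibly invariant under \<^const>\<open>act\<close>.\<close>

lemma lattice_iff: "(x, y) \<in> \<Lambda> \<longleftrightarrow> (\<exists>a b. x = s * a \<and> y = s * b \<and> (t = 0 \<or> even (a + b)))"
proof
  assume "(x, y) \<in> \<Lambda>"
  then obtain i j where ij: "x = i * s - j * t" "y = i * t + j * s" unfolding torus_lattice_def by blast
  show "\<exists>a b. x = s * a \<and> y = s * b \<and> (t = 0 \<or> even (a + b))"
  proof (cases "t = 0")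
    case True then show ?thesis using ij by (intro exI[of _ i] exI[of _ j]) auto
  next
    case False
    then have "t = s" using t_cases by simp
    then show ?thesis using ij by (intro exI[of _ "i - j"] exI[of _ "i + j"]) (auto simp: algebra_simps)
  qed
next
  assume "\<exists>a b. x = s * a \<and> y = s * b \<and> (t = 0 \<or> even (a + b))"
  then obtain a b where ab: "x = s * a" "y = s * b" "t = 0 \<or> even (a + b)" by blast
  show "(x, y) \<in> \<Lambda>"
  proof (cases "t = 0")
    case True then show ?thesis unfolding torus_lattice_def using ab
      by (intro CollectI exI[of _ a] exI[of _ b]) auto
  next
    case False
    then have ts: "t = s" and ev: "even (a + b)" using t_cases ab(3) by blast+
    obtain c where c: "a + b = 2 * c" using ev by (rule evenE)
    then have b: "b = 2 * c - a" by simp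
    have "x = c * s - (c - a) * t" "y = c * t + (c - a) * s"
      unfolding ab(1,2) b ts by (auto simp: algebra_simps)
    then show ?thesis unfolding torus_lattice_def by blast
  qed
qed

lemma lattice_zero: "0 \<in> \<Lambda>" unfolding zero_pair lattice_iff by auto

lemma lattice_add: "z \<in> \<Lambda> \<Longrightarrow> w \<in> \<Lambda> \<Longrightarrow> z + w \<in> \<Lambda>"
proof -
  assume "z \<in> \<Lambda>" "w \<in> \<Lambda>"
  moreover obtain x y x' y' where "z = (x, y)" "w = (x', y')" by (cases z; cases w) auto
  ultimately obtain a b a' b' where "z = (s * a, s * b)" "t = 0 \<or> even (a + b)"
    "w = (s * a', s * b')" "t = 0 \<or> even (a' + b')" using lattice_iff by auto
  then have zw: "z + w = (s * (a + a'), s * (b + b'))" and ev: "t = 0 \<or> even ((a + a') + (b + b'))"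
    by (auto simp: distrib_left)
  show ?thesis unfolding zw lattice_iff using ev by blast
qed

lemma lattice_act: "z \<in> \<Lambda> \<Longrightarrow> act A z \<in> \<Lambda>"
proof -
  assume z: "z \<in> \<Lambda>"
  obtain a b where ab: "z = (s * a, s * b)" "t = 0 \<or> even (a + b)" using z lattice_iff by (cases z) auto
  obtain c e p where A: "A = (c, e, p)" by (cases A) auto
  have "act A z = (s * ((if c then -1 else 1) * (if p then b else a)), s * ((if e then -1 else 1) * (if p then a else b)))"
    unfolding A ab(1) by auto
  moreover have "t = 0 \<or> even ((if c then -1 else 1) * (if p then b else a) + (if e then -1 else 1) * (if p then a else b))"
    using ab(2) by auto
  ultimately show ?thesis using lattice_iff by metis
qed

lemma lattice_uminus: "z \<in> \<Lambda> \<Longrightarrow> - z \<in> \<Lambda>"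
proof -
  assume "z \<in> \<Lambda>"
  then have "act (True, True, False) z \<in> \<Lambda>" by (rule lattice_act)
  then show ?thesis by (cases z) auto
qed

lemma lattice_diff: "z \<in> \<Lambda> \<Longrightarrow> w \<in> \<Lambda> \<Longrightarrow> z - w \<in> \<Lambda>"
  using lattice_add[of z "- w"] lattice_uminus[of w] by simp

lemma lattice_even: "(x, y) \<in> \<Lambda> \<Longrightarrow> even x \<and> even y"
  using even_s unfolding lattice_iff by auto

lemma rd_lattice: "z - rd z \<in> \<Lambda>"
proof -
  obtain x y where z: "z = (x, y)" by (cases z) auto
  define k q where "k = x div s" and "q = (y - t * k) div (s + t)"
  have x: "x - x mod s = s * k" unfolding k_def by (simp add: minus_mod_eq_mult_div)
  have "(y - t * k) - (y - t * k) mod (s + t) = (s + t) * q" unfolding q_def by (simp add: minus_mod_eq_mult_div)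
  then have y: "y - (y - t * k) mod (s + t) = t * k + (s + t) * q" by simp
  have "(s * k, t * k + (s + t) * q) \<in> \<Lambda>"
  proof (cases "t = 0")
    case True then show ?thesis unfolding lattice_iff by auto
  next
    case False
    then have "t = s" using t_cases by simp
    then show ?thesis unfolding lattice_iff
      by (intro exI[of _ k] exI[of _ "k + 2 * q"]) (auto simp: algebra_simps)
  qed
  then show ?thesis using x y z unfolding k_def by (simp add: red.simps)
qed

lemma rd_cong: assumes "z - w \<in> \<Lambda>" shows "rd z = rd w"
proof -
  obtain x y where w: "w = (x, y)" by (cases w) auto
  obtain u v where z: "z = (u, v)" by (cases z) auto
  have "(u - x, v - y) \<in> \<Lambda>" using assms z w by simp
  then obtain a b where "u - x = s * a" "v - y = s * b" and e: "t = 0 \<or> even (a + b)"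
    using lattice_iff by blast
  then have u: "u = x + a * s" and v: "v = y + s * b" by (auto simp: algebra_simps)
  have s0: "s \<noteq> 0" using s2 by simp
  have d: "u div s = x div s + a" unfolding u using s0 by simp
  have "u mod s = x mod s" unfolding u by simp
  moreover have "(v - t * (u div s)) mod (s + t) = (y - t * (x div s)) mod (s + t)"
  proof (cases "t = 0")
    case True then show ?thesis unfolding v by simp
  next
    case False
    then have ts: "t = s" and ev: "even (b - a)" using t_cases e by auto
    obtain c where c: "b - a = 2 * c" using ev by (rule evenE)
    then have "b = a + 2 * c" by simp
    then have "v - t * (u div s) = (y - t * (x div s)) + c * (s + t)"
      unfolding v d ts by (simp add: algebra_simps)
    then show ?thesis by simp
  qed
  ultimately show ?thesis using z w by (simp add: red.simps)
qed

lemma rd_id: "z \<in> {0..<s} \<times> {0..<s + t} \<Longrightarrow> rd z = z"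
  by (cases z) (auto simp: red.simps)

lemma rd_in: "rd z \<in> {0..<s} \<times> {0..<s + t}"
  using s2 t_cases by (cases z) (auto simp: red.simps)

lemma rd_add_left: "rd (rd z + w) = rd (z + w)"
proof (rule rd_cong)
  have "- (z - rd z) \<in> \<Lambda>" by (intro lattice_uminus rd_lattice)
  then show "rd z + w - (z + w) \<in> \<Lambda>" by (simp add: algebra_simps)
qed

lemma rd_add_act: "rd (z + act A (rd w)) = rd (z + act A w)"
proof (rule rd_cong)
  have "act A (- (w - rd w)) \<in> \<Lambda>" by (intro lattice_act lattice_uminus rd_lattice)
  then show "z + act A (rd w) - (z + act A w) \<in> \<Lambda>" by (simp add: act_diff)
qed

lemma carrier_\<Gamma>: "g \<in> carrier \<Gamma> \<longleftrightarrow> fst g \<in> {0..<s} \<times> {0..<s + t}"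
  unfolding torus_group_def by (cases g) auto

lemma mult_\<Gamma>: "g \<otimes>\<^bsub>\<Gamma>\<^esub> h = (rd (fst g + act (snd g) (fst h)), d4_mult (snd g) (snd h))"
  unfolding torus_group_def by simp

lemma one_\<Gamma>: "\<one>\<^bsub>\<Gamma>\<^esub> = ((0, 0), (False, False, False))"
  unfolding torus_group_def by simp

lemma small_range: "0 < s" "1 < s" "0 < s + t" "1 < s + t"
  using s2 t_cases by auto

lemma rd_small [simp]: "rd (0, 0) = (0, 0)" "rd (1, 0) = (1, 0)" "rd (0, 1) = (0, 1)" "rd (1, 1) = (1, 1)"
    "rd (of_bool a, of_bool b) = (of_bool a, of_bool b)" "rd (of_bool a, 0) = (of_bool a, 0)"
  using rd_id small_range by auto

lemma group_\<Gamma>: "group \<Gamma>"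
proof (rule groupI)
  show "g \<otimes>\<^bsub>\<Gamma>\<^esub> h \<in> carrier \<Gamma>" for g h unfolding mult_\<Gamma> carrier_\<Gamma> using rd_in by simp
  show "\<one>\<^bsub>\<Gamma>\<^esub> \<in> carrier \<Gamma>" unfolding one_\<Gamma> carrier_\<Gamma> using small_range by simp
  show "g \<otimes>\<^bsub>\<Gamma>\<^esub> h \<otimes>\<^bsub>\<Gamma>\<^esub> k = g \<otimes>\<^bsub>\<Gamma>\<^esub> (h \<otimes>\<^bsub>\<Gamma>\<^esub> k)" for g h k
    unfolding mult_\<Gamma> by (simp add: rd_add_left rd_add_act d4_assoc act_add act_mult add.assoc)
  show "\<one>\<^bsub>\<Gamma>\<^esub> \<otimes>\<^bsub>\<Gamma>\<^esub> g = g" if "g \<in> carrier \<Gamma>" for g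
    using that rd_id[of "fst g"] unfolding mult_\<Gamma> one_\<Gamma> carrier_\<Gamma> by (cases g) (auto simp: zero_pair[symmetric])
  show "\<exists>h\<in>carrier \<Gamma>. h \<otimes>\<^bsub>\<Gamma>\<^esub> g = \<one>\<^bsub>\<Gamma>\<^esub>" if "g \<in> carrier \<Gamma>" for g
  proof -
    obtain B where B: "d4_mult B (snd g) = (False, False, False)"
      using group.l_inv_ex[OF group_D4, of "snd g"] by auto
    have "rd (rd (act B (- fst g)) + act B (fst g)) = (0, 0)"
      unfolding rd_add_left by (simp add: act_uminus zero_pair)
    then have "(rd (act B (- fst g)), B) \<otimes>\<^bsub>\<Gamma>\<^esub> g = \<one>\<^bsub>\<Gamma>\<^esub>" unfolding mult_\<Gamma> one_\<Gamma> using B by simp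
    moreover have "(rd (act B (- fst g)), B) \<in> carrier \<Gamma>" unfolding carrier_\<Gamma> using rd_in by simp
    ultimately show ?thesis by blast
  qed
qed

interpretation \<Gamma>: group \<Gamma> by (rule group_\<Gamma>)

lemma finite_\<Gamma>: "finite (carrier \<Gamma>)"
  unfolding torus_group_def by simp

lemma tgen_carrier: "tgen k \<in> carrier \<Gamma>"
  unfolding carrier_\<Gamma> tgen_def using small_range by simp

lemma tgen_invol: "tgen k \<otimes>\<^bsub>\<Gamma>\<^esub> tgen k = \<one>\<^bsub>\<Gamma>\<^esub>"
  unfolding mult_\<Gamma> one_\<Gamma> tgen_def by auto

lemma tgen_commute: "tgen 0 \<otimes>\<^bsub>\<Gamma>\<^esub> tgen 2 = tgen 2 \<otimes>\<^bsub>\<Gamma>\<^esub> tgen 0"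
  unfolding mult_\<Gamma> tgen_def by auto

lemma tgen_2: "tgen 2 \<noteq> \<one>\<^bsub>\<Gamma>\<^esub>"
  unfolding one_\<Gamma> tgen_def by simp

lemma rd_parity: "rd (x, y) = (x', y') \<Longrightarrow> (even x' \<longleftrightarrow> even x) \<and> (even y' \<longleftrightarrow> even y)"
proof -
  assume "rd (x, y) = (x', y')"
  then have "(x - x', y - y') \<in> \<Lambda>" using rd_lattice[of "(x, y)"] by simp
  then have "even (x - x') \<and> even (y - y')" by (rule lattice_even)
  then show ?thesis by simp
qed

lemma proj_hom:
  "proj_left \<in> hom \<Gamma> D4" "proj_right \<in> hom \<Gamma> D4"
proof -
  have "proj_left (g \<otimes>\<^bsub>\<Gamma>\<^esub> h) = d4_mult (proj_left g) (proj_left h) \<and>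
    proj_right (g \<otimes>\<^bsub>\<Gamma>\<^esub> h) = d4_mult (proj_right g) (proj_right h)" for g h
  proof -
    obtain u v a b p where g: "g = ((u, v), (a, b, p))" by (metis prod.exhaust)
    obtain u' v' a' b' p' where h: "h = ((u', v'), (a', b', p'))" by (metis prod.exhaust)
    obtain x y where xy: "rd ((u, v) + act (a, b, p) (u', v')) = (x, y)" by fastforce
    obtain X1 Y1 where XY: "(u, v) + act (a, b, p) (u', v') = (X1, Y1)" by fastforce
    have par: "even x \<longleftrightarrow> even X1" "even y \<longleftrightarrow> even Y1" using rd_parity xy XY by auto
    have X1: "odd X1 \<longleftrightarrow> (odd u \<noteq> (if p then odd v' else odd u'))"
      and Y1: "odd Y1 \<longleftrightarrow> (odd v \<noteq> (if p then odd u' else odd v'))"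
      using XY by (cases a; cases b; cases p; auto)+
    have gh: "g \<otimes>\<^bsub>\<Gamma>\<^esub> h = ((x, y), d4_mult (a, b, p) (a', b', p'))" unfolding mult_\<Gamma> g h using xy by simp
    have 1: "proj_left (g \<otimes>\<^bsub>\<Gamma>\<^esub> h) = d4_mult (proj_left g) (proj_left h)"
      unfolding gh unfolding g h using par X1 Y1 by auto
    let ?A = "d4_mult (a, b, p) (a', b', p')"
    have "(odd x \<noteq> fst ?A, odd y \<noteq> fst (snd ?A), snd (snd ?A)) =
        d4_mult (odd u \<noteq> a, odd v \<noteq> b, p) (odd u' \<noteq> a', odd v' \<noteq> b', p')"
      using par X1 Y1 by (cases p; simp; argo)
    moreover have "proj_right ((x, y), A) = turn (odd x \<noteq> fst A, odd y \<noteq> fst (snd A), snd (snd A))" for A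
      by (cases A) (simp del: turn.simps)
    ultimately have "proj_right (g \<otimes>\<^bsub>\<Gamma>\<^esub> h) = turn (d4_mult (odd u \<noteq> a, odd v \<noteq> b, p) (odd u' \<noteq> a', odd v' \<noteq> b', p'))"
      unfolding gh by metis
    then have "proj_right (g \<otimes>\<^bsub>\<Gamma>\<^esub> h) = d4_mult (proj_right g) (proj_right h)"
      unfolding turn_mult unfolding g h by (simp del: turn.simps)
    then show ?thesis using 1 by blast
  qed
  then show "proj_left \<in> hom \<Gamma> D4" "proj_right \<in> hom \<Gamma> D4" unfolding hom_def by auto
qed

abbreviation "gen I \<equiv> generate \<Gamma> (tgen ` I)"

lemma gen_sub: "tgen ` I \<subseteq> carrier \<Gamma>" using tgen_carrier by auto

lemma stab_mult:
  assumes "g \<in> stab k" "h \<in> stab k" shows "g \<otimes>\<^bsub>\<Gamma>\<^esub> h \<in> stab k"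
proof -
  consider "k = 0" | "k = 1" | "k \<noteq> 0" "k \<noteq> 1" by blast
  then show ?thesis
  proof cases
    case 1
    then show ?thesis using assms unfolding stab.simps mult_\<Gamma> by auto
  next
    case 2
    then obtain a b a' b' where g: "g = ((of_bool a, 0), (a, b, False))" "h = ((of_bool a', 0), (a', b', False))"
      using assms unfolding stab.simps by auto
    have "fst g + act (snd g) (fst h) = (of_bool (a \<noteq> a'), 0)" unfolding g by auto
    then have "g \<otimes>\<^bsub>\<Gamma>\<^esub> h = ((of_bool (a \<noteq> a'), 0), (a \<noteq> a', b \<noteq> b', False))"
      unfolding mult_\<Gamma> using rd_small(6)[of "a \<noteq> a'"] unfolding g by simp
    then show ?thesis using 2 unfolding stab.simps by auto
  next
    case 3
    then obtain a b p a' b' p' where g: "g = ((of_bool a, of_bool b), (a, b, p))" "h = ((of_bool a', of_bool b'), (a', b', p'))"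
      using assms unfolding stab.simps by auto
    let ?c = "a \<noteq> (if p then b' else a')" and ?e = "b \<noteq> (if p then a' else b')"
    have "fst g + act (snd g) (fst h) = (of_bool ?c, of_bool ?e)" unfolding g by auto
    then have "g \<otimes>\<^bsub>\<Gamma>\<^esub> h = ((of_bool ?c, of_bool ?e), (?c, ?e, p \<noteq> p'))"
      unfolding mult_\<Gamma> using rd_small(5)[of ?c ?e] unfolding g by auto
    then show ?thesis using 3 unfolding stab.simps by auto
  qed
qed

lemma tgen_inv: "inv\<^bsub>\<Gamma>\<^esub> (tgen k) = tgen k"
  using \<Gamma>.inv_equality[OF tgen_invol tgen_carrier tgen_carrier] .

text \<open>Together with the converse \<open>stab_gen\<close> this identifies every parabolic subgroup with an intersection
of stabilisers, which yields the intersection property.\<close>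

lemma gen_stab:
  assumes k: "k < 3" "k \<notin> I" and I: "I \<subseteq> {..<3}" and g: "g \<in> gen I" shows "g \<in> stab k"
proof -
  have gens: "tgen i \<in> stab k" if "i \<in> I" for i
  proof -
    have "i < 3" "i \<noteq> k" using that k I by auto
    then have "(k = 0 \<or> k = 1 \<or> k = 2) \<and> (i = 0 \<or> i = 1 \<or> i = 2) \<and> i \<noteq> k" using k(1) by linarith
    then show ?thesis unfolding stab.simps tgen_def by auto
  qed
  from g show ?thesis
  proof (induction rule: generate.induct)
    case one
    then show ?case unfolding one_\<Gamma> stab.simps by auto
  next
    case (incl h) then show ?case using gens by blast
  next
    case (inv h) then show ?case using gens tgen_inv by auto
  next
    case (eng g h) then show ?case using stab_mult by blast
  qed
qed

lemma gen_mult: "g \<in> gen I \<Longrightarrow> i \<in> I \<Longrightarrow> tgen i \<otimes>\<^bsub>\<Gamma>\<^esub> g \<in> gen I"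
  by (rule generate.eng[OF generate.incl[OF imageI]])

lemma gen_one: "((0, 0), (False, False, False)) \<in> gen I"
  using generate.one[of \<Gamma>] unfolding one_\<Gamma> by simp

lemma mult_tgen:
  "tgen 0 \<otimes>\<^bsub>\<Gamma>\<^esub> ((u, v), (a, b, p)) = (rd (1 - u, v), (\<not> a, b, p))"
  "tgen 1 \<otimes>\<^bsub>\<Gamma>\<^esub> ((u, v), (a, b, p)) = (rd (v, u), (b, a, \<not> p))"
  "tgen 2 \<otimes>\<^bsub>\<Gamma>\<^esub> ((u, v), (a, b, p)) = (rd (u, - v), (a, \<not> b, p))"
  unfolding mult_\<Gamma> tgen_def by auto

lemma gen_stepI:
  assumes "((u, v), (a, b, p)) \<in> gen I"
  shows "0 \<in> I \<Longrightarrow> (rd (1 - u, v), (\<not> a, b, p)) \<in> gen I"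
    "1 \<in> I \<Longrightarrow> (rd (v, u), (b, a, \<not> p)) \<in> gen I"
    "2 \<in> I \<Longrightarrow> (rd (u, - v), (a, \<not> b, p)) \<in> gen I"
  using gen_mult[OF assms] mult_tgen by metis+

lemma stab_gen_pair:
  assumes k: "k < 3" and g: "g \<in> stab k" shows "g \<in> gen ({..<3} - {k})"
proof -
  note r = rd_small
  have "k = 0 \<or> k = 1 \<or> k = 2" using k by linarith
  then consider "k = 0" | "k = 1" | "k = 2" by blast
  then show ?thesis
  proof cases
    case 1
    let ?I = "{..<3} - {0 :: nat}"
    have 0: "((0, 0), (a, b, p)) \<in> gen ?I \<Longrightarrow> ((0, 0), (b, a, \<not> p)) \<in> gen ?I \<and> ((0, 0), (a, \<not> b, p)) \<in> gen ?I" for a b p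
      using gen_stepI(2,3)[of 0 0 a b p ?I] r by auto
    have 1: "((0, 0), (False, False, p)) \<in> gen ?I" for p
      using gen_one[of ?I] 0[of False False False, THEN conjunct1] by (cases p) simp_all
    have 2: "((0, 0), (False, b, p)) \<in> gen ?I" for b p
      using 1[of p] 0[of False False p, THEN conjunct2] by (cases b) simp_all
    have 3: "((0, 0), (a, False, p)) \<in> gen ?I" for a p
      using 0[OF 2[of a "\<not> p"], THEN conjunct1] by simp
    have "((0, 0), (a, b, p)) \<in> gen ?I" for a b p
      using 3[of a p] 0[of a False p, THEN conjunct2] by (cases b) simp_all
    then show ?thesis using g \<open>k = 0\<close> unfolding stab.simps by auto
  next
    case 2
    let ?I = "{..<3} - {1 :: nat}"
    have F: "((0, 0), (False, b, False)) \<in> gen ?I" for b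
      using gen_one[of ?I] gen_stepI(3)[of 0 0 False False False ?I] r by (cases b) auto
    have "((of_bool a, 0), (a, b, False)) \<in> gen ?I" for a b
      using F[of b] gen_stepI(1)[OF F[of b]] r by (cases a) auto
    then show ?thesis using g 2 unfolding stab.simps by auto
  next
    case 3
    let ?I = "{..<3} - {2 :: nat}"
    have 0: "((of_bool a, of_bool b), (a, b, p)) \<in> gen ?I \<Longrightarrow>
        ((of_bool (\<not> a), of_bool b), (\<not> a, b, p)) \<in> gen ?I \<and> ((of_bool b, of_bool a), (b, a, \<not> p)) \<in> gen ?I" for a b p
      using gen_stepI(1,2)[of "of_bool a" "of_bool b" a b p ?I] r by (cases a; cases b) auto
    have 1: "((of_bool False, of_bool False), (False, False, p)) \<in> gen ?I" for p
      using gen_one[of ?I] 0[of False False False, THEN conjunct2] by (cases p) simp_all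
    have 2: "((of_bool a, of_bool False), (a, False, p)) \<in> gen ?I" for a p
      using 1[of p] 0[OF 1[of p], THEN conjunct1] by (cases a) simp_all
    have 3: "((of_bool False, of_bool b), (False, b, p)) \<in> gen ?I" for b p
      using 0[OF 2[of b "\<not> p"], THEN conjunct2] by simp
    have "((of_bool a, of_bool b), (a, b, p)) \<in> gen ?I" for a b p
      using 3[of b p] 0[OF 3[of b p], THEN conjunct1] by (cases a) simp_all
    then show ?thesis using g \<open>k = 2\<close> unfolding stab.simps by auto
  qed
qed

lemma gen_full: "gen {..<3} = carrier \<Gamma>"
proof
  show "gen {..<3} \<subseteq> carrier \<Gamma>" using \<Gamma>.generate_incl[OF gen_sub] .
  note sub = \<Gamma>.mono_generate[OF image_mono, of "{..<3} - {0}" "{..<3}" tgen]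
  have st0: "((0, 0), A) \<in> gen {..<3}" for A
    using stab_gen_pair[of 0 "((0, 0), A)"] sub unfolding stab.simps by (cases A) auto
  have tx: "((1, 0), (False, False, False)) \<in> gen {..<3}"
    using gen_stepI(1)[OF st0[of "(True, False, False)"]] by simp
  have mul: "(rd (z + act A w), d4_mult A B) \<in> gen {..<3}"
    if "(z, A) \<in> gen {..<3}" "(w, B) \<in> gen {..<3}" for z w A B
    using generate.eng[OF that] unfolding mult_\<Gamma> by simp
  have ty: "((0, 1), (False, False, False)) \<in> gen {..<3}"
    using mul[OF mul[OF st0[of "(False, False, True)"] tx] st0[of "(False, False, True)"]] by simp
  have X0: "(rd (int n, 0), (False, False, False)) \<in> gen {..<3}" for n
  proof (induction n)
    case 0 then show ?case using gen_one[of "{..<3}"] by simp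
  next
    case (Suc n)
    have "rd (rd (int n, 0) + (1, 0)) = rd (int (Suc n), 0)" unfolding rd_add_left by (simp add: algebra_simps)
    then show ?case using mul[OF Suc tx] by simp
  qed
  have XY: "(rd (int n, int m), (False, False, False)) \<in> gen {..<3}" for n m
  proof (induction m)
    case 0 then show ?case using X0 by simp
  next
    case (Suc m)
    have "rd (rd (int n, int m) + (0, 1)) = rd (int n, int (Suc m))" unfolding rd_add_left by (simp add: algebra_simps)
    then show ?case using mul[OF Suc ty] by simp
  qed
  show "carrier \<Gamma> \<subseteq> gen {..<3}"
  proof
    fix g assume g: "g \<in> carrier \<Gamma>"
    obtain u v A where gu: "g = ((u, v), A)" by (cases g) auto
    have uv: "0 \<le> u" "0 \<le> v" "rd (u, v) = (u, v)" using g rd_id unfolding carrier_\<Gamma> gu by auto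
    have "((u, v), (False, False, False)) \<in> gen {..<3}" using XY[of "nat u" "nat v"] uv by simp
    from mul[OF this st0[of A]] have "(rd (u, v), d4_mult (False, False, False) A) \<in> gen {..<3}"
      by simp
    then show "g \<in> gen {..<3}" using uv(3) gu by (cases A) simp
  qed
qed

text \<open>An element of two different stabilisers is trivial or one of the generators.\<close>

lemma stab_gen:
  assumes I: "I \<subseteq> {..<3}" and g: "g \<in> carrier \<Gamma>" and st: "\<And>k. k < 3 \<Longrightarrow> k \<notin> I \<Longrightarrow> g \<in> stab k"
  shows "g \<in> gen I"
proof -
  have I3: "I = {i. i < 3 \<and> i \<in> I}" using I by auto
  have cl: "tgen i \<in> gen I" if "i \<in> I" for i using that by (intro generate.incl imageI)
  have s: "0 \<notin> I \<Longrightarrow> g \<in> stab 0" "1 \<notin> I \<Longrightarrow> g \<in> stab 1" "2 \<notin> I \<Longrightarrow> g \<in> stab 2" using st by auto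
  have set3: "{..<3 :: nat} = {0, 1, 2}" by auto
  show ?thesis
  proof (cases "card ({..<3} - I) \<le> 1")
    case True
    show ?thesis
    proof (cases "{..<3} - I = {}")
      case True then have "I = {..<3}" using I by blast
      then show ?thesis using gen_full g by simp
    next
      case False
      then have "card ({..<3} - I) = 1" using True by (metis card_0_eq finite_Diff finite_lessThan le_antisym less_one linorder_not_le)
      then obtain k where k: "{..<3} - I = {k}" by (metis card_1_singletonE)
      then have "I = {..<3} - {k}" "k < 3" "k \<notin> I" using I by blast+
      then show ?thesis using stab_gen_pair st by metis
    qed
  next
    case False
    have "0 \<notin> I \<and> 1 \<notin> I \<or> 0 \<notin> I \<and> 2 \<notin> I \<or> 1 \<notin> I \<and> 2 \<notin> I"
    proof (rule ccontr)
      assume "\<not> ?thesis"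
      then have "\<exists>k. {..<3} - I \<subseteq> {k}" unfolding set3 by auto
      then show False using False card_mono[of "{k}" "{..<3} - I" for k] by (metis card.empty card_insert_disjoint empty_iff finite.emptyI finite.insertI One_nat_def)
    qed
    then have "g = tgen 0 \<and> 0 \<in> I \<or> g = tgen 1 \<and> 1 \<in> I \<or> g = tgen 2 \<and> 2 \<in> I \<or> g = \<one>\<^bsub>\<Gamma>\<^esub>"
      using s unfolding stab.simps tgen_def one_\<Gamma> by (auto split: if_splits)
    then show ?thesis using cl generate.one[of \<Gamma>] by auto
  qed
qed

lemma gen_Int:
  assumes "I \<subseteq> {..<3}" "J \<subseteq> {..<3}" shows "gen I \<inter> gen J \<subseteq> gen (I \<inter> J)"
proof
  fix g assume g: "g \<in> gen I \<inter> gen J"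
  show "g \<in> gen (I \<inter> J)"
  proof (rule stab_gen)
    show "I \<inter> J \<subseteq> {..<3}" using assms by blast
    show "g \<in> carrier \<Gamma>" using g \<Gamma>.generate_incl[OF gen_sub] by blast
    show "g \<in> stab k" if "k < 3" "k \<notin> I \<inter> J" for k
      using gen_stab[OF that(1) _ assms(1), of g] gen_stab[OF that(1) _ assms(2), of g] that(2) g by blast
  qed
qed

lemma proj_left_inj: "g \<in> gen {0, 1} \<Longrightarrow> proj_left g = (False, False, False) \<Longrightarrow> g = \<one>\<^bsub>\<Gamma>\<^esub>"
  using gen_stab[of 2 "{0, 1}" g] unfolding stab.simps one_\<Gamma> by (auto split: if_splits)

lemma proj_right_inj:
  assumes "g \<in> gen {1, 2}" "proj_right g = (False, False, False)" shows "g = \<one>\<^bsub>\<Gamma>\<^esub>"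
proof -
  obtain A where A: "g = ((0, 0), A)" using gen_stab[of 0 "{1, 2}" g] assms(1) unfolding stab.simps by auto
  have "turn A = (False, False, False)" using assms(2) unfolding A by (cases A) (simp del: turn.simps)
  then show ?thesis using turn_inj A unfolding one_\<Gamma> by simp
qed

text \<open>A fibre prescribes the parities of the translation and whether the coordinates are exchanged; the
halves of the coordinates and the two signs are free.\<close>

lemma card_fibre: "int (card {g \<in> carrier \<Gamma>. proj_left g = c}) = s * (s + t)"
proof -
  obtain c1 c2 c3 where c: "c = (c1, c2, c3)" by (cases c) auto
  obtain m where m: "s = 2 * m" "m > 0" using even_s s2 by (auto elim!: evenE)
  obtain n where n: "s + t = 2 * n" "n > 0" using even_s s2 t_cases m by (auto)
  define f where "f = (\<lambda>(x :: int, y :: int, a :: bool, b :: bool). ((2 * x + of_bool c1, 2 * y + of_bool c2), (a, b, c3)))"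
  have "{g \<in> carrier \<Gamma>. proj_left g = c} = f ` ({0..<m} \<times> {0..<n} \<times> UNIV \<times> UNIV)"
  proof (intro equalityI subsetI)
    fix g assume g: "g \<in> {g \<in> carrier \<Gamma>. proj_left g = c}"
    obtain u v a b p where gu: "g = ((u, v), (a, b, p))" by (metis prod.exhaust)
    have h: "0 \<le> u" "u < 2 * m" "0 \<le> v" "v < 2 * n" "odd u = c1" "odd v = c2" "p = c3"
      using g unfolding carrier_\<Gamma> gu c m(1)[symmetric] n(1)[symmetric] by auto
    have "u = 2 * (u div 2) + of_bool c1" "v = 2 * (v div 2) + of_bool c2"
      using h(5,6) by (auto simp: odd_two_times_div_two_succ)
    then have "g = f (u div 2, v div 2, a, b)" unfolding f_def gu using h(7) by auto
    moreover have "(u div 2, v div 2, a, b) \<in> {0..<m} \<times> {0..<n} \<times> UNIV \<times> UNIV" using h by auto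
    ultimately show "g \<in> f ` ({0..<m} \<times> {0..<n} \<times> UNIV \<times> UNIV)" by blast
  next
    fix g assume "g \<in> f ` ({0..<m} \<times> {0..<n} \<times> UNIV \<times> UNIV)"
    then obtain x y a b where "0 \<le> x" "x < m" "0 \<le> y" "y < n" "g = f (x, y, a, b)" by auto
    then have g: "g = ((2 * x + of_bool c1, 2 * y + of_bool c2), (a, b, c3))"
      and "fst g \<in> {0..<2 * m} \<times> {0..<2 * n}" unfolding f_def by (auto simp: of_bool_def)
    then have "g \<in> carrier \<Gamma>" unfolding carrier_\<Gamma> m(1)[symmetric] n(1)[symmetric] by blast
    moreover have "proj_left g = c" unfolding g c by simp
    ultimately show "g \<in> {g \<in> carrier \<Gamma>. proj_left g = c}" by blast
  qed
  moreover have "inj_on f ({0..<m} \<times> {0..<n} \<times> UNIV \<times> UNIV)"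
    unfolding f_def by (rule inj_onI) auto
  ultimately have "card {g \<in> carrier \<Gamma>. proj_left g = c} = card ({0..<m} \<times> {0..<n} \<times> (UNIV :: bool set) \<times> (UNIV :: bool set))"
    by (simp only: card_image)
  also have "\<dots> = nat m * nat n * 4"
    by (simp add: card_cartesian_product UNIV_Times_UNIV[symmetric] del: UNIV_Times_UNIV)
  finally show ?thesis using m n by simp
qed

end

section \<open>The tessellation and its quotients\<close>

text \<open>The isometry of the plane described by a pair of a translation vector and a linear part.\<close>

fun app :: "aff \<Rightarrow> int \<times> int \<Rightarrow> int \<times> int" where
  "app (v, A) z = v + act A z"

definition base :: "int \<Rightarrow> (int \<times> int) set" where
  "base k = (if k = -1 then {} else if k = 0 then {(0, 0)} else if k = 1 then {(0, 0), (1, 0)}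
     else if k = 2 then {0, 1} \<times> {0, 1} else UNIV)"

text \<open>The faces of the tessellation are the images of the faces of the base flag.\<close>

definition tface :: "aff \<Rightarrow> int \<Rightarrow> (int \<times> int) set" where
  "tface g k = app g ` base k"

definition unit_sign :: "bool \<Rightarrow> int" where "unit_sign a = (if a then -1 else 1)"

lemma base_simps: "base (-1) = {}" "base 0 = {(0, 0)}" "base 1 = {(0, 0), (1, 0)}"
    "base 2 = {(0, 0), (1, 0), (0, 1), (1, 1)}" "base 3 = UNIV"
  unfolding base_def by auto

lemma act_right_inverse: obtains B where "\<And>z. act A (act B z) = z"
proof -
  obtain B where "d4_mult A B = (False, False, False)"
    using group.r_inv_ex[OF group_D4, of A] by auto
  then have "act A (act B z) = z" for z unfolding act_mult[symmetric] by simp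
  then show ?thesis using that by blast
qed

lemma act_inj: assumes "act A z = act A w" shows "z = w"
proof -
  obtain B where "d4_mult B A = (False, False, False)"
    using group.l_inv_ex[OF group_D4, of A] by auto
  then have "act B (act A x) = x" for x unfolding act_mult[symmetric] by simp
  then show ?thesis using assms by metis
qed

lemma app_inj: "inj (app g)"
proof (rule injI)
  fix z w assume e: "app g z = app g w"
  obtain v A where "g = (v, A)" by (cases g) auto
  then show "z = w" using act_inj[of A z w] e by simp
qed

lemma app_add: "app g (z + w) = app g z + act (snd g) w"
  by (cases g) (simp add: act_add add.assoc)

lemma app_surj: "app g ` UNIV = UNIV"
proof -
  obtain v A where g: "g = (v, A)" by (cases g) auto
  obtain B where B: "\<And>z. act A (act B z) = z" using act_right_inverse[of A] by blast
  have "z = app g (act B (z - v))" for z unfolding g using B by simp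
  then show ?thesis by (metis surj_def)
qed

lemma tface_simps:
  "tface g (-1) = {}" "tface g 3 = UNIV"
  "tface ((u, v), (a, b, p)) 0 = {(u, v)}"
  "tface ((u, v), (a, b, p)) 1 = (if p then {(u, v), (u, v + unit_sign b)} else {(u, v), (u + unit_sign a, v)})"
  "tface ((u, v), (a, b, p)) 2 = {u, u + unit_sign a} \<times> {v, v + unit_sign b}"
  unfolding tface_def base_simps by (auto simp: unit_sign_def app_surj)

lemma rank_cases: "k \<in> {-1..3} \<Longrightarrow> k = -1 \<or> k = 0 \<or> k = 1 \<or> k = 2 \<or> k = (3 :: int)"
  by auto

lemma tface_face:
  assumes "k \<in> {-1..3}" shows "tface g k \<in> tessellation_faces"
proof -
  obtain u v a b p where g: "g = ((u, v), (a, b, p))" by (metis prod.exhaust)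
  have h: "{(x, y), (x + 1, y)} \<in> tessellation_faces" "{(x, y), (x, y + 1)} \<in> tessellation_faces"
    "{x, x + 1} \<times> {y, y + 1} \<in> tessellation_faces" "{(x, y)} \<in> tessellation_faces"
    "{} \<in> tessellation_faces" "UNIV \<in> tessellation_faces" for x y
    unfolding tessellation_faces_def unit_square_def by auto
  have 1: "tface g 1 \<in> tessellation_faces"
    using h(1)[of u v] h(1)[of "u - 1" v] h(2)[of u v] h(2)[of u "v - 1"]
    unfolding g tface_simps unit_sign_def by (cases p; cases a; cases b) (simp_all add: insert_commute)
  have 2: "tface g 2 \<in> tessellation_faces"
    using h(3)[of u v] h(3)[of "u - 1" v] h(3)[of u "v - 1"] h(3)[of "u - 1" "v - 1"]
    unfolding g tface_simps unit_sign_def by (cases a; cases b) (simp_all add: insert_commute)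
  have 0: "tface g 0 \<in> tessellation_faces" unfolding g tface_simps by (rule h)
  have "tface g (-1) \<in> tessellation_faces" "tface g 3 \<in> tessellation_faces"
    unfolding tface_simps(1,2) by (rule h)+
  then show ?thesis using rank_cases[OF assms] 0 1 2 by metis
qed

lemma tface_mono:
  assumes "i \<le> j" "i \<in> {-1..3}" "j \<in> {-1..3}" shows "tface g i \<subseteq> tface g j"
proof -
  have "i = j \<or> i = -1 \<or> j = 3 \<or> (i = 0 \<and> j = 1) \<or> (i = 0 \<and> j = 2) \<or> (i = 1 \<and> j = 2)"
    using assms by auto
  then have "base i \<subseteq> base j" by (elim disjE conjE) (simp_all add: base_simps)
  then show ?thesis unfolding tface_def by blast
qed

lemma face_cases:
  assumes "F \<in> tessellation_faces"
  obtains "F = {}" | "F = UNIV" | x y where "F = {(x, y)}" | x y where "F = {(x, y), (x + 1, y)}"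
    | x y where "F = {(x, y), (x, y + 1)}" | x y where "F = {x, x + 1} \<times> {y, y + 1}"
proof -
  have "F \<in> {{}, UNIV} \<or> F \<in> {{(x, y)} | x y. True} \<or> F \<in> {{(x, y), (x + 1, y)} | x y. True} \<or>
      F \<in> {{(x, y), (x, y + 1)} | x y. True} \<or> F \<in> {{x, x + 1} \<times> {y, y + 1} | x y. True}"
    using assms unfolding tessellation_faces_def unit_square_def Un_iff by (elim disjE) simp_all
  then show thesis by (elim disjE CollectE exE insertE emptyE conjE) (rule that; assumption)+
qed

lemma face_tface:
  assumes "F \<in> tessellation_faces" shows "\<exists>g. \<exists>k\<in>{-1..3}. F = tface g k"
  using assms
proof (cases rule: face_cases)
  case 1
  then show ?thesis using tface_simps(1) by (intro exI bexI[of _ "-1"]) auto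
next
  case 2
  then show ?thesis using tface_simps(2) by (intro exI bexI[of _ 3]) auto
next
  case (3 x y)
  then show ?thesis by (intro exI[of _ "((x, y), (False, False, False))"] bexI[of _ 0]) (auto simp: tface_simps)
next
  case (4 x y)
  then show ?thesis by (intro exI[of _ "((x, y), (False, False, False))"] bexI[of _ 1]) (auto simp: tface_simps unit_sign_def)
next
  case (5 x y)
  then show ?thesis by (intro exI[of _ "((x, y), (False, False, True))"] bexI[of _ 1]) (auto simp: tface_simps unit_sign_def)
next
  case (6 x y)
  then show ?thesis by (intro exI[of _ "((x, y), (False, False, False))"] bexI[of _ 2]) (auto simp: tface_simps unit_sign_def)
qed

lemma unit_pair: "x = y \<or> x = y + 1 \<Longrightarrow> {x, x + unit_sign (x \<noteq> y)} = {y, y + (1 :: int)}"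
  unfolding unit_sign_def by auto

text \<open>Isometries act transitively on the flags of the tessellation. The flag is found by placing the origin
at a vertex of the smaller face and choosing the signs so that the remaining directions point into the
larger one.\<close>

lemma incident_faces:
  assumes F: "F \<in> tessellation_faces" and K: "K \<in> tessellation_faces" and FK: "F \<subseteq> K"
  shows "\<exists>g i j. -1 \<le> i \<and> i \<le> j \<and> j \<le> 3 \<and> F = tface g i \<and> K = tface g j"
proof -
  have I: ?thesis if "F = tface g i" "K = tface g j" "-1 \<le> i" "i \<le> j" "j \<le> 3" for g i j
    using that by blast
  consider "F = {}" | "K = UNIV" | "F \<noteq> {}" "K \<noteq> UNIV" by blast
  then show ?thesis
  proof cases
    case 1
    obtain g k where "k \<in> {-1..3}" "K = tface g k" using face_tface[OF K] by blast
    then show ?thesis using I[of g "-1" k] 1 tface_simps(1) by auto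
  next
    case 2
    obtain g k where "k \<in> {-1..3}" "F = tface g k" using face_tface[OF F] by blast
    then show ?thesis using I[of g k 3] 2 tface_simps(2) by auto
  next
    case 3
    from F show ?thesis
    proof (cases rule: face_cases)
      case 1 then show ?thesis using 3 by blast
    next
      case 2 then show ?thesis using 3 FK by blast
    next
      case v: (3 x y)
      from K show ?thesis
      proof (cases rule: face_cases)
        case 1 then show ?thesis using v FK by simp
      next
        case 2 then show ?thesis using \<open>K \<noteq> UNIV\<close> by blast
      next
        case (3 x' y')
        then show ?thesis using v FK by (intro I[of "((x, y), (False, False, False))" 0 0]) (auto simp: tface_simps)
      next
        case (4 x' y')
        then have xy: "x = x' \<or> x = x' + 1" "y = y'" using v FK by auto
        show ?thesis
          by (rule I[of "((x, y), (x \<noteq> x', False, False))" 0 1]) (use v 4 xy in \<open>auto simp: tface_simps unit_sign_def\<close>)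
      next
        case (5 x' y')
        then have xy: "x = x'" "y = y' \<or> y = y' + 1" using v FK by auto
        show ?thesis
          by (rule I[of "((x, y), (False, y \<noteq> y', True))" 0 1]) (use v 5 xy in \<open>auto simp: tface_simps unit_sign_def\<close>)
      next
        case (6 x' y')
        then have xy: "x = x' \<or> x = x' + 1" "y = y' \<or> y = y' + 1" using v FK by auto
        show ?thesis
          by (rule I[of "((x, y), (x \<noteq> x', y \<noteq> y', False))" 0 2])
            (use v 6 unit_pair[OF xy(1)] unit_pair[OF xy(2)] in \<open>auto simp: tface_simps\<close>)
      qed
    next
      case h: (4 x y)
      from K show ?thesis
      proof (cases rule: face_cases)
        case 1 then show ?thesis using h FK by simp
      next
        case 2 then show ?thesis using \<open>K \<noteq> UNIV\<close> by blast
      next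
        case (3 x' y') then show ?thesis using h FK by auto
      next
        case (4 x' y')
        then have xy: "x = x'" "y = y'" using h FK by auto
        show ?thesis
          by (rule I[of "((x, y), (False, False, False))" 1 1]) (use h 4 xy in \<open>auto simp: tface_simps unit_sign_def\<close>)
      next
        case (5 x' y') then show ?thesis using h FK by auto
      next
        case (6 x' y')
        then have xy: "x = x'" "y = y' \<or> y = y' + 1" using h FK by auto
        show ?thesis
          by (rule I[of "((x, y), (False, y \<noteq> y', False))" 1 2])
            (use h 6 xy(1) unit_pair[OF xy(2)] in \<open>auto simp: tface_simps unit_sign_def\<close>)
      qed
    next
      case h: (5 x y)
      from K show ?thesis
      proof (cases rule: face_cases)
        case 1 then show ?thesis using h FK by simp
      next
        case 2 then show ?thesis using \<open>K \<noteq> UNIV\<close> by blast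
      next
        case (3 x' y') then show ?thesis using h FK by auto
      next
        case (4 x' y') then show ?thesis using h FK by auto
      next
        case (5 x' y')
        then have xy: "x = x'" "y = y'" using h FK by auto
        show ?thesis
          by (rule I[of "((x, y), (False, False, True))" 1 1]) (use h 5 xy in \<open>auto simp: tface_simps unit_sign_def\<close>)
      next
        case (6 x' y')
        then have xy: "x = x' \<or> x = x' + 1" "y = y'" using h FK by auto
        show ?thesis
          by (rule I[of "((x, y), (x \<noteq> x', False, True))" 1 2])
            (use h 6 xy(2) unit_pair[OF xy(1)] in \<open>auto simp: tface_simps unit_sign_def\<close>)
      qed
    next
      case q: (6 x y)
      from K show ?thesis
      proof (cases rule: face_cases)
        case 1 then show ?thesis using q FK by auto
      next
        case 2 then show ?thesis using \<open>K \<noteq> UNIV\<close> by blast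
      next
        case (3 x' y') then show ?thesis using q FK by auto
      next
        case (4 x' y') then show ?thesis using q FK by auto
      next
        case (5 x' y') then show ?thesis using q FK by auto
      next
        case (6 x' y')
        then have xy: "x = x'" "y = y'" using q FK by auto
        show ?thesis
          by (rule I[of "((x, y), (False, False, False))" 2 2]) (use q 6 xy in \<open>auto simp: tface_simps unit_sign_def\<close>)
      qed
    qed
  qed
qed

definition translate :: "int \<times> int \<Rightarrow> (int \<times> int) set \<Rightarrow> (int \<times> int) set" where
  "translate l F = (\<lambda>z. z + l) ` F"

lemma translate_tface: "translate l (tface g k) = tface (fst g + l, snd g) k"
  unfolding translate_def tface_def image_image by (cases g) (simp add: algebra_simps)

lemma app_translate: "app g ` translate l F = translate (act (snd g) l) (app g ` F)"
  unfolding translate_def image_image app_add by simp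

text \<open>An isometry that takes a face of the base flag to a translate of itself is a stabilising isometry
followed by that translation.\<close>

lemma tface_eq_base:
  assumes k: "k \<in> {0, 1, 2 :: nat}" and e: "tface ((u, v), A) (int k) = translate l (base (int k))"
  shows "((u - fst l, v - snd l), A) \<in> stab k"
proof -
  obtain x y where l: "l = (x, y)" by (cases l) auto
  obtain a b p where A: "A = (a, b, p)" by (cases A) auto
  have sign: "u - x = of_bool a" if "{u, u + unit_sign a} = {x, x + 1}" for u x :: int and a
  proof -
    have "u = x \<or> u = x + 1" "u + unit_sign a = x \<or> u + unit_sign a = x + 1" using that by blast+
    then show ?thesis unfolding unit_sign_def by (cases a) auto
  qed
  consider "k = 0" | "k = 1" | "k = 2" using k by blast
  then show ?thesis
  proof cases
    case 1
    then show ?thesis using e unfolding A l stab.simps by (auto simp: tface_simps base_simps translate_def)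
  next
    case 2
    have "tface ((u, v), (a, b, p)) 1 = {(x, y), (x + 1, y)}"
      using e 2 unfolding A l by (simp add: base_simps translate_def add.commute)
    then have e': "(if p then {(u, v), (u, v + unit_sign b)} else {(u, v), (u + unit_sign a, v)}) = {(x, y), (x + 1, y)}"
      unfolding tface_simps .
    have p: "\<not> p"
    proof
      assume p
      then have "{(x, y), (x + 1, y)} = {(u, v), (u, v + unit_sign b)}" using e' by simp
      then have "fst ` {(x, y), (x + 1, y)} = fst ` {(u, v), (u, v + unit_sign b)}" by (rule arg_cong)
      then show False by auto
    qed
    then have e'': "{(u, v), (u + unit_sign a, v)} = {(x, y), (x + 1, y)}" using e' by simp
    have "fst ` {(u, v), (u + unit_sign a, v)} = fst ` {(x, y), (x + 1, y)}" unfolding e'' ..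
    then have "{u, u + unit_sign a} = {x, x + 1}" by simp
    then have "u - x = of_bool a" by (rule sign)
    moreover have "snd ` {(u, v), (u + unit_sign a, v)} = snd ` {(x, y), (x + 1, y)}" unfolding e'' ..
    then have "v = y" by auto
    ultimately have "\<not> p \<and> u - x = of_bool a \<and> v = y" using p by blast
    then show ?thesis using 2 unfolding A l stab.simps by auto
  next
    case 3
    have "translate (x, y) (base 2) = {x, x + 1} \<times> {y, y + 1}"
      unfolding base_simps translate_def by (simp add: Sigma_def insert_commute add.commute)
    moreover have "tface ((u, v), (a, b, p)) 2 = translate (x, y) (base 2)" using e 3 unfolding A l by simp
    ultimately have "tface ((u, v), (a, b, p)) 2 = {x, x + 1} \<times> {y, y + 1}" by (rule trans[rotated])
    then have "{u, u + unit_sign a} = {x, x + 1} \<and> {v, v + unit_sign b} = {y, y + 1}"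
      unfolding tface_simps times_eq_iff by blast
    then have "{u, u + unit_sign a} = {x, x + 1}" "{v, v + unit_sign b} = {y, y + 1}" by blast+
    then have "u - x = of_bool a \<and> v - y = of_bool b"
      using sign by blast
    then show ?thesis using 3 unfolding A l stab.simps by auto
  qed
qed

lemma stab_tface:
  assumes k: "k \<in> {0, 1, 2 :: nat}" and w: "w \<in> stab k" shows "tface w (int k) = base (int k)"
proof -
  consider "k = 0" | "k = 1" | "k = 2" using k by blast
  then show ?thesis
  proof cases
    case 1
    then show ?thesis using w unfolding stab.simps by (auto simp: tface_simps base_simps)
  next
    case 2
    then obtain a b where "w = ((of_bool a, 0), (a, b, False))" using w unfolding stab.simps by auto
    then show ?thesis using 2 by (cases a) (auto simp: tface_simps base_simps unit_sign_def)
  next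
    case 3
    then obtain a b p where "w = ((of_bool a, of_bool b), (a, b, p))" using w unfolding stab.simps by auto
    then show ?thesis using 3 by (cases a; cases b) (auto simp: tface_simps base_simps unit_sign_def)
  qed
qed

lemma card_translate: "card (translate l F) = card F"
  unfolding translate_def by (rule card_image) (auto intro: injI)

lemma card_tface: "card (tface g k) = card (base k)"
  unfolding tface_def by (rule card_image[OF inj_on_subset[OF app_inj subset_UNIV]])

context torus
begin

lemma equiv_lattice: "equiv tessellation_faces (lattice_equiv s t)"
  and lattice_equiv_iff: "(F, K) \<in> lattice_equiv s t \<longleftrightarrow>
      F \<in> tessellation_faces \<and> (\<exists>l\<in>\<Lambda>. K = translate l F)"
proof -
  have tr: "translate l F \<in> tessellation_faces" if "F \<in> tessellation_faces" for l F
    using face_tface[OF that] tface_face translate_tface by metis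
  have fn: "(\<lambda>(x, y). (x + a, y + b)) = (\<lambda>z. z + (a, b))" for a b :: int by auto
  have iff: "(F, K) \<in> lattice_equiv s t \<longleftrightarrow> F \<in> tessellation_faces \<and> (\<exists>l\<in>\<Lambda>. K = translate l F)" for F K
    using tr unfolding lattice_equiv_def translate_def fn by auto
  show "(F, K) \<in> lattice_equiv s t \<longleftrightarrow> F \<in> tessellation_faces \<and> (\<exists>l\<in>\<Lambda>. K = translate l F)" by (rule iff)
  have tt: "translate l (translate m F) = translate (m + l) F" for l m F
    unfolding translate_def image_image by (simp add: add.assoc)
  have t0: "translate 0 F = F" for F unfolding translate_def by simp
  show "equiv tessellation_faces (lattice_equiv s t)"
  proof (rule equivI)
    show "lattice_equiv s t \<subseteq> tessellation_faces \<times> tessellation_faces" unfolding lattice_equiv_def by auto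
    show "refl_on tessellation_faces (lattice_equiv s t)"
    proof (rule refl_onI)
      fix F assume F: "F \<in> tessellation_faces"
      have "F = translate 0 F" by (rule t0[symmetric])
      then show "(F, F) \<in> lattice_equiv s t"
        unfolding iff by (intro conjI bexI[of _ 0] lattice_zero F)
    qed
    show "sym (lattice_equiv s t)"
    proof (rule symI)
      fix F K assume "(F, K) \<in> lattice_equiv s t"
      then obtain l where l: "F \<in> tessellation_faces" "l \<in> \<Lambda>" "K = translate l F" unfolding iff by blast
      have "translate (- l) K = translate 0 F" unfolding l(3) tt by simp
      then have "F = translate (- l) K" unfolding t0 by (rule sym)
      moreover have "K \<in> tessellation_faces" unfolding l(3) by (rule tr[OF l(1)])
      ultimately show "(K, F) \<in> lattice_equiv s t"
        unfolding iff by (intro conjI bexI[of _ "- l"] lattice_uminus[OF l(2)])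
    qed
    show "trans (lattice_equiv s t)"
    proof (rule transI)
      fix F K M assume FK: "(F, K) \<in> lattice_equiv s t" and KM: "(K, M) \<in> lattice_equiv s t"
      obtain l where l: "F \<in> tessellation_faces" "l \<in> \<Lambda>" "K = translate l F" using FK unfolding iff by blast
      obtain m where m: "m \<in> \<Lambda>" "M = translate m K" using KM unfolding iff by blast
      have "M = translate (l + m) F" unfolding m(2) l(3) tt ..
      then show "(F, M) \<in> lattice_equiv s t"
        unfolding iff by (intro conjI bexI[of _ "l + m"] lattice_add[OF l(2) m(1)] l(1))
    qed
  qed
qed

text \<open>A face of the torus map, as in \<^const>\<open>torus_map\<close>: the class of a face of the tessellation.\<close>

definition orbit_face :: "aff \<Rightarrow> int \<Rightarrow> (int \<times> int) set set" where
  "orbit_face g k = lattice_equiv s t `` {tface g k}"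

lemma orbit_face_mem: "k \<in> {-1..3} \<Longrightarrow> F \<in> orbit_face g k \<longleftrightarrow> (\<exists>l\<in>\<Lambda>. F = translate l (tface g k))"
  unfolding orbit_face_def using lattice_equiv_iff tface_face by simp

lemma orbit_face_rd:
  assumes "k \<in> {-1..3}" "l \<in> \<Lambda>"
  shows "orbit_face (fst g + l, snd g) k = orbit_face g k"
proof -
  have "(tface g k, tface (fst g + l, snd g) k) \<in> lattice_equiv s t"
    unfolding lattice_equiv_iff using tface_face[OF assms(1)] assms(2) translate_tface by metis
  then show ?thesis unfolding orbit_face_def using equiv_class_eq[OF equiv_lattice] by metis
qed

lemma tface_orbit: "\<exists>h\<in>carrier \<Gamma>. \<forall>k\<in>{-1..3}. orbit_face g k = orbit_face h k"
proof -
  let ?h = "(rd (fst g), snd g)"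
  have "- (fst g - rd (fst g)) \<in> \<Lambda>" by (rule lattice_uminus[OF rd_lattice])
  then have "orbit_face (fst g + - (fst g - rd (fst g)), snd g) k = orbit_face g k" if "k \<in> {-1..3}" for k
    using orbit_face_rd that by blast
  moreover have "?h \<in> carrier \<Gamma>" unfolding carrier_\<Gamma> using rd_in by simp
  ultimately show ?thesis by (intro bexI[of _ ?h]) auto
qed

text \<open>All members of a class have equally many vertices, and this number determines the rank; the least and
the greatest face are treated first because the cardinality of an infinite set is 0 by convention.\<close>

definition orbit_rank :: "(int \<times> int) set set \<Rightarrow> int" where
  "orbit_rank C = (let F = (SOME F. F \<in> C) in
     if F = {} then -1 else if F = UNIV then 3 else if card F = 1 then 0 else if card F = 2 then 1 else 2)"

lemma orbit_rank: assumes k: "k \<in> {-1..3}" shows "orbit_rank (orbit_face g k) = k"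
proof -
  define F where "F = (SOME F. F \<in> orbit_face g k)"
  have "translate 0 (tface g k) \<in> orbit_face g k" unfolding orbit_face_mem[OF k] using lattice_zero by blast
  then have "F \<in> orbit_face g k" unfolding F_def by (rule someI)
  then obtain l where l: "F = translate l (tface g k)" unfolding orbit_face_mem[OF k] by blast
  have c: "card F = card (base k)" unfolding l card_translate card_tface ..
  have inf: "\<not> finite (UNIV :: (int \<times> int) set)" by (simp add: finite_prod)
  have cards: "card (base 0) = 1" "card (base 1) = 2" "card (base 2) = 4" by (auto simp: base_simps)
  have u: "card (UNIV :: (int \<times> int) set) = 0" using inf by simp
  consider "k = -1" | "k = 3" | "k = 0" | "k = 1" | "k = 2" using rank_cases[OF k] by blast
  then have "(if F = {} then -1 else if F = UNIV then 3 else if card F = 1 then 0 else if card F = 2 then 1 else 2) = k"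
  proof cases
    case 1 then show ?thesis unfolding l by (simp add: tface_simps translate_def)
  next
    case 2
    then have "F = UNIV" unfolding l by (simp add: tface_simps translate_def)
    then show ?thesis using 2 by simp
  qed (use c cards u in auto)
  then show ?thesis unfolding orbit_rank_def F_def Let_def .
qed

interpretation \<Gamma>: group \<Gamma> by (rule group_\<Gamma>)

text \<open>Composing with \<open>inv g\<close> reduces this to the question when an isometry \<open>w\<close> moves a base face to a lattice
translate of itself. Since \<open>w\<close> is in normal form and lattice vectors are large, it then stabilises
the base face.\<close>

lemma orbit_face_eq:
  assumes g: "g \<in> carrier \<Gamma>" and h: "h \<in> carrier \<Gamma>" and k: "k \<in> {-1..3}"
  shows "orbit_face g k = orbit_face h k \<longleftrightarrow> inv\<^bsub>\<Gamma>\<^esub> g \<otimes>\<^bsub>\<Gamma>\<^esub> h \<in> gen {l. l < 3 \<and> int l \<noteq> k}"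
proof -
  define w where "w = inv\<^bsub>\<Gamma>\<^esub> g \<otimes>\<^bsub>\<Gamma>\<^esub> h"
  have w: "w \<in> carrier \<Gamma>" and hw: "h = g \<otimes>\<^bsub>\<Gamma>\<^esub> w" unfolding w_def using g h by (auto simp: \<Gamma>.m_assoc[symmetric])
  define z where "z = fst g + act (snd g) (fst w)"
  define l0 where "l0 = rd z - z"
  have l0: "l0 \<in> \<Lambda>" unfolding l0_def using lattice_uminus[OF rd_lattice[of z]] by simp
  obtain v A where gv: "g = (v, A)" by (cases g) auto
  obtain v' A' where wv: "w = (v', A')" by (cases w) auto
  have "app h x = app g (app w x) + l0" for x
    unfolding hw mult_\<Gamma> l0_def z_def gv wv by (simp add: act_mult act_add algebra_simps del: d4_mult.simps)
  then have th: "tface h k = translate l0 (app g ` tface w k)"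
    unfolding tface_def translate_def image_image by simp
  have "orbit_face g k = orbit_face h k \<longleftrightarrow> (tface g k, tface h k) \<in> lattice_equiv s t"
    unfolding orbit_face_def by (rule eq_equiv_class_iff[OF equiv_lattice]) (use tface_face k in auto)
  also have "\<dots> \<longleftrightarrow> (\<exists>l\<in>\<Lambda>. tface h k = translate l (tface g k))"
    unfolding lattice_equiv_iff using tface_face[OF k] by blast
  also have "\<dots> \<longleftrightarrow> (\<exists>l\<in>\<Lambda>. tface w k = translate l (base k))"
  proof
    assume "\<exists>l\<in>\<Lambda>. tface h k = translate l (tface g k)"
    then obtain l where l1: "l \<in> \<Lambda>" "tface h k = translate l (tface g k)" by blast
    then have l: "l \<in> \<Lambda>" "translate l0 (app g ` tface w k) = translate l (app g ` base k)"
      unfolding th tface_def[of g] by simp_all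
    obtain B where B: "\<And>z. act (snd g) (act B z) = z" using act_right_inverse[of "snd g"] by blast
    have "app g ` tface w k = translate (- l0) (translate l0 (app g ` tface w k))"
      unfolding translate_def image_image by simp
    also have "\<dots> = translate (l - l0) (app g ` base k)"
      unfolding l(2) unfolding translate_def image_image by (simp add: algebra_simps)
    also have "\<dots> = app g ` translate (act B (l - l0)) (base k)" unfolding app_translate B ..
    finally have "tface w k = translate (act B (l - l0)) (base k)" using inj_image_eq_iff[OF app_inj] by blast
    moreover have "act B (l - l0) \<in> \<Lambda>" using l l0 lattice_act lattice_diff by blast
    ultimately show "\<exists>l\<in>\<Lambda>. tface w k = translate l (base k)" by blast
  next
    assume "\<exists>l\<in>\<Lambda>. tface w k = translate l (base k)"
    then obtain l where l: "l \<in> \<Lambda>" "tface w k = translate l (base k)" by blast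
    have "tface h k = translate (act (snd g) l + l0) (tface g k)"
      unfolding th l(2) app_translate unfolding tface_def translate_def image_image by (simp add: add.assoc)
    moreover have "act (snd g) l + l0 \<in> \<Lambda>" using l l0 lattice_act lattice_add by blast
    ultimately show "\<exists>l\<in>\<Lambda>. tface h k = translate l (tface g k)" by blast
  qed
  also have "\<dots> \<longleftrightarrow> w \<in> gen {l. l < 3 \<and> int l \<noteq> k}"
  proof (cases "k = -1 \<or> k = 3")
    case True
    have "{l. l < 3 \<and> int l \<noteq> k} = {..<3 :: nat}" using True by auto
    then have "w \<in> gen {l. l < 3 \<and> int l \<noteq> k}" using gen_full w by simp
    moreover have "tface w k = translate 0 (base k)" using True by (auto simp: tface_simps base_simps translate_def)
    ultimately show ?thesis using lattice_zero by blast
  next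
    case False
    then obtain m where m: "k = int m" "m \<in> {0, 1, 2 :: nat}" using rank_cases[OF k] by (auto intro: that[of 0] that[of 1] that[of 2])
    have m3: "m < 3" using m(2) by auto
    have set: "{l. l < 3 \<and> int l \<noteq> k} = {..<3} - {m}" unfolding m(1) by auto
    show ?thesis
    proof
      assume "\<exists>l\<in>\<Lambda>. tface w k = translate l (base k)"
      then obtain l where l: "l \<in> \<Lambda>" "tface w k = translate l (base k)" by blast
      obtain u v A where wu: "w = ((u, v), A)" by (metis prod.exhaust)
      have st: "((u - fst l, v - snd l), A) \<in> stab m" using tface_eq_base[OF m(2)] l(2) unfolding wu m(1) by blast
      have sm: "rd (u - fst l, v - snd l) = (u - fst l, v - snd l)"
        using st m(2) unfolding stab.simps by (auto split: if_splits)
      have "rd (u, v) = rd (u - fst l, v - snd l)" by (rule rd_cong) (use l(1) in simp)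
      moreover have "rd (u, v) = (u, v)" using rd_id w unfolding carrier_\<Gamma> wu by simp
      ultimately have wm: "w \<in> stab m" using sm st wu by simp
      show "w \<in> gen {l. l < 3 \<and> int l \<noteq> k}" unfolding set by (rule stab_gen_pair[OF m3 wm])
    next
      assume "w \<in> gen {l. l < 3 \<and> int l \<noteq> k}"
      then have "w \<in> stab m" unfolding set using gen_stab[of m "{..<3} - {m}" w] m3 by blast
      then have "tface w k = translate 0 (base k)" using stab_tface[OF m(2)] unfolding m(1) translate_def by simp
      then show "\<exists>l\<in>\<Lambda>. tface w k = translate l (base k)" using lattice_zero by blast
    qed
  qed
  finally show ?thesis unfolding w_def .
qed

lemma torus_map_flag_rel: "torus_map s t = flag_rel (carrier \<Gamma>) orbit_face 3"
proof (intro equalityI subsetI)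
  fix P assume "P \<in> torus_map s t"
  then obtain U V F K where P: "P = (U, V)" and U: "U \<in> tessellation_faces // lattice_equiv s t"
    and V: "V \<in> tessellation_faces // lattice_equiv s t" and F: "F \<in> U" and K: "K \<in> V"
    and FK: "(F, K) \<in> square_tessellation"
    unfolding torus_map_def relation_of_def by auto
  have fk: "F \<in> tessellation_faces" "K \<in> tessellation_faces" "F \<subseteq> K"
    using FK unfolding square_tessellation_def relation_of_def by auto
  obtain g i j where g: "-1 \<le> i" "i \<le> j" "j \<le> 3" "F = tface g i" "K = tface g j"
    using incident_faces[OF fk] by blast
  have cls: "C = lattice_equiv s t `` {E}" if "C \<in> tessellation_faces // lattice_equiv s t" "E \<in> C" for C E
    using that equiv_lattice by (metis Image_singleton_iff equiv_class_eq quotientE)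
  have "U = orbit_face g i" "V = orbit_face g j" using cls[OF U F] cls[OF V K] g unfolding orbit_face_def by auto
  moreover obtain h where "h \<in> carrier \<Gamma>" "\<forall>k\<in>{-1..3}. orbit_face g k = orbit_face h k"
    using tface_orbit[of g] by blast
  ultimately show "P \<in> flag_rel (carrier \<Gamma>) orbit_face 3"
    using g(1-3) unfolding P flag_rel_def by (intro CollectI exI[of _ h] exI[of _ i] exI[of _ j]) auto
next
  fix P assume "P \<in> flag_rel (carrier \<Gamma>) orbit_face 3"
  then obtain g i j where P: "P = (orbit_face g i, orbit_face g j)" and ij: "-1 \<le> i" "i \<le> j" "j \<le> 3"
    unfolding flag_rel_def by blast
  have k: "i \<in> {-1..3}" "j \<in> {-1..3}" using ij by auto
  have "(tface g i, tface g j) \<in> square_tessellation"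
    unfolding square_tessellation_def relation_of_def
    using tface_face[OF k(1), of g] tface_face[OF k(2), of g] tface_mono[OF ij(2) k, of g] by blast
  moreover have "tface g i \<in> orbit_face g i" "tface g j \<in> orbit_face g j"
    unfolding orbit_face_def by (intro equiv_class_self[OF equiv_lattice] tface_face k)+
  moreover have "orbit_face g i \<in> tessellation_faces // lattice_equiv s t" "orbit_face g j \<in> tessellation_faces // lattice_equiv s t"
    unfolding orbit_face_def by (intro quotientI tface_face k)+
  ultimately show "P \<in> torus_map s t" unfolding P torus_map_def relation_of_def by blast
qed

end

text \<open>The symmetries of the unit square, as isometries of the tessellation.\<close>

fun square_sym :: "d4 \<Rightarrow> aff" where
  "square_sym (a, b, p) = ((of_bool a, of_bool b), (a, b, p))"

lemma square_sym_mult: "app (square_sym (d4_mult x y)) z = app (square_sym x) (app (square_sym y) z)"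
proof -
  obtain a b p where x: "x = (a, b, p)" by (cases x) auto
  obtain c e q where y: "y = (c, e, q)" by (cases y) auto
  obtain u v where z: "z = (u, v)" by (cases z) auto
  show ?thesis unfolding x y z by (cases a; cases b; cases p; cases c; cases e; cases q) auto
qed

lemma square_sym_stab: "square_sym x \<in> stab 2"
  by (cases x) (auto simp: stab.simps)

lemma square_face_eq:
  assumes k: "k \<in> {-1..2}"
  shows "tface (square_sym x) k = tface (square_sym y) k \<longleftrightarrow>
    inv\<^bsub>D4\<^esub> x \<otimes>\<^bsub>D4\<^esub> y \<in> generate D4 (dgen ` {l. l < 2 \<and> int l \<noteq> k})"
proof -
  interpret D: group D4 by (rule group_D4)
  define w where "w = inv\<^bsub>D4\<^esub> x \<otimes>\<^bsub>D4\<^esub> y"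
  have y: "y = d4_mult x w" unfolding w_def using D.m_assoc[of x "inv\<^bsub>D4\<^esub> x" y] D.r_inv[of x] D.l_one[of y] by (simp del: d4_mult.simps)
  have "tface (square_sym y) k = app (square_sym x) ` tface (square_sym w) k"
    unfolding y tface_def square_sym_mult image_image ..
  then have "tface (square_sym x) k = tface (square_sym y) k \<longleftrightarrow> tface (square_sym w) k = base k"
    unfolding tface_def[of "square_sym x"] using inj_image_eq_iff[OF app_inj] by metis
  also have "\<dots> \<longleftrightarrow> w \<in> generate D4 (dgen ` {l. l < 2 \<and> int l \<noteq> k})"
  proof -
    obtain a b p where w: "w = (a, b, p)" by (cases w) auto
    have branch: "dgen l \<in> generate D4 (dgen ` I)" if "l \<in> I" for l I using that by (intro generate.incl imageI)
    have one: "(False, False, False) \<in> generate D4 (dgen ` I)" for I using generate.one[of D4] by simp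
    have inv: "inv\<^bsub>D4\<^esub> (dgen l) = dgen l" for l
      by (rule D.inv_equality) (auto simp: dgen_def)
    have only: "z = (False, False, False) \<or> z = dgen l" if "z \<in> generate D4 (dgen ` {l})" for z l
      using that
    proof (induction rule: generate.induct)
      case (eng g h) then show ?case by (auto simp: dgen_def)
    qed (use inv in auto)
    have full: "z \<in> generate D4 (dgen ` {0, 1})" for z
    proof -
      have s0: "d4_mult (dgen 0) z \<in> generate D4 (dgen ` {0, 1})" "d4_mult (dgen 1) z \<in> generate D4 (dgen ` {0, 1})"
        if "z \<in> generate D4 (dgen ` {0, 1})" for z
        using generate.eng[OF branch[of 0 "{0, 1}"] that] generate.eng[OF branch[of 1 "{0, 1}"] that] by auto
      have s: "(\<not> a, b, p) \<in> generate D4 (dgen ` {0, 1})" "(b, a, \<not> p) \<in> generate D4 (dgen ` {0, 1})"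
        if "(a, b, p) \<in> generate D4 (dgen ` {0, 1})" for a b p
        using s0[OF that] unfolding dgen_def by auto
      have 1: "(False, False, p) \<in> generate D4 (dgen ` {0, 1})" for p
        using one[of "{0, 1}"] s(2)[OF one[of "{0, 1}"]] by (cases p) simp_all
      have 2: "(a, False, p) \<in> generate D4 (dgen ` {0, 1})" for a p
        using 1[of p] s(1)[OF 1[of p]] by (cases a) simp_all
      have 3: "(False, b, p) \<in> generate D4 (dgen ` {0, 1})" for b p
        using s(2)[OF 2[of b "\<not> p"]] by simp
      have "(a, b, p) \<in> generate D4 (dgen ` {0, 1})" for a b p
        using 3[of b p] s(1)[OF 3[of b p]] by (cases a) simp_all
      then show ?thesis by (cases z) auto
    qed
    have "k = -1 \<or> k = 0 \<or> k = 1 \<or> k = 2" using k by auto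
    then consider "k = -1" | "k = 2" | "k = 0" | "k = 1" by blast
    then show ?thesis
    proof cases
      case 1
      have "{l. l < 2 \<and> int l \<noteq> k} = {0, 1 :: nat}" unfolding 1 by auto
      then show ?thesis using full[of w] 1 by (simp add: tface_simps base_simps)
    next
      case 2
      have "{l. l < 2 \<and> int l \<noteq> k} = {0, 1 :: nat}" unfolding 2 by auto
      then show ?thesis using full[of w] 2 stab_tface[of 2 "square_sym w"] square_sym_stab[of w] by simp
    next
      case 3
      have s: "{l. l < 2 \<and> int l \<noteq> k} = {1 :: nat}" unfolding 3 by auto
      have "tface (square_sym w) k = base k \<longleftrightarrow> \<not> a \<and> \<not> b"
        unfolding 3 w by (auto simp: tface_simps base_simps)
      also have "\<dots> \<longleftrightarrow> w = (False, False, False) \<or> w = dgen 1" unfolding w dgen_def by auto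
      also have "\<dots> \<longleftrightarrow> w \<in> generate D4 (dgen ` {1})" using only[of w 1] one branch[of 1 "{1}"] by blast
      finally show ?thesis unfolding s .
    next
      case 4
      have s: "{l. l < 2 \<and> int l \<noteq> k} = {0 :: nat}" unfolding 4 by auto
      have "tface (square_sym w) k = base k \<longleftrightarrow> \<not> p \<and> \<not> b"
        unfolding 4 w by (cases a; cases b; cases p) (auto simp: tface_simps base_simps unit_sign_def doubleton_eq_iff)
      also have "\<dots> \<longleftrightarrow> w = (False, False, False) \<or> w = dgen 0" unfolding w dgen_def by auto
      also have "\<dots> \<longleftrightarrow> w \<in> generate D4 (dgen ` {0})" using only[of w 0] one branch[of 0 "{0}"] by blast
      finally show ?thesis unfolding s .
    qed
  qed
  finally show ?thesis unfolding w_def .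
qed

text \<open>A flag of a face contained in the unit square is moved so that its square is the unit square, without
changing the given face.\<close>

lemma four_gon_flag_rel: "four_gon = flag_rel UNIV (\<lambda>x. tface (square_sym x)) 2"
proof (intro equalityI subsetI)
  have u: "unit_square 0 0 = base 2" unfolding unit_square_def base_simps by auto
  have uf: "base 2 \<in> tessellation_faces" unfolding tessellation_faces_def u[symmetric] by auto
  fix P assume "P \<in> four_gon"
  then obtain F K where P: "P = (F, K)" and FK: "(F, K) \<in> square_tessellation" and Ku: "K \<subseteq> base 2"
    unfolding four_gon_def face_poset_def under_def u square_tessellation_def relation_of_def by auto
  have fk: "F \<in> tessellation_faces" "K \<in> tessellation_faces" "F \<subseteq> K"
    using FK unfolding square_tessellation_def relation_of_def by auto
  obtain g i j where g: "-1 \<le> i" "i \<le> j" "j \<le> 3" "F = tface g i" "K = tface g j"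
    using incident_faces[OF fk] by blast
  obtain m n a b p where gm: "g = ((m, n), (a, b, p))" by (metis prod.exhaust)
  have "\<exists>x. \<forall>k\<in>{-1..j}. tface (square_sym x) k = tface g k"
  proof -
    have jne: "j \<noteq> 3"
    proof
      assume "j = 3"
      then have "(5, 5) \<in> base 2" using Ku unfolding g(5) by (auto simp: tface_simps)
      then show False by (auto simp: base_simps)
    qed
    have "j = -1 \<or> j = 0 \<or> j = 1 \<or> j = 2" using g(1-3) jne by auto
    then consider "j = -1" | "j = 0" | "j = 1" | "j = 2" by blast
    then show ?thesis
    proof cases
      case 1
      then have "k = -1" if "k \<in> {-1..j}" for k using that by simp
      moreover have "tface (square_sym x) (-1) = tface g (-1)" for x unfolding tface_simps(1) ..
      ultimately show ?thesis by metis
    next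
      case 2
      then have "m \<in> {0, 1} \<and> n \<in> {0, 1}" using Ku unfolding g(5) gm by (auto simp: tface_simps base_simps)
      then have "tface (square_sym (m = 1, n = 1, p)) 0 = tface g 0" unfolding gm by (auto simp: tface_simps)
      moreover have "tface (square_sym (m = 1, n = 1, p)) (-1) = tface g (-1)" unfolding tface_simps(1) ..
      moreover have "k = -1 \<or> k = 0" if "k \<in> {-1..j}" for k using that 2 by auto
      ultimately show ?thesis by metis
    next
      case 3
      let ?x = "(if p then (m = 1, b, p) else (a, n = 1, p))"
      have "square_sym ?x = ((m, n), ?x)"
        using Ku 3 unfolding g(5) gm by (cases p; cases a; cases b) (auto simp: tface_simps base_simps unit_sign_def)
      then have "tface (square_sym ?x) 0 = tface g 0" "tface (square_sym ?x) 1 = tface g 1"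
        unfolding gm by (auto simp: tface_simps)
      moreover have "tface (square_sym ?x) (-1) = tface g (-1)" unfolding tface_simps(1) ..
      moreover have "k = -1 \<or> k = 0 \<or> k = 1" if "k \<in> {-1..j}" for k using that 3 by auto
      ultimately show ?thesis by metis
    next
      case 4
      have "{m, m + unit_sign a} \<times> {n, n + unit_sign b} \<subseteq> {0, 1} \<times> {0, 1}"
        using Ku 4 unfolding g(5) gm by (auto simp: tface_simps base_simps)
      then have "m = of_bool a \<and> n = of_bool b" unfolding unit_sign_def by (cases a; cases b) auto
      then have "square_sym (a, b, p) = g" unfolding gm by simp
      then show ?thesis by metis
    qed
  qed
  then obtain x where x: "\<forall>k\<in>{-1..j}. tface (square_sym x) k = tface g k" by blast
  have "j \<le> 2"
  proof (rule ccontr)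
    assume "\<not> j \<le> 2"
    then have "j = 3" using g by simp
    then have "(5, 5) \<in> base 2" using Ku unfolding g(5) by (auto simp: tface_simps)
    then show False by (auto simp: base_simps)
  qed
  moreover have "F = tface (square_sym x) i" "K = tface (square_sym x) j" using x g by auto
  ultimately show "P \<in> flag_rel UNIV (\<lambda>x. tface (square_sym x)) 2"
    unfolding P flag_rel_def using g by (intro CollectI exI[of _ x] exI[of _ i] exI[of _ j]) auto
next
  have u: "unit_square 0 0 = base 2" unfolding unit_square_def base_simps by auto
  fix P assume "P \<in> flag_rel UNIV (\<lambda>x. tface (square_sym x)) 2"
  then obtain x i j where P: "P = (tface (square_sym x) i, tface (square_sym x) j)" and ij: "-1 \<le> i" "i \<le> j" "j \<le> 2"
    unfolding flag_rel_def by blast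
  let ?f = "tface (square_sym x)"
  have f2: "?f 2 = base 2" using stab_tface[of 2 "square_sym x"] square_sym_stab[of x] by simp
  have "?f i \<in> tessellation_faces" "?f j \<in> tessellation_faces" "?f 2 \<in> tessellation_faces"
    using tface_face ij by auto
  moreover have "?f i \<subseteq> ?f j" "?f i \<subseteq> ?f 2" "?f j \<subseteq> ?f 2" using tface_mono ij by auto
  ultimately show "P \<in> four_gon"
    unfolding P four_gon_def face_poset_def under_def u square_tessellation_def relation_of_def f2 by auto
qed

definition square_rank :: "(int \<times> int) set \<Rightarrow> int" where
  "square_rank F = (if card F = 0 then -1 else if card F = 1 then 0 else if card F = 2 then 1 else 2)"

lemma square_rank:
  assumes "k \<in> {-1..2}" shows "square_rank (tface g k) = k"
proof -
  have b: "card (base (-1)) = 0" "card (base 0) = 1" "card (base 1) = 2" "card (base 2) = 4"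
    by (simp_all add: base_simps)
  have "k = -1 \<or> k = 0 \<or> k = 1 \<or> k = 2" using assms by auto
  then consider "k = -1" | "k = 0" | "k = 1" | "k = 2" by blast
  then show ?thesis unfolding square_rank_def card_tface by cases (simp_all only: b, simp_all)
qed

section \<open>Fibre products over the group of the square\<close>

declare proj_left.simps proj_right.simps d4_mult.simps [simp del]

text \<open>Elements of iterated fibre products. One type is needed for all stages of the induction, so a
component is added by a constructor rather than by forming pairs.\<close>

datatype el = Sq d4 | Ext el aff

primrec core :: "el \<Rightarrow> el" where
  "core (Sq x) = Sq x"
| "core (Ext g \<gamma>) = g"

primrec leaf :: "el \<Rightarrow> aff" where
  "leaf (Sq x) = ((0, 0), x)"
| "leaf (Ext g \<gamma>) = \<gamma>"

definition fibre_prod :: "el monoid \<Rightarrow> (el \<Rightarrow> d4) \<Rightarrow> aff monoid \<Rightarrow> el monoid" where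
  "fibre_prod G \<sigma> T = \<lparr>carrier = {Ext g \<gamma> | g \<gamma>. g \<in> carrier G \<and> \<gamma> \<in> carrier T \<and> \<sigma> g = proj_left \<gamma>},
     monoid.mult = (\<lambda>x y. Ext (core x \<otimes>\<^bsub>G\<^esub> core y) (leaf x \<otimes>\<^bsub>T\<^esub> leaf y)),
     one = Ext \<one>\<^bsub>G\<^esub> \<one>\<^bsub>T\<^esub>\<rparr>"

text \<open>The component in the new factor of an old generator: \<open>\<rho> a\<close> and \<open>\<rho> b\<close> become the first two generators of
the toroidal polyhedron, every other one becomes trivial (which is \<open>tgen 3\<close>).\<close>

definition local_gen :: "nat \<Rightarrow> nat \<Rightarrow> nat \<Rightarrow> aff" where
  "local_gen a b i = tgen (if i = a then 0 else if i = b then 1 else 3)"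

definition fibre_gen :: "el monoid \<Rightarrow> nat \<Rightarrow> nat \<Rightarrow> nat \<Rightarrow> (nat \<Rightarrow> el) \<Rightarrow> nat \<Rightarrow> el" where
  "fibre_gen G N a b \<rho> i = (if i = N then Ext \<one>\<^bsub>G\<^esub> (tgen 2) else Ext (\<rho> i) (local_gen a b i))"

text \<open>The hypotheses under which a toroidal polyhedron can be glued on: the homomorphism \<open>\<sigma>\<close> to the group of
the square identifies the subgroup of \<open>\<rho> a\<close> and \<open>\<rho> b\<close> with it and kills all other generators.
Geometrically \<open>\<sigma>\<close> colours the faces of a polytope by the faces of a square.\<close>

locale square_coloured = group G for G :: "el monoid" (structure) +
  fixes N a b :: nat and \<rho> :: "nat \<Rightarrow> el" and \<sigma> :: "el \<Rightarrow> d4"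
  assumes finite_carrier: "finite (carrier G)"
    and gen_closed: "i < N \<Longrightarrow> \<rho> i \<in> carrier G"
    and invol: "i < N \<Longrightarrow> \<rho> i \<otimes> \<rho> i = \<one>"
    and nontrivial: "i < N \<Longrightarrow> \<rho> i \<noteq> \<one>"
    and generates: "generate G (\<rho> ` {..<N}) = carrier G"
    and intersection: "I \<subseteq> {..<N} \<Longrightarrow> J \<subseteq> {..<N} \<Longrightarrow>
      generate G (\<rho> ` I) \<inter> generate G (\<rho> ` J) \<subseteq> generate G (\<rho> ` (I \<inter> J))"
    and colour_hom: "\<sigma> \<in> hom G D4"
    and colour_indices: "a < N" "b < N" "a \<noteq> b"
    and colour_gens: "\<sigma> (\<rho> a) = dgen 0" "\<sigma> (\<rho> b) = dgen 1"
      "i < N \<Longrightarrow> i \<noteq> a \<Longrightarrow> i \<noteq> b \<Longrightarrow> \<sigma> (\<rho> i) = \<one>\<^bsub>D4\<^esub>"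
    and colour_inj: "g \<in> generate G (\<rho> ` {a, b}) \<Longrightarrow> \<sigma> g = \<one>\<^bsub>D4\<^esub> \<Longrightarrow> g = \<one>"

text \<open>Three generators of \<open>G\<close> span a copy of the toroidal group \<open>T\<close>, by restriction of a homomorphism that is
defined on all of \<open>G\<close>.\<close>

definition leaf_model :: "el monoid \<Rightarrow> (nat \<Rightarrow> el) \<Rightarrow> (nat \<Rightarrow> nat) \<Rightarrow> aff monoid \<Rightarrow> bool" where
  "leaf_model G \<rho> f T \<longleftrightarrow> (\<exists>h \<in> hom G T. (\<forall>l<3. h (\<rho> (f l)) = tgen l) \<and>
     (\<forall>g \<in> generate G (\<rho> ` f ` {..<3}). h g = \<one>\<^bsub>T\<^esub> \<longrightarrow> g = \<one>\<^bsub>G\<^esub>))"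

locale amalgam = square_coloured + torus
begin

abbreviation "E \<equiv> fibre_prod G \<sigma> \<Gamma>"
abbreviation "\<rho>' \<equiv> fibre_gen G N a b \<rho>"
abbreviation "par I \<equiv> generate G (\<rho> ` I)"
abbreviation "par' I \<equiv> generate E (\<rho>' ` I)"

interpretation T: group \<Gamma> by (rule group_\<Gamma>)
interpretation D: group D4 by (rule group_D4)
interpretation \<sigma>: group_hom G D4 \<sigma>
  by (intro group_hom.intro group_hom_axioms.intro colour_hom is_group group_D4)
interpretation \<pi>: group_hom \<Gamma> D4 proj_left
  by (intro group_hom.intro group_hom_axioms.intro proj_hom group_\<Gamma> group_D4)

lemma Ext_mem:
  "Ext g \<gamma> \<in> carrier E \<longleftrightarrow> g \<in> carrier G \<and> \<gamma> \<in> carrier \<Gamma> \<and> \<sigma> g = proj_left \<gamma>"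
proof -
  have "carrier E = {Ext g \<gamma> | g \<gamma>. g \<in> carrier G \<and> \<gamma> \<in> carrier \<Gamma> \<and> \<sigma> g = proj_left \<gamma>}"
    unfolding fibre_prod_def by (simp only: partial_object.simps)
  then show ?thesis by blast
qed

lemma E_simps:
  "Ext g \<gamma> \<in> carrier E \<longleftrightarrow> g \<in> carrier G \<and> \<gamma> \<in> carrier \<Gamma> \<and> \<sigma> g = proj_left \<gamma>"
  "x \<otimes>\<^bsub>E\<^esub> y = Ext (core x \<otimes> core y) (leaf x \<otimes>\<^bsub>\<Gamma>\<^esub> leaf y)"
  "\<one>\<^bsub>E\<^esub> = Ext \<one> \<one>\<^bsub>\<Gamma>\<^esub>"
  by (rule Ext_mem) (simp_all add: fibre_prod_def)

lemma E_elim: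
  assumes "x \<in> carrier E"
  obtains g \<gamma> where "x = Ext g \<gamma>" "g \<in> carrier G" "\<gamma> \<in> carrier \<Gamma>" "\<sigma> g = proj_left \<gamma>"
proof -
  have "x \<in> {Ext g \<gamma> | g \<gamma>. g \<in> carrier G \<and> \<gamma> \<in> carrier \<Gamma> \<and> \<sigma> g = proj_left \<gamma>}"
    using assms unfolding fibre_prod_def by (simp only: partial_object.simps)
  then show thesis using that by blast
qed

lemma group_E: "group E"
proof (rule groupI)
  show "x \<otimes>\<^bsub>E\<^esub> y \<in> carrier E" if x: "x \<in> carrier E" and y: "y \<in> carrier E" for x y
  proof -
    obtain g \<gamma> where g: "x = Ext g \<gamma>" "g \<in> carrier G" "\<gamma> \<in> carrier \<Gamma>" "\<sigma> g = proj_left \<gamma>" using x by (rule E_elim)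
    obtain h \<delta> where h: "y = Ext h \<delta>" "h \<in> carrier G" "\<delta> \<in> carrier \<Gamma>" "\<sigma> h = proj_left \<delta>" using y by (rule E_elim)
    have "\<sigma> (g \<otimes> h) = proj_left (\<gamma> \<otimes>\<^bsub>\<Gamma>\<^esub> \<delta>)"
      using \<sigma>.hom_mult[OF g(2) h(2)] \<pi>.hom_mult[OF g(3) h(3)] g(4) h(4) by simp
    then show ?thesis using g h by (simp add: E_simps)
  qed
  show "\<one>\<^bsub>E\<^esub> \<in> carrier E" unfolding E_simps using \<sigma>.hom_one \<pi>.hom_one by simp
  show "x \<otimes>\<^bsub>E\<^esub> y \<otimes>\<^bsub>E\<^esub> z = x \<otimes>\<^bsub>E\<^esub> (y \<otimes>\<^bsub>E\<^esub> z)"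
    if x: "x \<in> carrier E" and y: "y \<in> carrier E" and z: "z \<in> carrier E" for x y z
    using x y z by (elim E_elim) (simp add: E_simps m_assoc T.m_assoc)
  show "\<one>\<^bsub>E\<^esub> \<otimes>\<^bsub>E\<^esub> x = x" if x: "x \<in> carrier E" for x
    using x by (elim E_elim) (simp add: E_simps)
  show "\<exists>y\<in>carrier E. y \<otimes>\<^bsub>E\<^esub> x = \<one>\<^bsub>E\<^esub>" if x: "x \<in> carrier E" for x
  proof -
    obtain g \<gamma> where g: "x = Ext g \<gamma>" "g \<in> carrier G" "\<gamma> \<in> carrier \<Gamma>" "\<sigma> g = proj_left \<gamma>" using x by (rule E_elim)
    have "\<sigma> (inv g) = proj_left (inv\<^bsub>\<Gamma>\<^esub> \<gamma>)"
      using \<sigma>.hom_inv[OF g(2)] \<pi>.hom_inv[OF g(3)] g(4) by simp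
    then have "Ext (inv g) (inv\<^bsub>\<Gamma>\<^esub> \<gamma>) \<in> carrier E" using g E_simps(1) by simp
    moreover have "Ext (inv g) (inv\<^bsub>\<Gamma>\<^esub> \<gamma>) \<otimes>\<^bsub>E\<^esub> x = \<one>\<^bsub>E\<^esub>" using g by (simp add: E_simps)
    ultimately show ?thesis by blast
  qed
qed

interpretation E: group E by (rule group_E)

lemma hom_chain: "f \<in> hom A B \<Longrightarrow> g \<in> hom B C \<Longrightarrow> (\<lambda>x. g (f x)) \<in> hom A C"
  by (auto simp: hom_def Pi_iff)

lemma core_hom: "core \<in> hom E G" and leaf_hom: "leaf \<in> hom E \<Gamma>"
  unfolding hom_def by (auto elim!: E_elim simp: E_simps)

interpretation core: group_hom E G core
  by (intro group_hom.intro group_hom_axioms.intro core_hom is_group group_E)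
interpretation leaf: group_hom E \<Gamma> leaf
  by (intro group_hom.intro group_hom_axioms.intro leaf_hom group_\<Gamma> group_E)

lemma E_compat: "x \<in> carrier E \<Longrightarrow> \<sigma> (core x) = proj_left (leaf x)"
  by (elim E_elim) simp

lemma E_eta: "x \<in> carrier E \<Longrightarrow> x = Ext (core x) (leaf x)"
  by (elim E_elim) simp

lemma tgen_3: "tgen 3 = \<one>\<^bsub>\<Gamma>\<^esub>"
  unfolding tgen_def one_\<Gamma> by simp

lemma proj_tgen: "proj_left (tgen 0) = dgen 0" "proj_left (tgen 1) = dgen 1"
    "proj_left (tgen 2) = \<one>\<^bsub>D4\<^esub>" "proj_left (tgen 3) = \<one>\<^bsub>D4\<^esub>"
    "proj_right (tgen 0) = \<one>\<^bsub>D4\<^esub>" "proj_right (tgen 1) = dgen 0" "proj_right (tgen 2) = dgen 1"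
    "proj_right (tgen 3) = \<one>\<^bsub>D4\<^esub>"
  unfolding tgen_def dgen_def by (auto simp: proj_left.simps proj_right.simps)

lemma core_gen: "core (\<rho>' i) = (if i = N then \<one> else \<rho> i)"
  and leaf_gen: "leaf (\<rho>' i) = (if i = N then tgen 2 else local_gen a b i)"
  unfolding fibre_gen_def by auto

lemma gen'_carrier: assumes "i < Suc N" shows "\<rho>' i \<in> carrier E"
proof (cases "i = N")
  case True
  have "\<sigma> \<one> = proj_left (tgen 2)" using \<sigma>.hom_one proj_tgen(3) by simp
  then show ?thesis using True tgen_carrier[of 2] unfolding fibre_gen_def by (simp add: Ext_mem)
next
  case False
  then have i: "i < N" using assms by simp
  have "\<sigma> (\<rho> i) = proj_left (local_gen a b i)"
  proof -
    consider "i = a" | "i = b" "i \<noteq> a" | "i \<noteq> a" "i \<noteq> b" by blast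
    then show ?thesis
      by cases (simp_all only: local_gen_def colour_gens(1,2) colour_gens(3)[OF i] proj_tgen if_True if_False refl not_False_eq_True)
  qed
  then show ?thesis using False gen_closed[OF i] tgen_carrier
    unfolding fibre_gen_def local_gen_def by (simp add: Ext_mem)
qed

lemma gens'_sub: "I \<subseteq> {..<Suc N} \<Longrightarrow> \<rho>' ` I \<subseteq> carrier E"
  using gen'_carrier by auto

lemma gen'_invol: "i < Suc N \<Longrightarrow> \<rho>' i \<otimes>\<^bsub>E\<^esub> \<rho>' i = \<one>\<^bsub>E\<^esub>"
  unfolding E_simps core_gen leaf_gen local_gen_def using invol[of i] tgen_invol by auto

lemma gen'_nontrivial: "i < Suc N \<Longrightarrow> \<rho>' i \<noteq> \<one>\<^bsub>E\<^esub>"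
  unfolding E_simps fibre_gen_def using nontrivial[of i] tgen_2 by auto

lemma gen'_inv: "i < Suc N \<Longrightarrow> inv\<^bsub>E\<^esub> \<rho>' i = \<rho>' i"
  using E.inv_equality[OF gen'_invol gen'_carrier gen'_carrier] .

lemma tgen_triv_commute: "\<gamma> \<in> carrier \<Gamma> \<Longrightarrow> tgen 3 \<otimes>\<^bsub>\<Gamma>\<^esub> \<gamma> = \<gamma> \<otimes>\<^bsub>\<Gamma>\<^esub> tgen 3"
  unfolding tgen_3 by simp

lemma gen'_commute:
  assumes "i < N" "j < N" "\<rho> i \<otimes> \<rho> j = \<rho> j \<otimes> \<rho> i" "{i, j} \<noteq> {a, b}"
  shows "\<rho>' i \<otimes>\<^bsub>E\<^esub> \<rho>' j = \<rho>' j \<otimes>\<^bsub>E\<^esub> \<rho>' i"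
proof -
  have "local_gen a b i \<otimes>\<^bsub>\<Gamma>\<^esub> local_gen a b j = local_gen a b j \<otimes>\<^bsub>\<Gamma>\<^esub> local_gen a b i"
  proof -
    have cl: "local_gen a b k \<in> carrier \<Gamma>" for k unfolding local_gen_def by (rule tgen_carrier)
    have "i = j \<or> i \<notin> {a, b} \<or> j \<notin> {a, b}" using assms(4) by blast
    moreover have "local_gen a b k = tgen 3" if "k \<notin> {a, b}" for k using that unfolding local_gen_def by simp
    ultimately consider "i = j" | "local_gen a b i = tgen 3" | "local_gen a b j = tgen 3" by blast
    then show ?thesis
    proof cases
      case 1 then show ?thesis by simp
    next
      case 2 then show ?thesis using tgen_triv_commute[OF cl] by metis
    next
      case 3 then show ?thesis using tgen_triv_commute[OF cl] by metis
    qed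
  qed
  then show ?thesis unfolding E_simps core_gen leaf_gen using assms(1-3) by simp
qed

lemma gen'_commute_new:
  assumes "i < N" "i \<noteq> b" shows "\<rho>' i \<otimes>\<^bsub>E\<^esub> \<rho>' N = \<rho>' N \<otimes>\<^bsub>E\<^esub> \<rho>' i"
proof -
  have "local_gen a b i \<otimes>\<^bsub>\<Gamma>\<^esub> tgen 2 = tgen 2 \<otimes>\<^bsub>\<Gamma>\<^esub> local_gen a b i"
    using assms(2) tgen_triv_commute[OF tgen_carrier, of 2] tgen_commute unfolding local_gen_def
    by (cases "i = a") simp_all
  then show ?thesis unfolding E_simps core_gen leaf_gen using assms(1) gen_closed[OF assms(1)] by simp
qed

definition loc :: "nat set \<Rightarrow> nat set" where
  "loc I = {l. (l = 0 \<and> a \<in> I) \<or> (l = 1 \<and> b \<in> I) \<or> (l = 2 \<and> N \<in> I)}"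

lemma loc_sub: "loc I \<subseteq> {..<3}" unfolding loc_def by auto

lemma par'_bound:
  assumes I: "I \<subseteq> {..<Suc N}" and x: "x \<in> par' I"
  shows "x \<in> carrier E \<and> core x \<in> par (I \<inter> {..<N}) \<and> leaf x \<in> gen (loc I)"
proof -
  have g: "\<rho>' i \<in> carrier E \<and> core (\<rho>' i) \<in> par (I \<inter> {..<N}) \<and> leaf (\<rho>' i) \<in> gen (loc I)"
    if i: "i \<in> I" for i
  proof (intro conjI)
    show "\<rho>' i \<in> carrier E" using gen'_carrier i I by auto
    show "core (\<rho>' i) \<in> par (I \<inter> {..<N})"
    proof (cases "i = N")
      case False
      then have "i \<in> I \<inter> {..<N}" using i I by force
      then show ?thesis unfolding core_gen using False by (auto intro: generate.incl)
    qed (simp add: core_gen generate.one)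
    have lg: "tgen l \<in> gen (loc I)" if "l \<in> loc I" for l using that by (intro generate.incl imageI)
    show "leaf (\<rho>' i) \<in> gen (loc I)"
      using lg[of 0] lg[of 1] lg[of 2] i generate.one[of \<Gamma>] unfolding leaf_gen local_gen_def
      by (auto simp: loc_def tgen_3)
  qed
  from x show ?thesis
  proof (induction rule: generate.induct)
    case one
    then show ?case by (auto simp: E_simps(3) generate.one simp del: E.one_closed)
      (use E.one_closed E_simps(3) in simp)
  next
    case (incl h) then show ?case using g by blast
  next
    case (inv h)
    then obtain i where i: "i \<in> I" "h = \<rho>' i" by blast
    then have "inv\<^bsub>E\<^esub> h = \<rho>' i" using gen'_inv I by auto
    then show ?case using g[OF i(1)] by simp
  next
    case (eng h1 h2)
    then show ?case using core.hom_mult[of h1 h2] leaf.hom_mult[of h1 h2] generate.eng E.m_closed by metis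
  qed
qed

lemma core_par': "J \<subseteq> {..<N} \<Longrightarrow> core ` par' J = par J"
proof -
  assume J: "J \<subseteq> {..<N}"
  have "core ` \<rho>' ` J = \<rho> ` J" unfolding image_image core_gen using J by (intro image_cong) auto
  moreover have "\<rho>' ` J \<subseteq> carrier E" using gens'_sub[of J] J by force
  ultimately show ?thesis using core.generate_img by metis
qed

text \<open>The key to the intersection property. An element of the right-hand side is first multiplied by an
element of the parabolic subgroup that makes its old component trivial. What remains is a word in the
toroidal generators. The corresponding word in the generators of the fibre product has an old component
in \<open>\<langle>\<rho> a, \<rho> b\<rangle>\<close> with trivial colour, hence a trivial one.\<close>

lemma par'_iff:
  assumes I: "I \<subseteq> {..<Suc N}"
  shows "x \<in> par' I \<longleftrightarrow> x \<in> carrier E \<and> core x \<in> par (I \<inter> {..<N}) \<and> leaf x \<in> gen (loc I)"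
proof
  assume "x \<in> par' I" then show "x \<in> carrier E \<and> core x \<in> par (I \<inter> {..<N}) \<and> leaf x \<in> gen (loc I)"
    by (rule par'_bound[OF I])
next
  assume x: "x \<in> carrier E \<and> core x \<in> par (I \<inter> {..<N}) \<and> leaf x \<in> gen (loc I)"
  let ?J = "I \<inter> {..<N}"
  have "core x \<in> core ` par' ?J" unfolding core_par'[OF Int_lower2] using x by blast
  then obtain y where y: "core x = core y" "y \<in> par' ?J" by (rule imageE)
  have yI: "y \<in> par' I" using subsetD[OF E.mono_generate[OF image_mono[OF Int_lower1]] y(2)] .
  have yb: "y \<in> carrier E" "leaf y \<in> gen (loc I)" using par'_bound[OF I yI] by auto
  define z where "z = inv\<^bsub>E\<^esub> y \<otimes>\<^bsub>E\<^esub> x"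
  have z: "z \<in> carrier E" unfolding z_def using yb x by simp
  have cz: "core z = \<one>" unfolding z_def using core.hom_mult[of "inv\<^bsub>E\<^esub> y" x] core.hom_inv yb x y(1) core.hom_closed[OF yb(1)]
    by simp
  have lz: "leaf z \<in> gen (loc I)"
  proof -
    have e: "leaf z = inv\<^bsub>\<Gamma>\<^esub> (leaf y) \<otimes>\<^bsub>\<Gamma>\<^esub> leaf x"
      unfolding z_def using leaf.hom_mult[of "inv\<^bsub>E\<^esub> y" x] leaf.hom_inv yb x by simp
    show ?thesis unfolding e
      by (rule generate.eng[OF T.generate_m_inv_closed[OF gen_sub yb(2)]]) (use x in blast)
  qed
  let ?K = "I \<inter> {a, b, N}"
  have K: "?K \<subseteq> {..<Suc N}" using I by blast
  have "leaf ` \<rho>' ` ?K = tgen ` loc I"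
    unfolding image_image leaf_gen local_gen_def loc_def using colour_indices by (auto simp: image_iff)
  then have "leaf ` par' ?K = gen (loc I)" using leaf.generate_img[OF gens'_sub[OF K]] by simp
  then have "leaf z \<in> leaf ` par' ?K" using lz by blast
  then obtain w where w: "leaf z = leaf w" "w \<in> par' ?K" by (rule imageE)
  have wb: "w \<in> carrier E" "core w \<in> par (?K \<inter> {..<N})" using par'_bound[OF K w(2)] by auto
  have "?K \<inter> {..<N} \<subseteq> {a, b}" by auto
  then have "core w \<in> par {a, b}" using wb(2) mono_generate[OF image_mono] by blast
  moreover have "\<sigma> (core w) = \<one>\<^bsub>D4\<^esub>"
    using E_compat[OF wb(1)] E_compat[OF z] w(1) cz \<sigma>.hom_one by simp
  ultimately have "core w = \<one>" by (rule colour_inj)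
  then have "w = z" using E_eta[OF wb(1)] E_eta[OF z] w(1) cz by metis
  then have "z \<in> par' I" using subsetD[OF E.mono_generate[OF image_mono[OF Int_lower1]] w(2)] by simp
  moreover have "x = y \<otimes>\<^bsub>E\<^esub> z" unfolding z_def using yb x E.m_assoc[of y "inv\<^bsub>E\<^esub> y" x] by simp
  ultimately show "x \<in> par' I" using generate.eng[OF yI] by simp
qed

lemma loc_Int: "loc (I \<inter> J) = loc I \<inter> loc J"
  unfolding loc_def using colour_indices by auto

lemma par'_Int:
  assumes I: "I \<subseteq> {..<Suc N}" and J: "J \<subseteq> {..<Suc N}"
  shows "par' I \<inter> par' J \<subseteq> par' (I \<inter> J)"
proof
  fix x assume "x \<in> par' I \<inter> par' J"
  then have xI: "x \<in> par' I" and xJ: "x \<in> par' J" by simp_all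
  note bI = par'_bound[OF I xI] and bJ = par'_bound[OF J xJ]
  have "core x \<in> par ((I \<inter> {..<N}) \<inter> (J \<inter> {..<N}))"
    by (rule subsetD[OF intersection[OF Int_lower2 Int_lower2]]) (use bI bJ in simp)
  moreover have "(I \<inter> {..<N}) \<inter> (J \<inter> {..<N}) = (I \<inter> J) \<inter> {..<N}" by blast
  ultimately have c: "core x \<in> par ((I \<inter> J) \<inter> {..<N})" by simp
  have l: "leaf x \<in> gen (loc (I \<inter> J))"
    unfolding loc_Int by (rule subsetD[OF gen_Int[OF loc_sub loc_sub]]) (use bI bJ in simp)
  have "I \<inter> J \<subseteq> {..<Suc N}" using I by blast
  from par'_iff[OF this, of x] show "x \<in> par' (I \<inter> J)" using c l bI by simp
qed

lemma par'_full: "par' {..<Suc N} = carrier E"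
proof -
  have l: "loc {..<Suc N} = {..<3}" unfolding loc_def using colour_indices by auto
  have "core x \<in> carrier G" "leaf x \<in> carrier \<Gamma>" if "x \<in> carrier E" for x
    using that core.hom_closed leaf.hom_closed by auto
  moreover have "{..<Suc N} \<inter> {..<N} = {..<N}" by auto
  ultimately show ?thesis using par'_iff[of "{..<Suc N}"] generates gen_full l by auto
qed

lemma finite_E: "finite (carrier E)"
proof (rule finite_subset)
  show "carrier E \<subseteq> (\<lambda>(g, \<gamma>). Ext g \<gamma>) ` (carrier G \<times> carrier \<Gamma>)" by (auto elim!: E_elim)
  show "finite ((\<lambda>(g, \<gamma>). Ext g \<gamma>) ` (carrier G \<times> carrier \<Gamma>))" using finite_carrier finite_\<Gamma> by simp
qed

lemma card_E: "int (card (carrier E)) = int (card (carrier G)) * (s * (s + t))"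
proof -
  have eq: "carrier E = (\<lambda>(g, \<gamma>). Ext g \<gamma>) ` (SIGMA g:carrier G. {\<gamma> \<in> carrier \<Gamma>. proj_left \<gamma> = \<sigma> g})"
    by (auto elim!: E_elim simp: E_simps image_iff)
  have "inj_on (\<lambda>(g, \<gamma>). Ext g \<gamma>) Z" for Z by (rule inj_onI) auto
  then have "card (carrier E) = card (SIGMA g:carrier G. {\<gamma> \<in> carrier \<Gamma>. proj_left \<gamma> = \<sigma> g})"
    unfolding eq by (rule card_image)
  also have "\<dots> = (\<Sum>g\<in>carrier G. card {\<gamma> \<in> carrier \<Gamma>. proj_left \<gamma> = \<sigma> g})"
    by (rule card_SigmaI) (use finite_carrier finite_\<Gamma> in auto)
  finally show ?thesis using card_fibre by simp
qed

lemma compose_homs: "(\<lambda>x. \<sigma> (core x)) \<in> hom E D4" "(\<lambda>x. proj_right (leaf x)) \<in> hom E D4"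
  by (rule hom_chain[OF core_hom colour_hom], rule hom_chain[OF leaf_hom proj_hom(2)])

text \<open>Continuing the string: the next polyhedron is glued along the last two generators.\<close>

lemma coloured_right: "square_coloured E (Suc N) b N \<rho>' (\<lambda>x. proj_right (leaf x))"
proof (intro square_coloured.intro square_coloured_axioms.intro group_E)
  show "b < Suc N" "N < Suc N" "b \<noteq> N" using colour_indices by auto
  show "proj_right (leaf (\<rho>' b)) = dgen 0" "proj_right (leaf (\<rho>' N)) = dgen 1"
    unfolding leaf_gen local_gen_def using colour_indices proj_tgen by auto
  show "proj_right (leaf (\<rho>' i)) = \<one>\<^bsub>D4\<^esub>" if "i < Suc N" "i \<noteq> b" "i \<noteq> N" for i
    unfolding leaf_gen local_gen_def using that proj_tgen by auto
  show "x = \<one>\<^bsub>E\<^esub>" if x: "x \<in> par' {b, N}" and e: "proj_right (leaf x) = \<one>\<^bsub>D4\<^esub>" for x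
  proof -
    have bN: "{b, N} \<subseteq> {..<Suc N}" using colour_indices by auto
    have xb: "x \<in> carrier E" "core x \<in> par ({b, N} \<inter> {..<N})" "leaf x \<in> gen (loc {b, N})"
      using par'_bound[OF bN x] by auto
    have "loc {b, N} = {1, 2}" unfolding loc_def using colour_indices by auto
    then have l: "leaf x = \<one>\<^bsub>\<Gamma>\<^esub>" using proj_right_inj xb(3) e by simp
    then have "\<sigma> (core x) = \<one>\<^bsub>D4\<^esub>" using E_compat[OF xb(1)] \<pi>.hom_one by simp
    moreover have "core x \<in> par {a, b}" using xb(2) mono_generate[OF image_mono, of "{b, N} \<inter> {..<N}" "{a, b}"] by auto
    ultimately have "core x = \<one>" using colour_inj by blast
    then show ?thesis using E_eta[OF xb(1)] l E_simps(3) by simp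
  qed
qed (use finite_E gen'_carrier gen'_invol gen'_nontrivial par'_full par'_Int compose_homs in auto)

text \<open>Branching: the next polyhedron is glued along the same two generators as the present one.\<close>

lemma coloured_left: "square_coloured E (Suc N) a b \<rho>' (\<lambda>x. \<sigma> (core x))"
proof (intro square_coloured.intro square_coloured_axioms.intro group_E)
  show "a < Suc N" "b < Suc N" "a \<noteq> b" using colour_indices by auto
  show "\<sigma> (core (\<rho>' a)) = dgen 0" "\<sigma> (core (\<rho>' b)) = dgen 1"
    unfolding core_gen using colour_indices colour_gens by auto
  show "\<sigma> (core (\<rho>' i)) = \<one>\<^bsub>D4\<^esub>" if "i < Suc N" "i \<noteq> a" "i \<noteq> b" for i
    unfolding core_gen using that colour_gens(3)[of i] \<sigma>.hom_one by auto
  show "x = \<one>\<^bsub>E\<^esub>" if x: "x \<in> par' {a, b}" and e: "\<sigma> (core x) = \<one>\<^bsub>D4\<^esub>" for x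
  proof -
    have ab: "{a, b} \<subseteq> {..<Suc N}" using colour_indices by auto
    have xb: "x \<in> carrier E" "core x \<in> par ({a, b} \<inter> {..<N})" "leaf x \<in> gen (loc {a, b})"
      using par'_bound[OF ab x] by auto
    have "{a, b} \<inter> {..<N} = {a, b}" using colour_indices by auto
    then have c: "core x = \<one>" using colour_inj xb(2) e by simp
    have "loc {a, b} = {0, 1}" unfolding loc_def using colour_indices by auto
    then have "leaf x = \<one>\<^bsub>\<Gamma>\<^esub>" using proj_left_inj xb(3) E_compat[OF xb(1)] e by simp
    then show ?thesis using E_eta[OF xb(1)] c E_simps(3) by simp
  qed
qed (use finite_E gen'_carrier gen'_invol gen'_nontrivial par'_full par'_Int compose_homs in auto)

text \<open>Without the new generator, the new component is an element of \<open>\<langle>tgen 0, tgen 1\<rangle>\<close> that is determined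
by its colour, so nothing is added to the old parabolic subgroups.\<close>

lemma old_kernel:
  assumes J: "J \<subseteq> {..<N}" and x: "x \<in> par' J" and e: "core x = \<one>"
  shows "x = \<one>\<^bsub>E\<^esub>"
proof -
  have J': "J \<subseteq> {..<Suc N}" using J by force
  have xb: "x \<in> carrier E" "leaf x \<in> gen (loc J)" using par'_bound[OF J' x] by auto
  have "loc J \<subseteq> {0, 1}" unfolding loc_def using J by auto
  then have "leaf x \<in> gen {0, 1}" using xb(2) T.mono_generate[OF image_mono] by blast
  moreover have "proj_left (leaf x) = (False, False, False)" using E_compat[OF xb(1)] e \<sigma>.hom_one by simp
  ultimately have "leaf x = \<one>\<^bsub>\<Gamma>\<^esub>" by (rule proj_left_inj)
  then show ?thesis using E_eta[OF xb(1)] e E_simps(3) by simp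
qed

lemma card_old: assumes J: "J \<subseteq> {..<N}" shows "card (par' J) = card (par J)"
proof -
  have J': "J \<subseteq> {..<Suc N}" using J by force
  have "inj_on core (par' J)"
  proof (rule inj_onI)
    fix x y assume x: "x \<in> par' J" and y: "y \<in> par' J" and e: "core x = core y"
    have c: "x \<in> carrier E" "y \<in> carrier E" using par'_bound[OF J'] x y by auto
    have "inv\<^bsub>E\<^esub> x \<otimes>\<^bsub>E\<^esub> y \<in> par' J"
      using E.generate_m_inv_closed[OF gens'_sub[OF J'] x] y generate.eng by metis
    moreover have "core (inv\<^bsub>E\<^esub> x \<otimes>\<^bsub>E\<^esub> y) = \<one>"
      using core.hom_mult core.hom_inv c e core.hom_closed[OF c(2)] by simp
    ultimately have "inv\<^bsub>E\<^esub> x \<otimes>\<^bsub>E\<^esub> y = \<one>\<^bsub>E\<^esub>" by (rule old_kernel[OF J])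
    then show "x = y" using c E.inv_solve_left'[of x y "\<one>\<^bsub>E\<^esub>"] by (metis E.inv_comm E.inv_equality E.inv_inv E.inv_closed)
  qed
  from card_image[OF this] show ?thesis unfolding core_par'[OF J] by (rule sym)
qed

lemma old_model:
  assumes m: "leaf_model G \<rho> f T'" and f: "\<And>l. l < 3 \<Longrightarrow> f l < N"
  shows "leaf_model E \<rho>' f T'"
proof -
  obtain h where h: "h \<in> hom G T'" "\<forall>l<3. h (\<rho> (f l)) = tgen l"
    "\<forall>g \<in> generate G (\<rho> ` f ` {..<3}). h g = \<one>\<^bsub>T'\<^esub> \<longrightarrow> g = \<one>"
    using m unfolding leaf_model_def by blast
  have J: "f ` {..<3} \<subseteq> {..<N}" using f by auto
  have "(\<lambda>x. h (core x)) \<in> hom E T'" by (rule hom_chain[OF core_hom h(1)])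
  moreover have "h (core (\<rho>' (f l))) = tgen l" if "l < 3" for l
    unfolding core_gen using h(2) f[OF that] that by auto
  moreover have "x = \<one>\<^bsub>E\<^esub>" if x: "x \<in> par' (f ` {..<3})" "h (core x) = \<one>\<^bsub>T'\<^esub>" for x
  proof (rule old_kernel[OF J x(1)])
    have "core x \<in> par (f ` {..<3})" unfolding core_par'[OF J, symmetric] using x(1) by (rule imageI)
    from bspec[OF h(3) this] show "core x = \<one>" using x(2) by simp
  qed
  ultimately show ?thesis unfolding leaf_model_def by (intro bexI[of _ "\<lambda>x. h (core x)"]) simp_all
qed

lemma new_model:
  assumes f: "f 0 = a" "f 1 = b" "f 2 = N"
  shows "leaf_model E \<rho>' f \<Gamma>"
proof -
  have set: "f ` {..<3} = {a, b, N}"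
  proof -
    have "{..<3 :: nat} = {0, 1, 2}" by auto
    then show ?thesis using f by simp
  qed
  have abN: "{a, b, N} \<subseteq> {..<Suc N}" using colour_indices by auto
  have l3: "l = 0 \<or> l = 1 \<or> l = 2" if "l < 3" for l :: nat using that by auto
  have "leaf (\<rho>' (f l)) = tgen l" if "l < 3" for l
    using l3[OF that] f colour_indices unfolding leaf_gen local_gen_def by auto
  moreover have "x = \<one>\<^bsub>E\<^esub>" if x: "x \<in> par' (f ` {..<3})" "leaf x = \<one>\<^bsub>\<Gamma>\<^esub>" for x
  proof -
    have xb: "x \<in> carrier E" "core x \<in> par ({a, b, N} \<inter> {..<N})" using par'_bound[OF abN] x(1) unfolding set by auto
    have "{a, b, N} \<inter> {..<N} = {a, b}" using colour_indices by auto
    moreover have "\<sigma> (core x) = \<one>\<^bsub>D4\<^esub>" using E_compat[OF xb(1)] x(2) \<pi>.hom_one by simp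
    ultimately have "core x = \<one>" using colour_inj xb(2) by simp
    then show ?thesis using E_eta[OF xb(1)] x(2) E_simps(3) by simp
  qed
  ultimately show ?thesis unfolding leaf_model_def by (intro bexI[of _ leaf] leaf_hom) simp_all
qed

end

lemma D4_generated: "x \<in> generate D4 (dgen ` {..<2})"
proof -
  interpret D: group D4 by (rule group_D4)
  have f2: "tface (square_sym y) 2 = base 2" for y using stab_tface[of 2 "square_sym y"] square_sym_stab[of y] by simp
  have "inv\<^bsub>D4\<^esub> \<one>\<^bsub>D4\<^esub> \<otimes>\<^bsub>D4\<^esub> x \<in> generate D4 (dgen ` {l. l < 2 \<and> int l \<noteq> 2})"
    by (rule iffD1[OF square_face_eq]) (simp, simp only: f2)
  moreover have "{l. l < 2 \<and> int l \<noteq> 2} = {..<2 :: nat}" by auto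
  moreover have "inv\<^bsub>D4\<^esub> \<one>\<^bsub>D4\<^esub> \<otimes>\<^bsub>D4\<^esub> x = x" using D.l_one[of x] D.inv_one by simp
  ultimately show ?thesis by metis
qed

definition square_group :: "el monoid" where
  "square_group = \<lparr>carrier = range Sq, monoid.mult = (\<lambda>x y. Sq (d4_mult (snd (leaf x)) (snd (leaf y)))),
     one = Sq (False, False, False)\<rparr>"

lemma square_group_coloured:
  "square_coloured square_group 2 0 1 (\<lambda>i. Sq (dgen i)) (\<lambda>x. snd (leaf x))"
proof -
  let ?Q = square_group
  have simps: "carrier ?Q = range Sq" "Sq x \<otimes>\<^bsub>?Q\<^esub> Sq y = Sq (d4_mult x y)" "\<one>\<^bsub>?Q\<^esub> = Sq (False, False, False)" for x y
    unfolding square_group_def by simp_all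
  interpret D: group D4 by (rule group_D4)
  interpret Q: group ?Q
  proof (rule groupI)
    fix x assume x: "x \<in> carrier ?Q"
    obtain u where u: "x = Sq u" using x simps(1) by (metis imageE)
    show "\<one>\<^bsub>?Q\<^esub> \<otimes>\<^bsub>?Q\<^esub> x = x" unfolding u simps using D.l_one[of u] by simp
    obtain v where "d4_mult v u = (False, False, False)" using D.l_inv_ex[of u] by auto
    then have "Sq v \<otimes>\<^bsub>?Q\<^esub> x = \<one>\<^bsub>?Q\<^esub>" unfolding u simps by simp
    then show "\<exists>y\<in>carrier ?Q. y \<otimes>\<^bsub>?Q\<^esub> x = \<one>\<^bsub>?Q\<^esub>" unfolding simps(1) by blast
    fix y assume y: "y \<in> carrier ?Q"
    obtain w where w: "y = Sq w" using y simps(1) by (metis imageE)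
    show "x \<otimes>\<^bsub>?Q\<^esub> y \<in> carrier ?Q" unfolding u w simps by simp
    fix z assume z: "z \<in> carrier ?Q"
    obtain q where q: "z = Sq q" using z simps(1) by (metis imageE)
    show "x \<otimes>\<^bsub>?Q\<^esub> y \<otimes>\<^bsub>?Q\<^esub> z = x \<otimes>\<^bsub>?Q\<^esub> (y \<otimes>\<^bsub>?Q\<^esub> z)" unfolding u w q simps d4_assoc ..
  qed (simp add: simps)
  have hom: "Sq \<in> hom D4 ?Q" unfolding hom_def using simps by auto
  interpret h: group_hom D4 ?Q Sq by (intro group_hom.intro group_hom_axioms.intro hom Q.is_group group_D4)
  have img: "generate ?Q ((\<lambda>i. Sq (dgen i)) ` I) = Sq ` generate D4 (dgen ` I)" for I
    using h.generate_img[of "dgen ` I"] by (simp add: image_image)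
  note full = D4_generated
  have one_only: "x = (False, False, False)" if x: "x \<in> generate D4 (dgen ` {0})" "x \<in> generate D4 (dgen ` {1})" for x
  proof -
    have "{l. l < 2 \<and> int l \<noteq> 0} = {1 :: nat}" "{l. l < 2 \<and> int l \<noteq> 1} = {0 :: nat}" by auto
    then have t: "tface (square_sym \<one>\<^bsub>D4\<^esub>) 0 = tface (square_sym x) 0" "tface (square_sym \<one>\<^bsub>D4\<^esub>) 1 = tface (square_sym x) 1"
      using square_face_eq[of 0 "\<one>\<^bsub>D4\<^esub>" x] square_face_eq[of 1 "\<one>\<^bsub>D4\<^esub>" x] x D.l_one[of x] D.inv_one by simp_all
    obtain a b p where xa: "x = (a, b, p)" by (cases x) auto
    show ?thesis using t unfolding xa by (cases a; cases b; cases p) (auto simp: tface_simps unit_sign_def doubleton_eq_iff)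
  qed
  have meet: "Sq x \<in> Sq ` generate D4 K" if "x \<in> generate D4 (dgen ` {0})" "x \<in> generate D4 (dgen ` {1})" for x K
    unfolding one_only[OF that] using generate.one[of D4] by (intro imageI) simp
  show ?thesis
  proof (intro square_coloured.intro square_coloured_axioms.intro Q.is_group)
    show "finite (carrier ?Q)" unfolding simps by simp
    show "Sq (dgen i) \<in> carrier ?Q" for i unfolding simps by simp
    show "Sq (dgen i) \<otimes>\<^bsub>?Q\<^esub> Sq (dgen i) = \<one>\<^bsub>?Q\<^esub>" for i unfolding simps dgen_def by (simp add: d4_mult.simps)
    show "Sq (dgen i) \<noteq> \<one>\<^bsub>?Q\<^esub>" if "i < 2" for i unfolding simps dgen_def using that by auto
    show "generate ?Q ((\<lambda>i. Sq (dgen i)) ` {..<2}) = carrier ?Q" unfolding img simps using full by auto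
    show "generate ?Q ((\<lambda>i. Sq (dgen i)) ` I) \<inter> generate ?Q ((\<lambda>i. Sq (dgen i)) ` J)
        \<subseteq> generate ?Q ((\<lambda>i. Sq (dgen i)) ` (I \<inter> J))" if I: "I \<subseteq> {..<2}" and J: "J \<subseteq> {..<2}" for I J :: "nat set"
    proof -
      have t: "{..<2 :: nat} = {0, 1}" by auto
      have "Pow {0, 1 :: nat} = {{}, {0}, {1}, {0, 1}}" by (simp add: Pow_insert insert_commute)
      then have "K = {} \<or> K = {0} \<or> K = {1} \<or> K = {0, 1}" if "K \<subseteq> {..<2}" for K :: "nat set"
        using that unfolding t by blast
      from this[OF I] this[OF J]
      have "I \<subseteq> J \<or> J \<subseteq> I \<or> I = {0} \<and> J = {1} \<or> I = {1} \<and> J = {0}"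
        by (elim disjE) simp_all
      then consider "I \<subseteq> J" | "J \<subseteq> I" | "I = {0}" "J = {1}" | "I = {1}" "J = {0}" by blast
      then show ?thesis
      proof cases
        case 1 then show ?thesis by (simp add: Int_absorb2)
      next
        case 2 then show ?thesis by (simp add: Int_absorb1)
      next
        case 3
        show ?thesis using meet unfolding img 3 by blast
      next
        case 4
        show ?thesis using meet unfolding img 4 by blast
      qed
    qed
    show "(\<lambda>x. snd (leaf x)) \<in> hom ?Q D4" unfolding hom_def using simps by auto
    show "snd (leaf (Sq (dgen i))) = \<one>\<^bsub>D4\<^esub>" if "i < 2" "i \<noteq> 0" "i \<noteq> 1" for i using that by simp
    show "g = \<one>\<^bsub>?Q\<^esub>" if "g \<in> generate ?Q ((\<lambda>i. Sq (dgen i)) ` {0, 1})" "snd (leaf g) = \<one>\<^bsub>D4\<^esub>" for g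
      using that unfolding img simps by auto
  qed auto
qed

section \<open>Strings of toroidal polyhedra\<close>

lemma flag_rel_image: "flag_rel S (\<lambda>x. \<psi> (h x)) c = flag_rel (h ` S) \<psi> c"
  unfolding flag_rel_def by blast

text \<open>A homomorphism that is injective on the subgroup in question transports a coset geometry.\<close>

lemma (in tail_triangle_polytope) section_modelI:
  assumes H: "group H" and h: "h \<in> hom G H"
    and s: "\<And>l. l < c \<Longrightarrow> s l < d" "\<And>l. l < c \<Longrightarrow> h (\<rho> (s l)) = \<eta> l"
    and ker: "\<And>g. g \<in> par (s ` {..<c}) \<Longrightarrow> h g = \<one>\<^bsub>H\<^esub> \<Longrightarrow> g = \<one>"
    and T: "T = flag_rel (carrier H) \<psi> (int c)"
    and gen: "generate H (\<eta> ` {..<c}) = carrier H"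
    and rank: "\<And>g k. g \<in> carrier H \<Longrightarrow> k \<in> {-1..int c} \<Longrightarrow> rk' (\<psi> g k) = k"
    and eq: "\<And>x y k. x \<in> carrier H \<Longrightarrow> y \<in> carrier H \<Longrightarrow> k \<in> {-1..int c} \<Longrightarrow>
      \<psi> x k = \<psi> y k \<longleftrightarrow> inv\<^bsub>H\<^esub> x \<otimes>\<^bsub>H\<^esub> y \<in> generate H (\<eta> ` {l. l < c \<and> int l \<noteq> k})"
  shows "section_model c s T"
proof -
  interpret h: group_hom G H h by (intro group_hom.intro group_hom_axioms.intro h is_group H)
  have img: "h ` par (s ` L) = generate H (\<eta> ` L)" if L: "L \<subseteq> {..<c}" for L
  proof -
    have "h ` \<rho> ` s ` L = \<eta> ` L" unfolding image_image using s(2) L by (intro image_cong) auto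
    moreover have "\<rho> ` s ` L \<subseteq> carrier G" using gen_closed s(1) L by auto
    ultimately show ?thesis using h.generate_img[of "\<rho> ` s ` L"] by simp
  qed
  let ?P = "par (s ` {..<c})"
  have subd: "s ` {..<c} \<subseteq> {..<d}" using s(1) by auto
  have sub: "subgroup ?P G" by (rule par_subgroup[OF subd])
  have P: "h ` ?P = carrier H" using img[OF order_refl] gen by simp
  have hP: "h g \<in> carrier H" if "g \<in> ?P" for g using P that by blast
  have "\<psi> (h x) k = \<psi> (h y) k \<longleftrightarrow> inv x \<otimes> y \<in> par (s ` {l. l < c \<and> int l \<noteq> k})"
    if x: "x \<in> ?P" and y: "y \<in> ?P" and k: "k \<in> {-1..int c}" for x y k
  proof -
    let ?L = "{l. l < c \<and> int l \<noteq> k}"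
    have cl: "x \<in> carrier G" "y \<in> carrier G" using x y par_carrier[OF subd] by auto
    have w: "inv x \<otimes> y \<in> ?P" using x y sub by (meson subgroup.m_closed subgroup.m_inv_closed)
    have Lc: "?L \<subseteq> {..<c}" by auto
    have "\<psi> (h x) k = \<psi> (h y) k \<longleftrightarrow> inv\<^bsub>H\<^esub> (h x) \<otimes>\<^bsub>H\<^esub> h y \<in> generate H (\<eta> ` ?L)"
      by (rule eq[OF hP[OF x] hP[OF y] k])
    also have "inv\<^bsub>H\<^esub> (h x) \<otimes>\<^bsub>H\<^esub> h y = h (inv x \<otimes> y)" using cl by simp
    also have "h (inv x \<otimes> y) \<in> generate H (\<eta> ` ?L) \<longleftrightarrow> inv x \<otimes> y \<in> par (s ` ?L)"
    proof
      assume "inv x \<otimes> y \<in> par (s ` ?L)"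
      then show "h (inv x \<otimes> y) \<in> generate H (\<eta> ` ?L)" unfolding img[OF Lc, symmetric] by (rule imageI)
    next
      assume "h (inv x \<otimes> y) \<in> generate H (\<eta> ` ?L)"
      then have "h (inv x \<otimes> y) \<in> h ` par (s ` ?L)" unfolding img[OF Lc] .
      then obtain z where z: "h (inv x \<otimes> y) = h z" "z \<in> par (s ` ?L)" by (rule imageE)
      have zP: "z \<in> ?P" using subsetD[OF par_mono[OF image_mono[OF Lc]] z(2)] .
      have zc: "z \<in> carrier G" "inv x \<otimes> y \<in> carrier G" using par_carrier[OF subd] zP w by auto
      have "inv z \<otimes> (inv x \<otimes> y) \<in> ?P" using zP w sub by (meson subgroup.m_closed subgroup.m_inv_closed)
      moreover have "h (inv z \<otimes> (inv x \<otimes> y)) = \<one>\<^bsub>H\<^esub>"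
        using h.hom_mult[of "inv z" "inv x \<otimes> y"] zc z(1) h.hom_closed[OF zc(1)] by simp
      ultimately have "inv z \<otimes> (inv x \<otimes> y) = \<one>" by (rule ker)
      then have "z = inv x \<otimes> y" using zc inv_equality[of "inv z" "inv x \<otimes> y"] by (metis inv_closed inv_inv inv_unique' l_inv r_inv m_assoc r_one l_one)
      then show "inv x \<otimes> y \<in> par (s ` ?L)" using z(2) by simp
    qed
    finally show ?thesis .
  qed
  moreover have "T = flag_rel ?P (\<lambda>x. \<psi> (h x)) (int c)" unfolding T flag_rel_image P ..
  moreover have "rk' (\<psi> (h g) k) = k" if "g \<in> ?P" "k \<in> {-1..int c}" for g k by (rule rank[OF hP[OF that(1)] that(2)])
  ultimately show ?thesis unfolding section_model_def
    by (intro exI[of _ "\<lambda>x. \<psi> (h x)"] exI[of _ rk']) simp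
qed

lemma (in tail_triangle_polytope) section_model_cong:
  assumes "\<And>l. l < c \<Longrightarrow> s l = s' l" "section_model c s T" shows "section_model c s' T"
proof -
  have "s ` {..<c} = s' ` {..<c}" "s ` {l. l < c \<and> int l \<noteq> k} = s' ` {l. l < c \<and> int l \<noteq> k}" for k
    using assms(1) by (intro image_cong; simp)+
  then show ?thesis using assms(2) unfolding section_model_def by simp
qed

definition torus_s :: "nat \<Rightarrow> int" where
  "torus_s n = (if odd n then 2 ^ ((n - 3) div 2) else 2 ^ ((n - 4) div 2))"

definition torus_t :: "nat \<Rightarrow> int" where
  "torus_t n = (if odd n then 0 else torus_s n)"

abbreviation torus_grp :: "nat \<Rightarrow> aff monoid" where
  "torus_grp n \<equiv> torus_group (torus_s n) (torus_t n)"

lemma torus44_eq: "torus44 n = torus_map (torus_s n) (torus_t n)"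
  unfolding torus44_def torus_s_def torus_t_def by simp

text \<open>The exponent is the same in both parities: \<open>s\<^sup>2\<close> with \<open>s = 2\<^sup>e\<close>, \<open>n = 2 e + 3\<close>, and \<open>2 s\<^sup>2\<close> with \<open>n = 2 e + 4\<close>.\<close>

lemma torus_params:
  assumes "5 \<le> n"
  shows "torus (torus_s n) (torus_t n)" and "torus_s n * (torus_s n + torus_t n) = 2 ^ (n - 3)"
proof -
  obtain e where e: "torus_s n = 2 ^ Suc e" "odd n \<Longrightarrow> n - 3 = 2 * Suc e" "even n \<Longrightarrow> n - 3 = Suc (2 * Suc e)"
  proof (cases "odd n")
    case True
    then obtain k where k: "n = 2 * k + 1" by (rule oddE)
    then have "n - 3 = 2 * Suc (k - 2)" using assms by auto
    then show thesis using that[of "k - 2"] True unfolding torus_s_def by simp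
  next
    case False
    then have "even n" by simp
    then obtain k where k: "n = 2 * k" by (rule evenE)
    then have "n - 4 = 2 * Suc (k - 3)" "n - 3 = Suc (2 * Suc (k - 3))" using assms by auto
    then show thesis using that[of "k - 3"] False unfolding torus_s_def by simp
  qed
  have "(1 :: int) \<le> 2 ^ e" by simp
  then have "(2 :: int) \<le> 2 ^ Suc e" unfolding power_Suc by linarith
  moreover have "even ((2 :: int) ^ Suc e)" by simp
  ultimately show "torus (torus_s n) (torus_t n)" unfolding torus_def torus_t_def e(1) by simp
  have sq: "(2 :: int) ^ (2 * Suc e) = 2 ^ Suc e * 2 ^ Suc e" unfolding mult_2 power_add ..
  show "torus_s n * (torus_s n + torus_t n) = 2 ^ (n - 3)"
  proof (cases "odd n")
    case True
    then show ?thesis unfolding torus_t_def e(1) e(2)[OF True] sq by simp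
  next
    case False
    then have ev: "even n" by simp
    show ?thesis using False unfolding torus_t_def e(1) e(3)[OF ev] power_Suc[of 2 "2 * Suc e"] sq by simp
  qed
qed

text \<open>The base of the induction is the group of the square; the polyhedron with number \<open>j\<close> uses the
generators \<open>j, j + 1, j + 2\<close>.\<close>

lemma string_group:
  assumes "\<And>j. j < c \<Longrightarrow> 5 \<le> k j"
  shows "\<exists>G \<rho> \<sigma>. square_coloured G (c + 2) c (c + 1) \<rho> \<sigma> \<and>
    (\<forall>i j. i + 2 \<le> j \<longrightarrow> j < c + 2 \<longrightarrow> \<rho> i \<otimes>\<^bsub>G\<^esub> \<rho> j = \<rho> j \<otimes>\<^bsub>G\<^esub> \<rho> i) \<and>
    (\<forall>j<c. leaf_model G \<rho> (\<lambda>l. j + l) (torus_grp (k j))) \<and>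
    card (carrier G) = 2 ^ (3 + (\<Sum>j<c. k j - 3))"
  using assms
proof (induction c)
  case 0
  have c: "card (carrier square_group) = 8"
  proof -
    have "card (range Sq) = card (UNIV :: d4 set)" by (rule card_image) (auto intro: injI)
    also have "\<dots> = 8" by (simp add: card_cartesian_product UNIV_Times_UNIV[symmetric] del: UNIV_Times_UNIV)
    finally show ?thesis unfolding square_group_def by simp
  qed
  have q: "square_coloured square_group (0 + 2) 0 (0 + 1) (\<lambda>i. Sq (dgen i)) (\<lambda>x. snd (leaf x))"
    using square_group_coloured by (simp add: numeral_2_eq_2)
  show ?case
    by (intro exI[of _ square_group] exI[of _ "\<lambda>i. Sq (dgen i)"] exI[of _ "\<lambda>x. snd (leaf x)"] conjI q)
      (use c in auto)
next
  case (Suc c)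
  have "\<exists>G \<rho> \<sigma>. square_coloured G (c + 2) c (c + 1) \<rho> \<sigma> \<and>
    (\<forall>i j. i + 2 \<le> j \<longrightarrow> j < c + 2 \<longrightarrow> \<rho> i \<otimes>\<^bsub>G\<^esub> \<rho> j = \<rho> j \<otimes>\<^bsub>G\<^esub> \<rho> i) \<and>
    (\<forall>j<c. leaf_model G \<rho> (\<lambda>l. j + l) (torus_grp (k j))) \<and>
    card (carrier G) = 2 ^ (3 + (\<Sum>j<c. k j - 3))"
    by (rule Suc.IH) (use Suc.prems in simp)
  then obtain G \<rho> \<sigma> where sq: "square_coloured G (c + 2) c (c + 1) \<rho> \<sigma>"
    and com: "\<And>i j. i + 2 \<le> j \<Longrightarrow> j < c + 2 \<Longrightarrow> \<rho> i \<otimes>\<^bsub>G\<^esub> \<rho> j = \<rho> j \<otimes>\<^bsub>G\<^esub> \<rho> i"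
    and mod: "\<And>j. j < c \<Longrightarrow> leaf_model G \<rho> (\<lambda>l. j + l) (torus_grp (k j))"
    and cd: "card (carrier G) = 2 ^ (3 + (\<Sum>j<c. k j - 3))"
    by blast
  have k5: "5 \<le> k c" using Suc.prems by simp
  interpret A: amalgam G "c + 2" c "c + 1" \<rho> \<sigma> "torus_s (k c)" "torus_t (k c)"
    by (intro amalgam.intro sq torus_params k5)
  let ?\<rho> = "fibre_gen G (c + 2) c (c + 1) \<rho>"
  have 1: "square_coloured A.E (Suc c + 2) (Suc c) (Suc c + 1) ?\<rho> (\<lambda>x. proj_right (leaf x))"
    using A.coloured_right by simp
  have 2: "?\<rho> i \<otimes>\<^bsub>A.E\<^esub> ?\<rho> j = ?\<rho> j \<otimes>\<^bsub>A.E\<^esub> ?\<rho> i" if "i + 2 \<le> j" "j < Suc c + 2" for i j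
  proof (cases "j = c + 2")
    case True
    then show ?thesis using A.gen'_commute_new[of i] that by simp
  next
    case False
    then have j: "j < c + 2" using that by simp
    have "{i, j} \<noteq> {c, c + 1}" using that(1) by (auto simp: doubleton_eq_iff)
    then show ?thesis using A.gen'_commute[of i j] com[OF that(1) j] that j by simp
  qed
  have 3: "leaf_model A.E ?\<rho> (\<lambda>l. j + l) (torus_grp (k j))" if "j < Suc c" for j
  proof (cases "j = c")
    case True then show ?thesis using A.new_model[of "\<lambda>l. c + l"] by simp
  next
    case False
    then have j: "j < c" using that by simp
    show ?thesis by (rule A.old_model[OF mod[OF j]]) (use j in simp)
  qed
  have "int (card (carrier A.E)) = 2 ^ (3 + (\<Sum>j<c. k j - 3)) * 2 ^ (k c - 3)"
    unfolding A.card_E cd torus_params(2)[OF k5] by simp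
  also have "\<dots> = int (2 ^ (3 + (\<Sum>j<Suc c. k j - 3)))" by (simp add: power_add mult.assoc)
  finally have 4: "card (carrier A.E) = 2 ^ (3 + (\<Sum>j<Suc c. k j - 3))" by linarith
  show ?case
  proof (intro exI conjI allI impI)
    show "square_coloured A.E (Suc c + 2) (Suc c) (Suc c + 1) ?\<rho> (\<lambda>x. proj_right (leaf x))" by (rule 1)
  qed (use 2 3 4 in auto)
qed

text \<open>Two polyhedra glued along the same generators can be interchanged.\<close>

definition swap_leaves :: "el \<Rightarrow> el" where
  "swap_leaves x = Ext (Ext (core (core x)) (leaf x)) (leaf (core x))"

lemma swap_leaves_mem:
  assumes A: "amalgam G N a b \<rho> \<sigma> s t" and B: "amalgam G N a b \<rho> \<sigma> s' t'"
    and x: "x \<in> carrier (fibre_prod (fibre_prod G \<sigma> (torus_group s t)) (\<lambda>x. \<sigma> (core x)) (torus_group s' t'))"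
  shows "swap_leaves x \<in> carrier (fibre_prod (fibre_prod G \<sigma> (torus_group s' t')) (\<lambda>x. \<sigma> (core x)) (torus_group s t))"
    and "swap_leaves (swap_leaves x) = x"
proof -
  interpret A: amalgam G N a b \<rho> \<sigma> s t by (rule A)
  interpret B: amalgam G N a b \<rho> \<sigma> s' t' by (rule B)
  interpret AB: amalgam A.E "Suc N" a b "fibre_gen G N a b \<rho>" "\<lambda>x. \<sigma> (core x)" s' t'
    by (intro amalgam.intro A.coloured_left B.torus_axioms)
  interpret BA: amalgam B.E "Suc N" a b "fibre_gen G N a b \<rho>" "\<lambda>x. \<sigma> (core x)" s t
    by (intro amalgam.intro B.coloured_left A.torus_axioms)
  obtain y \<gamma> where y: "x = Ext y \<gamma>" "y \<in> carrier A.E" "\<gamma> \<in> carrier (torus_group s' t')" "\<sigma> (core y) = proj_left \<gamma>"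
    using x by (rule AB.E_elim)
  obtain g \<delta> where g: "y = Ext g \<delta>" "g \<in> carrier G" "\<delta> \<in> carrier (torus_group s t)" "\<sigma> g = proj_left \<delta>"
    using y(2) by (rule A.E_elim)
  have sx: "swap_leaves x = Ext (Ext g \<gamma>) \<delta>" unfolding swap_leaves_def y(1) g(1) by simp
  have "Ext g \<gamma> \<in> carrier B.E" using y g by (simp add: B.Ext_mem)
  then show "swap_leaves x \<in> carrier BA.E" unfolding sx using g by (simp add: BA.Ext_mem)
  show "swap_leaves (swap_leaves x) = x" unfolding sx unfolding swap_leaves_def y(1) g(1) by simp
qed

lemma swap_leaves_iso:
  assumes A: "amalgam G N a b \<rho> \<sigma> s t" and B: "amalgam G N a b \<rho> \<sigma> s' t'"
  shows "swap_leaves \<in> iso (fibre_prod (fibre_prod G \<sigma> (torus_group s t)) (\<lambda>x. \<sigma> (core x)) (torus_group s' t'))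
    (fibre_prod (fibre_prod G \<sigma> (torus_group s' t')) (\<lambda>x. \<sigma> (core x)) (torus_group s t))"
proof (rule isoI)
  note AB = swap_leaves_mem[OF A B] and BA = swap_leaves_mem[OF B A]
  show "bij_betw swap_leaves (carrier (fibre_prod (fibre_prod G \<sigma> (torus_group s t)) (\<lambda>x. \<sigma> (core x)) (torus_group s' t')))
    (carrier (fibre_prod (fibre_prod G \<sigma> (torus_group s' t')) (\<lambda>x. \<sigma> (core x)) (torus_group s t)))"
    by (rule bij_betwI[of _ _ _ swap_leaves]) (use AB BA in blast)+
  show "swap_leaves \<in> hom (fibre_prod (fibre_prod G \<sigma> (torus_group s t)) (\<lambda>x. \<sigma> (core x)) (torus_group s' t'))
    (fibre_prod (fibre_prod G \<sigma> (torus_group s' t')) (\<lambda>x. \<sigma> (core x)) (torus_group s t))"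
    by (rule homI) (use AB(1) in \<open>simp_all add: fibre_prod_def swap_leaves_def\<close>)
qed

lemma p_group_2I:
  assumes "group A" "order A = 2 ^ e" shows "p_group 2 A"
proof -
  interpret group A by (rule assms(1))
  have "\<exists>k. ord x = 2 ^ k" if "x \<in> carrier A" for x
  proof -
    have "ord x dvd 2 ^ e" using ord_dvd_group_order[OF that] assms(2) by simp
    then show ?thesis using divides_primepow_nat[OF two_is_prime_nat] by blast
  qed
  then show ?thesis unfolding p_group_def using assms(1) by blast
qed

section \<open>The semiregular polytope\<close>

definition swap_index :: "nat \<Rightarrow> nat \<Rightarrow> nat" where
  "swap_index N i = (if i = N then Suc N else if i = Suc N then N else i)"

text \<open>Only the two generators that are added last are interchanged. The trivial component of the first of
them in the second toroidal factor is written \<open>tgen 3\<close>, which is the identity of every toroidal group.\<close>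

lemma swap_leaves_gen:
  fixes s t s' t' :: int
  assumes ab: "a < N" "b < N"
  shows "swap_leaves (fibre_gen (fibre_prod G \<sigma> (torus_group s t)) (Suc N) a b (fibre_gen G N a b \<rho>) i) =
    fibre_gen (fibre_prod G \<sigma> (torus_group s' t')) (Suc N) a b (fibre_gen G N a b \<rho>) (swap_index N i)"
proof -
  have one: "\<one>\<^bsub>fibre_prod G \<sigma> (torus_group s t)\<^esub> = Ext \<one>\<^bsub>G\<^esub> (tgen 3)" for s t
    unfolding fibre_prod_def torus_group_def tgen_def by simp
  have "i = N \<or> i = Suc N \<or> (i \<noteq> N \<and> i \<noteq> Suc N)" by blast
  then show ?thesis
    using ab unfolding fibre_gen_def swap_index_def swap_leaves_def one local_gen_def by auto
qed

text \<open>The string of the first \<open>c\<close> polyhedra with two polyhedra attached at its end; the case \<open>c = 0\<close> attaches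
both to a single square. With \<open>d = c + 4\<close>, the generators \<open>\<rho> (d - 2)\<close> and \<open>\<rho> (d - 1)\<close> are those added by the two.
The facets of the second kind are treated by means of the isomorphism that interchanges the two.\<close>

lemma semiregular_tower:
  fixes c m :: nat and n :: "nat \<Rightarrow> nat"
  defines "d \<equiv> Suc (Suc (c + 2))"
  assumes n5: "\<And>j. j \<in> {3..d - 1} \<Longrightarrow> n j \<ge> 5" and m5: "m \<ge> 5"
  shows "\<exists>(S :: nat rel) rk A B.
    finite (Field S) \<and>
    alternating_semiregular (int d) S rk A B \<and>
    has_alternating_type d S rk A B n m \<and>
    p_group 2 (aut_group S) \<and>
    (n (d - 1) \<noteq> m \<longrightarrow>
       order (aut_group S) = 2 ^ ((\<Sum>j = 3..d - 1. n j) + m - 3 * (d - 3))) \<and>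
    (n (d - 1) = m \<longrightarrow>
       order (aut_group S) = 2 * 2 ^ ((\<Sum>j = 3..d - 1. n j) + m - 3 * (d - 3)))"
proof -
  have dc: "d = c + 4" unfolding d_def by simp
  define p where "p = n (c + 3)"
  have p5: "5 \<le> p" unfolding p_def by (rule n5) (simp add: dc)
  have "\<exists>G \<rho> \<sigma>. square_coloured G (c + 2) c (c + 1) \<rho> \<sigma> \<and>
    (\<forall>i j. i + 2 \<le> j \<longrightarrow> j < c + 2 \<longrightarrow> \<rho> i \<otimes>\<^bsub>G\<^esub> \<rho> j = \<rho> j \<otimes>\<^bsub>G\<^esub> \<rho> i) \<and>
    (\<forall>j<c. leaf_model G \<rho> (\<lambda>l. j + l) (torus_grp (n (j + 3)))) \<and>
    card (carrier G) = 2 ^ (3 + (\<Sum>j<c. n (j + 3) - 3))"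
    by (rule string_group) (rule n5, simp add: dc)
  then obtain G \<rho> \<sigma> where sq: "square_coloured G (c + 2) c (c + 1) \<rho> \<sigma>"
    and com: "\<And>i j. i + 2 \<le> j \<Longrightarrow> j < c + 2 \<Longrightarrow> \<rho> i \<otimes>\<^bsub>G\<^esub> \<rho> j = \<rho> j \<otimes>\<^bsub>G\<^esub> \<rho> i"
    and mod: "\<And>j. j < c \<Longrightarrow> leaf_model G \<rho> (\<lambda>l. j + l) (torus_grp (n (j + 3)))"
    and cG: "card (carrier G) = 2 ^ (3 + (\<Sum>j<c. n (j + 3) - 3))"
    by blast
  have am: "amalgam G (c + 2) c (c + 1) \<rho> \<sigma> (torus_s r) (torus_t r)" if "5 \<le> r" for r
    by (intro amalgam.intro sq torus_params that)
  interpret A: amalgam G "c + 2" c "c + 1" \<rho> \<sigma> "torus_s p" "torus_t p" by (rule am[OF p5])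
  interpret B: amalgam G "c + 2" c "c + 1" \<rho> \<sigma> "torus_s m" "torus_t m" by (rule am[OF m5])
  let ?\<rho>1 = "fibre_gen G (c + 2) c (c + 1) \<rho>"
  interpret AB: amalgam A.E "Suc (c + 2)" c "c + 1" ?\<rho>1 "\<lambda>x. \<sigma> (core x)" "torus_s m" "torus_t m"
    by (intro amalgam.intro A.coloured_left B.torus_axioms)
  interpret BA: amalgam B.E "Suc (c + 2)" c "c + 1" ?\<rho>1 "\<lambda>x. \<sigma> (core x)" "torus_s p" "torus_t p"
    by (intro amalgam.intro B.coloured_left A.torus_axioms)
  let ?\<rho> = "fibre_gen A.E (Suc (c + 2)) c (c + 1) ?\<rho>1"
  let ?\<rho>' = "fibre_gen B.E (Suc (c + 2)) c (c + 1) ?\<rho>1"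
  have com1: "?\<rho>1 i \<otimes>\<^bsub>A.E\<^esub> ?\<rho>1 j = ?\<rho>1 j \<otimes>\<^bsub>A.E\<^esub> ?\<rho>1 i" if "i + 2 \<le> j" "j < c + 3" for i j
  proof (cases "j = c + 2")
    case True then show ?thesis using A.gen'_commute_new[of i] that by simp
  next
    case False
    then have j: "j < c + 2" using that by simp
    have "{i, j} \<noteq> {c, c + 1}" using that(1) by (auto simp: doubleton_eq_iff)
    then show ?thesis using A.gen'_commute[OF _ j com[OF that(1) j]] that(1) j by simp
  qed
  interpret T: tail_triangle AB.E d ?\<rho>
  proof (intro tail_triangle.intro tail_triangle_axioms.intro AB.group_E)
    show "3 \<le> d" unfolding dc by simp
    show "finite (carrier AB.E)" by (rule AB.finite_E)
    show "?\<rho> i \<in> carrier AB.E" "?\<rho> i \<otimes>\<^bsub>AB.E\<^esub> ?\<rho> i = \<one>\<^bsub>AB.E\<^esub>" "?\<rho> i \<noteq> \<one>\<^bsub>AB.E\<^esub>" if "i < d" for i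
      by (rule AB.gen'_carrier AB.gen'_invol AB.gen'_nontrivial; use that in \<open>simp only: d_def\<close>)+
    show "generate AB.E (?\<rho> ` {..<d}) = carrier AB.E" unfolding d_def by (rule AB.par'_full)
    show "generate AB.E (?\<rho> ` I) \<inter> generate AB.E (?\<rho> ` J) \<subseteq> generate AB.E (?\<rho> ` (I \<inter> J))"
      if "I \<subseteq> {..<d}" "J \<subseteq> {..<d}" for I J
      by (rule AB.par'_Int) (use that in \<open>simp_all only: d_def\<close>)
    show "?\<rho> i \<otimes>\<^bsub>AB.E\<^esub> ?\<rho> j = ?\<rho> j \<otimes>\<^bsub>AB.E\<^esub> ?\<rho> i" if ij: "i + 2 \<le> j" "j < d - 1" for i j
    proof (rule AB.gen'_commute)
      show "i < Suc (c + 2)" "j < Suc (c + 2)" using ij unfolding dc by auto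
      show "{i, j} \<noteq> {c, c + 1}" using ij(1) by (auto simp: doubleton_eq_iff)
      show "?\<rho>1 i \<otimes>\<^bsub>A.E\<^esub> ?\<rho>1 j = ?\<rho>1 j \<otimes>\<^bsub>A.E\<^esub> ?\<rho>1 i" by (rule com1) (use ij dc in auto)
    qed
    show "?\<rho> i \<otimes>\<^bsub>AB.E\<^esub> ?\<rho> (d - 1) = ?\<rho> (d - 1) \<otimes>\<^bsub>AB.E\<^esub> ?\<rho> i" if i: "i < d" "i \<noteq> d - 3" for i
    proof (cases "i = d - 1")
      case False
      have d1: "d - 1 = Suc (c + 2)" unfolding dc by simp
      show ?thesis unfolding d1 by (rule AB.gen'_commute_new) (use i False dc in auto)
    qed simp
  qed
  obtain \<phi> :: "el \<times> bool \<Rightarrow> int \<Rightarrow> nat" and rk where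
    rk: "\<And>x k. x \<in> T.\<Omega> \<Longrightarrow> k \<in> {-1..int d} \<Longrightarrow> rk (\<phi> x k) = k" and
    \<phi>: "\<And>x y k. x \<in> T.\<Omega> \<Longrightarrow> y \<in> T.\<Omega> \<Longrightarrow> k \<in> {-1..int d} \<Longrightarrow> \<phi> x k = \<phi> y k \<longleftrightarrow> T.same k x y"
    by (rule T.face_labels[OF that])
  interpret P: tail_triangle_polytope AB.E d ?\<rho> \<phi> rk
    by (intro tail_triangle_polytope.intro T.tail_triangle_axioms tail_triangle_polytope_axioms.intro rk \<phi>)
  let ?S = "flag_rel T.\<Omega> \<phi> (int d)"
  have cA: "int (card (carrier A.E)) = int (card (carrier G)) * 2 ^ (p - 3)"
    unfolding A.card_E torus_params(2)[OF p5] ..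
  have cB: "int (card (carrier B.E)) = int (card (carrier G)) * 2 ^ (m - 3)"
    unfolding B.card_E torus_params(2)[OF m5] ..
  define e where "e = (\<Sum>j = 3..d - 1. n j) + m - 3 * (d - 3)"
  have cE: "card (carrier AB.E) = 2 ^ e"
  proof -
    have "int (card (carrier AB.E)) = 2 ^ (3 + (\<Sum>j<c. n (j + 3) - 3)) * 2 ^ (p - 3) * 2 ^ (m - 3)"
      unfolding AB.card_E torus_params(2)[OF m5] cA cG by simp
    also have "\<dots> = int (2 ^ (3 + (\<Sum>j<c. n (j + 3) - 3) + (p - 3) + (m - 3)))" by (simp add: power_add)
    also have "3 + (\<Sum>j<c. n (j + 3) - 3) + (p - 3) + (m - 3) = e"
    proof -
      have "(\<Sum>j = 3..d - 1. n j) = (\<Sum>j\<in>{..<Suc c}. n (j + 3))"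
        by (rule sum.reindex_bij_witness[of _ "\<lambda>j. j + 3" "\<lambda>j. j - 3"]) (auto simp: dc)
      \<comment> \<open>the base square contributes the exponent 3, and every polyhedron its own exponent less 3\<close>
      then have 1: "(\<Sum>j = 3..d - 1. n j) = (\<Sum>j<c. n (j + 3)) + p" unfolding p_def by simp
      have "(\<Sum>j<c. n (j + 3)) = (\<Sum>j<c. (n (j + 3) - 3) + 3)"
      proof (rule sum.cong[OF refl])
        fix j assume "j \<in> {..<c}"
        then have "5 \<le> n (j + 3)" by (intro n5) (simp add: dc)
        then show "n (j + 3) = n (j + 3) - 3 + 3" by simp
      qed
      also have "\<dots> = (\<Sum>j<c. n (j + 3) - 3) + 3 * c" by (simp add: sum.distrib)
      finally show ?thesis unfolding e_def 1 using p5 m5 dc by simp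
    qed
    finally show ?thesis by linarith
  qed
  have branch: "T.branch b j = (if b \<and> j = c + 2 then c + 3 else j)" for b j
    unfolding T.branch_def using dc by simp
  have branch_id: "T.branch b l = l" if "l < c + 2" for b l unfolding branch using that by simp
  have leaf_section: "P.section_model 3 f (torus44 r)"
    if r: "5 \<le> r" and lm: "leaf_model AB.E ?\<rho> f (torus_grp r)" and f: "\<And>l. l < 3 \<Longrightarrow> f l < d" for r f
  proof -
    interpret R: torus "torus_s r" "torus_t r" by (rule torus_params(1)[OF r])
    obtain h where h: "h \<in> hom AB.E (torus_grp r)" "\<forall>l<3. h (?\<rho> (f l)) = tgen l"
      "\<forall>g \<in> generate AB.E (?\<rho> ` f ` {..<3}). h g = \<one>\<^bsub>torus_grp r\<^esub> \<longrightarrow> g = \<one>\<^bsub>AB.E\<^esub>"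
      using lm unfolding leaf_model_def by blast
    show ?thesis
    proof (rule P.section_modelI[OF R.group_\<Gamma> h(1), where c=3 and \<eta>=tgen and \<psi>=R.orbit_face and rk'=R.orbit_rank])
      show "f l < d" if "l < 3" for l by (rule f[OF that])
      show "h (?\<rho> (f l)) = tgen l" if "l < 3" for l using h(2) that by blast
      show "g = \<one>\<^bsub>AB.E\<^esub>" if "g \<in> generate AB.E (?\<rho> ` f ` {..<3})" "h g = \<one>\<^bsub>torus_grp r\<^esub>" for g
        using h(3) that by blast
      show "torus44 r = flag_rel (carrier (torus_grp r)) R.orbit_face (int 3)"
        unfolding torus44_eq using R.torus_map_flag_rel by simp
      show "generate (torus_grp r) (tgen ` {..<3}) = carrier (torus_grp r)" by (rule R.gen_full)
      show "R.orbit_rank (R.orbit_face g k) = k" if "k \<in> {-1..int 3}" for g k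
        using R.orbit_rank that by simp
      show "R.orbit_face x k = R.orbit_face y k \<longleftrightarrow>
          inv\<^bsub>torus_grp r\<^esub> x \<otimes>\<^bsub>torus_grp r\<^esub> y \<in> generate (torus_grp r) (tgen ` {l. l < 3 \<and> int l \<noteq> k})"
        if "x \<in> carrier (torus_grp r)" "y \<in> carrier (torus_grp r)" "k \<in> {-1..int 3}" for x y k
        using R.orbit_face_eq[OF that(1,2)] that(3) by simp
    qed
  qed
  have low: "P.section_model 3 (\<lambda>l. T.branch b (j - 3 + l)) (torus44 (n j))" if j: "j \<in> {3..d - 2}" for b j
  proof (rule P.section_model_cong[of 3 "\<lambda>l. j - 3 + l"])
    have jc: "j - 3 < c" "j - 3 + 3 = j" using j dc by auto
    show "j - 3 + l = T.branch b (j - 3 + l)" if "l < 3" for l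
    proof -
      have "j - 3 + l < c + 2" using that jc(1) by linarith
      from branch_id[OF this] show ?thesis by (rule sym)
    qed
    have "leaf_model A.E ?\<rho>1 (\<lambda>l. j - 3 + l) (torus_grp (n (j - 3 + 3)))"
      by (rule A.old_model[OF mod[OF jc(1)]]) (use jc in simp)
    then have "leaf_model AB.E ?\<rho> (\<lambda>l. j - 3 + l) (torus_grp (n (j - 3 + 3)))"
      by (rule AB.old_model) (use jc in simp)
    then show "P.section_model 3 (\<lambda>l. j - 3 + l) (torus44 (n j))"
      unfolding jc(2) by (rule leaf_section[rotated]) (use j n5[of j] dc in auto)
  qed
  have topA: "P.section_model 3 (\<lambda>l. T.branch False (c + l)) (torus44 p)"
  proof (rule leaf_section[OF p5])
    have "leaf_model A.E ?\<rho>1 (\<lambda>l. c + l) (torus_grp p)" by (rule A.new_model) auto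
    then have "leaf_model AB.E ?\<rho> (\<lambda>l. c + l) (torus_grp p)" by (rule AB.old_model) simp
    then show "leaf_model AB.E ?\<rho> (\<lambda>l. T.branch False (c + l)) (torus_grp p)" unfolding branch by simp
    show "T.branch False (c + l) < d" if "l < 3" for l using that dc unfolding branch by simp
  qed
  have topB: "P.section_model 3 (\<lambda>l. T.branch True (c + l)) (torus44 m)"
  proof (rule leaf_section[OF m5])
    show "leaf_model AB.E ?\<rho> (\<lambda>l. T.branch True (c + l)) (torus_grp m)"
      by (rule AB.new_model) (simp_all only: branch, simp_all)
    show "T.branch True (c + l) < d" if "l < 3" for l using that dc unfolding branch by simp
  qed
  have square: "P.section_model 2 (T.branch b) four_gon" if c0: "c = 0" for b
  proof (rule P.section_model_cong[of 2 "\<lambda>l. l"])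
    show "l = T.branch b l" if "l < 2" for l using branch_id[of l b] that c0 by simp
    interpret L: square_coloured AB.E "Suc (Suc (c + 2))" c "c + 1" ?\<rho> "\<lambda>x. \<sigma> (core (core x))"
      by (rule AB.coloured_left)
    have l2: "l = 0 \<or> l = 1" if "l < 2" for l :: nat using that by auto
    have two: "(\<lambda>l. l) ` {..<2 :: nat} = {c, c + 1}" using c0 by auto
    show "P.section_model 2 (\<lambda>l. l) four_gon"
    proof (rule P.section_modelI[OF group_D4 L.colour_hom, where c=2 and \<eta>=dgen
        and \<psi>="\<lambda>x. tface (square_sym x)" and rk'=square_rank])
      show "l < d" if "l < 2" for l using that unfolding dc by simp
      show "\<sigma> (core (core (?\<rho> l))) = dgen l" if "l < 2" for l
        using L.colour_gens(1,2) l2[OF that] c0 by auto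
      show "g = \<one>\<^bsub>AB.E\<^esub>" if "g \<in> generate AB.E (?\<rho> ` (\<lambda>l. l) ` {..<2})" "\<sigma> (core (core g)) = \<one>\<^bsub>D4\<^esub>" for g
        using L.colour_inj that unfolding two by blast
      show "four_gon = flag_rel (carrier D4) (\<lambda>x. tface (square_sym x)) (int 2)"
        using four_gon_flag_rel by simp
      show "generate D4 (dgen ` {..<2}) = carrier D4" using D4_generated by auto
      show "square_rank (tface (square_sym x) k) = k" if "k \<in> {-1..int 2}" for x k
        by (rule square_rank) (use that in simp)
      show "tface (square_sym x) k = tface (square_sym y) k \<longleftrightarrow>
          inv\<^bsub>D4\<^esub> x \<otimes>\<^bsub>D4\<^esub> y \<in> generate D4 (dgen ` {l. l < 2 \<and> int l \<noteq> k})" if "k \<in> {-1..int 2}" for x y k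
        by (rule square_face_eq) (use that in simp)
    qed
  qed
  have type: "has_alternating_type d ?S rk (P.facets False) (P.facets True) n m"
    unfolding has_alternating_type_def
  proof (intro conjI ballI impI)
    have d1: "int d - 1 = int (d - 1)" unfolding dc by simp
    show "has_symbol (d - 1) (face_poset ?S F) rk (\<lambda>j. torus44 (n j))" if F: "F \<in> P.facets False" for F
    proof -
      obtain x where x: "x \<in> T.\<Omega>" "snd x = False" "F = \<phi> x (int d - 1)" using F by (rule P.facetsE)
      show ?thesis unfolding x(3) d1
      proof (rule P.face_symbol[OF x(1)])
        show "d - 1 < d" unfolding dc by simp
        fix j assume j: "j \<in> {3..d - 1}"
        show "P.section_model 3 (\<lambda>l. T.branch (snd x) (j - 3 + l)) (torus44 (n j))"
        proof (cases "j = c + 3")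
          case True then show ?thesis using topA x(2) unfolding p_def by simp
        next
          case False
          then have "j \<in> {3..d - 2}" using j unfolding dc by auto
          then show ?thesis by (rule low)
        qed
      qed
    qed
    show "has_symbol (d - 1) (face_poset ?S F) rk (\<lambda>j. torus44 ((n(d - 1 := m)) j))" if F: "F \<in> P.facets True" for F
    proof -
      obtain x where x: "x \<in> T.\<Omega>" "snd x = True" "F = \<phi> x (int d - 1)" using F by (rule P.facetsE)
      show ?thesis unfolding x(3) d1
      proof (rule P.face_symbol[OF x(1)])
        show "d - 1 < d" unfolding dc by simp
        fix j assume j: "j \<in> {3..d - 1}"
        show "P.section_model 3 (\<lambda>l. T.branch (snd x) (j - 3 + l)) (torus44 ((n(d - 1 := m)) j))"
        proof (cases "j = c + 3")
          case True then show ?thesis using topB x(2) unfolding dc by simp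
        next
          case False
          then have "j \<in> {3..d - 2}" "j \<noteq> d - 1" using j unfolding dc by auto
          then show ?thesis using low[of j "snd x"] by simp
        qed
      qed
    qed
    fix H assume "H \<in> faces_of_rank ?S rk (int d - 2)"
    then obtain x where x: "x \<in> T.\<Omega>" "H = \<phi> x (int d - 2)"
      using P.faces_of_rank_R[of "int d - 2"] unfolding dc by auto
    have d2: "int d - 2 = int (d - 2)" unfolding dc by simp
    show "if d = 4 then isomorphic_posets (face_poset ?S H) four_gon
          else has_symbol (d - 2) (face_poset ?S H) rk (\<lambda>j. torus44 (n j))"
    proof (cases "d = 4")
      case True
      then have "isomorphic_posets (face_poset ?S (\<phi> x (int 2))) four_gon"
        by (intro P.face_iso[OF x(1)] square) (simp_all add: dc)
      then show ?thesis using True x(2) by simp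
    next
      case False
      have "has_symbol (d - 2) (face_poset ?S (\<phi> x (int (d - 2)))) rk (\<lambda>j. torus44 (n j))"
        by (rule P.face_symbol[OF x(1) _ low]) (simp_all add: dc)
      then show ?thesis unfolding x(2) d2 by (simp only: False if_False)
    qed
  qed
  have fin: "finite (Field ?S)" by (rule P.finite_Field)
  have iso: "swap_leaves \<in> iso AB.E BA.E" by (rule swap_leaves_iso[OF am[OF p5] am[OF m5]])
  have swap_gen: "swap_leaves (?\<rho> i) = ?\<rho>' (swap_index (c + 2) i)" for i
    by (rule swap_leaves_gen) auto
  have pd: "n (d - 1) = p" unfolding p_def dc by (simp add: add.commute)
  have wrap: ?thesis
    if "alternating_semiregular (int d) ?S rk (P.facets False) (P.facets True)" "p_group 2 (aut_group ?S)"
      "p \<noteq> m \<longrightarrow> order (aut_group ?S) = 2 ^ e" "p = m \<longrightarrow> order (aut_group ?S) = 2 * 2 ^ e"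
    unfolding e_def[symmetric] pd
    by (intro exI[of _ ?S] exI[of _ rk] exI[of _ "P.facets False"] exI[of _ "P.facets True"] conjI fin type that)
  show ?thesis
  proof (cases "p = m")
    case True
    have gens: "?\<rho>' = ?\<rho>" using True by simp
    have idx: "swap_index (c + 2) (d - 2) = d - 1" "swap_index (c + 2) (d - 1) = d - 2"
      "i < d - 2 \<Longrightarrow> swap_index (c + 2) i = i" for i
      unfolding swap_index_def using dc by auto
    have "swap_leaves \<in> iso AB.E AB.E" using iso True by simp
    moreover have "swap_leaves (?\<rho> i) = ?\<rho> i" if "i < d - 2" for i
      using swap_gen[of i] unfolding idx(3)[OF that] gens .
    moreover have "swap_leaves (?\<rho> (d - 2)) = ?\<rho> (d - 1)" "swap_leaves (?\<rho> (d - 1)) = ?\<rho> (d - 2)"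
      using swap_gen[of "d - 2"] swap_gen[of "d - 1"] unfolding idx(1,2) gens .
    ultimately have alt: "alternating_semiregular (int d) ?S rk (P.facets False) (P.facets True)"
      and ord: "order (aut_group ?S) = 2 * card (carrier AB.E)"
      using P.equal_kinds[of swap_leaves] by blast+
    have "p_group 2 (aut_group ?S)"
      by (rule p_group_2I[OF group_aut_group, of _ "Suc e"]) (simp add: ord cE)
    moreover have "order (aut_group ?S) = 2 * 2 ^ e" unfolding ord cE ..
    ultimately show ?thesis using wrap[OF alt] True by blast
  next
    case False
    have cG0: "0 < card (carrier G)" unfolding cG by simp
    have idF: "T.branch False ` {..<d - 1} = {..<Suc (c + 2)}" using dc unfolding branch by auto
    have cardF: "card (generate AB.E (?\<rho> ` (T.branch False ` {..<d - 1}))) = card (carrier A.E)"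
      unfolding idF using AB.card_old[of "{..<Suc (c + 2)}"] A.par'_full by simp
    have cardT: "card (generate AB.E (?\<rho> ` (T.branch True ` {..<d - 1}))) = card (carrier B.E)"
    proof -
      let ?I = "T.branch True ` {..<d - 1}"
      have sI: "swap_index (c + 2) ` ?I = {..<Suc (c + 2)}"
      proof -
        have "swap_index (c + 2) (T.branch True l) = l" if "l \<in> {..<d - 1}" for l
          using that dc unfolding branch swap_index_def by auto
        then have "swap_index (c + 2) ` ?I = (\<lambda>l. l) ` {..<d - 1}"
          unfolding image_image by (rule image_cong[OF refl])
        then show ?thesis unfolding dc by auto
      qed
      interpret h: group_hom AB.E BA.E swap_leaves
        using iso by (intro group_hom.intro group_hom_axioms.intro AB.group_E BA.group_E) (auto simp: iso_def)
      have Id: "?I \<subseteq> {..<d}" using T.branch_less by auto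
      have "swap_leaves ` generate AB.E (?\<rho> ` ?I) = generate BA.E (swap_leaves ` ?\<rho> ` ?I)"
        using h.generate_img[OF T.gens_closed[OF Id]] by simp
      also have "swap_leaves ` ?\<rho> ` ?I = ?\<rho>' ` {..<Suc (c + 2)}"
        unfolding sI[symmetric] image_image swap_gen ..
      finally have im: "swap_leaves ` generate AB.E (?\<rho> ` ?I) = generate BA.E (?\<rho>' ` {..<Suc (c + 2)})" .
      have "inj_on swap_leaves (generate AB.E (?\<rho> ` ?I))"
        by (rule inj_on_subset[of _ "carrier AB.E"]) (use iso T.par_carrier[OF Id] in \<open>auto simp: iso_def bij_betw_def\<close>)
      then have "card (generate AB.E (?\<rho> ` ?I)) = card (generate BA.E (?\<rho>' ` {..<Suc (c + 2)}))"
        using card_image im by metis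
      also have "\<dots> = card (carrier B.E)" using BA.card_old[of "{..<Suc (c + 2)}"] B.par'_full by simp
      finally show ?thesis .
    qed
    have "card (carrier A.E) \<noteq> card (carrier B.E)"
    proof
      assume "card (carrier A.E) = card (carrier B.E)"
      then have "(2 :: int) ^ (p - 3) = 2 ^ (m - 3)" using cA cB cG0 by simp
      then have "p - 3 = m - 3" by simp
      then show False using False p5 m5 by simp
    qed
    then have ne: "card (generate AB.E (?\<rho> ` (T.branch False ` {..<d - 1}))) \<noteq> card (generate AB.E (?\<rho> ` (T.branch True ` {..<d - 1})))"
      unfolding cardF cardT .
    have alt: "alternating_semiregular (int d) ?S rk (P.facets False) (P.facets True)"
      and ord: "order (aut_group ?S) = card (carrier AB.E)"
      using P.distinct_kinds[OF ne] by blast+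
    have "p_group 2 (aut_group ?S)"
      by (rule p_group_2I[OF group_aut_group, of _ e]) (simp add: ord cE)
    moreover have "order (aut_group ?S) = 2 ^ e" unfolding ord cE ..
    ultimately show ?thesis using wrap[OF alt] False by blast
  qed
qed

theorem theorem6p1:
  fixes d m :: nat and n :: "nat \<Rightarrow> nat"
  assumes "d \<ge> 4"
    and "\<And>j. j \<in> {3..d - 1} \<Longrightarrow> n j \<ge> 5"
    and "m \<ge> 5"
  shows "\<exists>(S :: nat rel) rk A B.
    finite (Field S) \<and>
    alternating_semiregular (int d) S rk A B \<and>
    has_alternating_type d S rk A B n m \<and>
    p_group 2 (aut_group S) \<and>
    (n (d - 1) \<noteq> m \<longrightarrow>
       order (aut_group S) = 2 ^ ((\<Sum>j = 3..d - 1. n j) + m - 3 * (d - 3))) \<and>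
    (n (d - 1) = m \<longrightarrow>
       order (aut_group S) = 2 * 2 ^ ((\<Sum>j = 3..d - 1. n j) + m - 3 * (d - 3)))"
proof -
  have "d = Suc (Suc ((d - 4) + 2))" using assms(1) by simp
  then show ?thesis using semiregular_tower[of "d - 4" n m] assms(2,3) by metis
qed

end
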